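(* Consider the system $$\dot\alpha=\omega(A)+\varepsilon F(\alpha,A,C,t),\qquad \dot A=\varepsilon G(\alpha,A,C,t),$$ and let $A_0\in W$ be such that $\omega(A_0)=p/q$. Assume that: (i) $\omega'(A_0)\neq 0$; (ii) there exists an analytic curve $t\mapsto C_0(t)$ from $[0,2\pi)$ to $\mathbb{R}$, $2\pi$-periodic, such that $M(t_0,C_0(t_0))=0$ and $\frac{\partial M}{\partial C}(t_0,C_0(t_0))\neq 0$ for all $t_0\in[0,2\pi)$, where $M$ is the subharmonic Melnikov function; (iii) there exists $k\ge 1$ such that the functions $C_j(t_0)$ (defined in the context) are identically constant in $t_0$ for all $j=0,\dots,k-1$, and, if $t_m$ and $t_M$ are the values in $[0,2\pi)$ for which the function $C_k(t_0)$ attains its minimum and its maximum, respectively, then $C_k''(t_m)\,C_k''(t_M)\neq 0$. Then there exist $\varepsilon_0>0$ and two functions $\widetilde\gamma_1(\varepsilon)$ and $\widetilde\gamma_2(\varepsilon)$, analytic for $|\varepsilon|<\varepsilon_0$, with $\widetilde\gamma_1(0)=\widetilde\gamma_2(0)$ and $\widetilde\gamma_1(\varepsilon)\neq\widetilde\gamma_2(\varepsilon)$ for all $\varepsilon\neq 0$, such that the two functions $$\gamma_1(\varepsilon)=\begin{cases}\max\{\widetilde\gamma_1(\varepsilon),\widetilde\gamma_2(\varepsilon)\},&\varepsilon>0,\\ \min\{\widetilde\gamma_1(\varepsilon),\widetilde\gamma_2(\varepsilon)\},&\varepsilon<0,\end{cases}\qquad \gamma_2(\varepsilon)=\begin{cases}\min\{\widetilde\gamma_1(\varepsilon),\widetilde\gamma_2(\varepsilon)\},&\varepsilon>0,\\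 \max\{\widetilde\gamma_1(\varepsilon),\widetilde\gamma_2(\varepsilon)\},&\varepsilon<0,\end{cases}$$ (extended to $\varepsilon=0$ by the common value $\widetilde\gamma_1(0)=\widetilde\gamma_2(0)$) have the same tangent lines at the origin, and the system has at least one subharmonic solution of order $q/p$ for $\gamma_2(\varepsilon)\le\varepsilon C\le\gamma_1(\varepsilon)$ when $\varepsilon\in(0,\varepsilon_0)$ and for $\gamma_1(\varepsilon)\le\varepsilon C\le\gamma_2(\varepsilon)$ when $\varepsilon\in(-\varepsilon_0,0)$.
   Context: Here $(\alpha,A)\in\mathbb{T}\times W$ with $\mathbb{T}=\mathbb{R}/2\pi\mathbb{Z}$ and $W\subset\mathbb{R}$ open; $\omega:W\to\mathbb{R}$ is analytic; $F,G$ are real-valued, analytic in their arguments, and $2\pi$-periodic in $\alpha$ and $t$; $\varepsilon,C$ are real parameters; $p,q$ are relatively prime nonzero integers with $q\ge1$; $T=2\pi q$. Primes on $C_k$ denote derivatives with respect to $t_0$. Subharmonic Melnikov function: with $\alpha_0(t)=\omega(A_0)t$, $$M(t_0,C)=\frac1T\int_0^T G(\alpha_0(t),A_0,C,t+t_0)\,dt .$$ Functions $C_k(t_0)$: under (i) and (ii), for each $t_0$ there are unique formal power series $\alpha(t)=\omega(A_0)t+\sum_{k\ge1}\varepsilon^k\alpha^{(k)}(t)$, $A(t)=A_0+\sum_{k\ge1}\varepsilon^kA^{(k)}(t)$, $C=C_0(t_0)+\sum_{k\ge1}\varepsilon^kC_k(t_0)$ such that all $\alpha^{(k)},A^{(k)}$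 are $T$-periodic, each $\alpha^{(k)}$ has zero mean over $[0,T]$, and the equations $\dot\alpha=\omega(A)+\varepsilon F(\alpha,A,C,t+t_0)$, $\dot A=\varepsilon G(\alpha,A,C,t+t_0)$ hold to all orders in $\varepsilon$. The $C_k(t_0)$, $k\ge0$, are the coefficients of the last series; they are $2\pi$-periodic in $t_0$. Subharmonic solution of order $q/p$ at parameter values $(\varepsilon_*,C_* )$: a solution $(\alpha(t),A(t))$ of the system such that $A(t)$ and $\alpha(t)-(p/q)t$ are periodic with period $T=2\pi q$ and which continues an unperturbed solution on the torus $\{A=A_0\}$, i.e. it is the member at $\varepsilon=\varepsilon_*$ of a family of such solutions depending analytically on $\varepsilon$ in an interval containing $0$ and $\varepsilon_*$, corresponding to an analytic choice $C=C(\varepsilon)$ of the parameter with $\varepsilon_*C(\varepsilon_* )=\varepsilon_*C_*$, and reducing at $\varepsilon=0$ to $((p/q)t+\mathrm{const},A_0)$. *)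

theory Defs
  imports "HOL-Analysis.Analysis"
begin

(* Real analyticity in several variables: near every point of S the function is the sum of an
   unconditionally (equivalently, absolutely) convergent power series in the coordinates, indexed
   by the multi-indices m.  On the type real there is just one coordinate.  The series has to
   represent f on a full ball, so the definition is meant for open S. *)
definition real_analytic_on :: "('a::euclidean_space \<Rightarrow> real) \<Rightarrow> 'a set \<Rightarrow> bool" where
  "real_analytic_on f S \<longleftrightarrow>
     (\<forall>x\<in>S. \<exists>r>0. \<exists>c :: ('a \<Rightarrow> nat) \<Rightarrow> real. \<forall>y\<in>ball x r.
        ((\<lambda>m. c m * (\<Prod>b\<in>Basis. ((y - x) \<bullet> b) ^ m b)) has_sum f y) (Basis \<rightarrow>\<^sub>E UNIV))"

definition periodic_with :: "real \<Rightarrow> (real \<Rightarrow> real) \<Rightarrow> bool" where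
  "periodic_with T f \<longleftrightarrow> (\<forall>t. f (t + T) = f t)"

definition Melnikov ::
  "(real \<Rightarrow> real) \<Rightarrow> (real \<Rightarrow> real \<Rightarrow> real \<Rightarrow> real \<Rightarrow> real) \<Rightarrow> int \<Rightarrow> real \<Rightarrow> real \<Rightarrow> real \<Rightarrow> real" where
  "Melnikov \<omega> G q A0 t0 C =
     (let T = 2 * pi * of_int q
      in 1 / T * integral {0..T} (\<lambda>t. G (\<omega> A0 * t) A0 C (t + t0)))"

definition fps_trunc :: "nat \<Rightarrow> real fps \<Rightarrow> real \<Rightarrow> real" where
  "fps_trunc n f \<epsilon> = (\<Sum>k\<le>n. fps_nth f k * \<epsilon> ^ k)"

definition eps_coeff :: "nat \<Rightarrow> (real \<Rightarrow> real) \<Rightarrow> real" where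
  "eps_coeff n h = (deriv ^^ n) h 0 / fact n"

(* Formal T-periodic solution with T = 2 pi q, for phase t0.  The n-th coefficient of an analytic
   function of formal power series depends only on their coefficients up to order n, so it is the
   n-th Taylor coefficient at 0 of the function evaluated at the truncated series.  Thus the last
   conjunct is the system of differential equations holding to all orders. *)
definition formal_subharmonic ::
  "(real \<Rightarrow> real) \<Rightarrow> (real \<Rightarrow> real \<Rightarrow> real \<Rightarrow> real \<Rightarrow> real) \<Rightarrow> (real \<Rightarrow> real \<Rightarrow> real \<Rightarrow> real \<Rightarrow> real) \<Rightarrow> int \<Rightarrow>
   real \<Rightarrow> real \<Rightarrow> real \<Rightarrow> (real \<Rightarrow> real fps) \<Rightarrow> (real \<Rightarrow> real fps) \<Rightarrow> real fps \<Rightarrow> bool" where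
  "formal_subharmonic \<omega> F G q A0 c0 t0 \<alpha> A C \<longleftrightarrow>
     (let T = 2 * pi * of_int q in
       (\<forall>t. fps_nth (\<alpha> t) 0 = \<omega> A0 * t) \<and> (\<forall>t. fps_nth (A t) 0 = A0) \<and> fps_nth C 0 = c0 \<and>
       (\<forall>k\<ge>1. periodic_with T (\<lambda>t. fps_nth (\<alpha> t) k) \<and> periodic_with T (\<lambda>t. fps_nth (A t) k) \<and>
          ((\<lambda>t. fps_nth (\<alpha> t) k) has_integral 0) {0..T}) \<and>
       (\<forall>n t.
          ((\<lambda>s. fps_nth (\<alpha> s) n) has_real_derivative
             eps_coeff n (\<lambda>\<epsilon>. \<omega> (fps_trunc n (A t) \<epsilon>) +
               \<epsilon> * F (fps_trunc n (\<alpha> t) \<epsilon>) (fps_trunc n (A t) \<epsilon>) (fps_trunc n C \<epsilon>) (t + t0))) (at t) \<and>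
          ((\<lambda>s. fps_nth (A s) n) has_real_derivative
             eps_coeff n (\<lambda>\<epsilon>.
               \<epsilon> * G (fps_trunc n (\<alpha> t) \<epsilon>) (fps_trunc n (A t) \<epsilon>) (fps_trunc n C \<epsilon>) (t + t0))) (at t)))"

(* C_coeff ... k t0 is C_k(t0); C0 is the whole curve t0 \<mapsto> C_0(t0). *)
definition C_coeff ::
  "(real \<Rightarrow> real) \<Rightarrow> (real \<Rightarrow> real \<Rightarrow> real \<Rightarrow> real \<Rightarrow> real) \<Rightarrow> (real \<Rightarrow> real \<Rightarrow> real \<Rightarrow> real \<Rightarrow> real) \<Rightarrow> int \<Rightarrow>
   real \<Rightarrow> (real \<Rightarrow> real) \<Rightarrow> nat \<Rightarrow> real \<Rightarrow> real" where
  "C_coeff \<omega> F G q A0 C0 k t0 =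
     fps_nth (THE C. \<exists>\<alpha> A. formal_subharmonic \<omega> F G q A0 (C0 t0) t0 \<alpha> A C) k"

(* The angle is represented by a real-valued lift. *)
definition system_solution ::
  "real set \<Rightarrow> (real \<Rightarrow> real) \<Rightarrow> (real \<Rightarrow> real \<Rightarrow> real \<Rightarrow> real \<Rightarrow> real) \<Rightarrow>
   (real \<Rightarrow> real \<Rightarrow> real \<Rightarrow> real \<Rightarrow> real) \<Rightarrow> real \<Rightarrow> real \<Rightarrow> (real \<Rightarrow> real) \<Rightarrow> (real \<Rightarrow> real) \<Rightarrow> bool" where
  "system_solution W \<omega> F G \<epsilon> C \<alpha> A \<longleftrightarrow>
     (\<forall>t. A t \<in> W \<and>
        (\<alpha> has_real_derivative \<omega> (A t) + \<epsilon> * F (\<alpha> t) (A t) C t) (at t) \<and>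
        (A has_real_derivative \<epsilon> * G (\<alpha> t) (A t) C t) (at t))"

definition periodic_solution ::
  "real set \<Rightarrow> (real \<Rightarrow> real) \<Rightarrow> (real \<Rightarrow> real \<Rightarrow> real \<Rightarrow> real \<Rightarrow> real) \<Rightarrow>
   (real \<Rightarrow> real \<Rightarrow> real \<Rightarrow> real \<Rightarrow> real) \<Rightarrow> int \<Rightarrow> int \<Rightarrow> real \<Rightarrow> real \<Rightarrow>
   (real \<Rightarrow> real) \<Rightarrow> (real \<Rightarrow> real) \<Rightarrow> bool" where
  "periodic_solution W \<omega> F G p q \<epsilon> C \<alpha> A \<longleftrightarrow>
     system_solution W \<omega> F G \<epsilon> C \<alpha> A \<and>
     periodic_with (2 * pi * of_int q) A \<and>
     periodic_with (2 * pi * of_int q) (\<lambda>t. \<alpha> t - of_int p / of_int q * t)"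

definition subharmonic_solution ::
  "real set \<Rightarrow> (real \<Rightarrow> real) \<Rightarrow> (real \<Rightarrow> real \<Rightarrow> real \<Rightarrow> real \<Rightarrow> real) \<Rightarrow>
   (real \<Rightarrow> real \<Rightarrow> real \<Rightarrow> real \<Rightarrow> real) \<Rightarrow> int \<Rightarrow> int \<Rightarrow> real \<Rightarrow> real \<Rightarrow> real \<Rightarrow>
   (real \<Rightarrow> real) \<Rightarrow> (real \<Rightarrow> real) \<Rightarrow> bool" where
  "subharmonic_solution W \<omega> F G p q A0 \<epsilon>s Cs \<alpha> A \<longleftrightarrow>
     periodic_solution W \<omega> F G p q \<epsilon>s Cs \<alpha> A \<and>
     (\<exists>J \<alpha>' A' C'. is_interval J \<and> open J \<and> 0 \<in> J \<and> \<epsilon>s \<in> J \<and>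
        real_analytic_on C' J \<and>
        (\<forall>t. real_analytic_on (\<lambda>\<epsilon>. \<alpha>' \<epsilon> t) J \<and> real_analytic_on (\<lambda>\<epsilon>. A' \<epsilon> t) J) \<and>
        (\<forall>\<epsilon>\<in>J. periodic_solution W \<omega> F G p q \<epsilon> (C' \<epsilon>) (\<alpha>' \<epsilon>) (A' \<epsilon>)) \<and>
        \<epsilon>s * C' \<epsilon>s = \<epsilon>s * Cs \<and>
        (\<exists>\<theta>. \<forall>t. \<alpha>' 0 t = of_int p / of_int q * t + \<theta>) \<and> (\<forall>t. A' 0 t = A0) \<and>
        \<alpha>' \<epsilon>s = \<alpha> \<and> A' \<epsilon>s = A)"

end

theory Submission
  imports Defs "HOL-Complex_Analysis.Complex_Analysis"
begin

text \<open>
The unperturbed torus carries one periodic solution for every phase \<open>p\<close>. Look for solutions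
\<open>\<alpha>(t) = \<omega>(A0) (t - p) + a\<close>, \<open>A(t) = A0 + b\<close> at the parameter value \<open>C = C0(p) + c\<close>, where \<open>a\<close> and \<open>b\<close>
are functions of \<open>t - p\<close> with period \<open>T = 2 \<pi> q\<close> and \<open>a\<close> has zero mean. They have to satisfy
\<open>a' = v(b) + \<epsilon> f\<close> and \<open>b' = \<epsilon> g\<close>, where \<open>v(b) = \<omega>(A0 + b) - \<omega>(A0)\<close> and \<open>f\<close>, \<open>g\<close> are \<open>F\<close>, \<open>G\<close> in the
new variables. A periodic function has a periodic primitive if and only if its mean vanishes, so both
right hand sides need zero mean. The first of these two scalar conditions can be solved for the mean of \<open>b\<close> because
\<open>\<omega>'(A0) \<noteq> 0\<close>; the second can be solved for \<open>c\<close> because the mean of \<open>g\<close> at \<open>a = b = c = 0\<close> is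
\<open>M(p, C0(p)) = 0\<close> and its derivative in \<open>c\<close> is \<open>\<partial>M/\<partial>C \<noteq> 0\<close>. Solving them by a Newton step and the
differential equations by zero-mean primitives gives a map \<open>\<Phi>\<close> which, in suitable weights, is a
contraction uniformly in \<open>p\<close> (\<open>contraction\<close>). It acts on complex \<open>\<epsilon>\<close> and preserves holomorphy in
\<open>\<epsilon>\<close> and joint continuity, and so do uniform limits; hence the fixed point consists of functions
\<open>a(\<epsilon>, p, t)\<close>, \<open>b(\<epsilon>, p, t)\<close>, \<open>c(\<epsilon>, p)\<close> that are holomorphic in \<open>\<epsilon>\<close> on a disc independent of \<open>p\<close> and
continuous in all variables (\<open>periodic_solution_families\<close>).

For every phase this is a family of subharmonic solutions along the analytic curve
\<open>C(\<epsilon>, p) = C0(p) + c(\<epsilon>, p)\<close>. For fixed \<open>\<epsilon>\<close> the intermediate value theorem in \<open>p\<close> shows that every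
value between \<open>\<epsilon> C(\<epsilon>, tM)\<close> and \<open>\<epsilon> C(\<epsilon>, tm)\<close> is of the form \<open>\<epsilon> C(\<epsilon>, p)\<close>. So these two functions of
\<open>\<epsilon>\<close>, at the two fixed phases \<open>tM\<close> and \<open>tm\<close>, serve as boundary curves: they are analytic, vanish at \<open>0\<close>,
and their derivatives there are \<open>C0(tM)\<close> and \<open>C0(tm)\<close>, which are equal because \<open>k \<ge> 1\<close>.
A function that selects one of two curves with a common tangent has that tangent too, which covers the maximum and the minimum.

It remains to see that the two curves separate for \<open>\<epsilon> \<noteq> 0\<close>. The Taylor coefficients of \<open>a\<close>, \<open>b\<close> and \<open>c\<close>
form a formal periodic solution (\<open>formal_subharmonic_of_families\<close>), and the formal solution is unique
(\<open>formal_subharmonic_unique\<close>): at order \<open>m + 1\<close> the \<open>A\<close>-equation determines \<open>C\<^sub>m\<close> through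
\<open>\<partial>M/\<partial>C \<noteq> 0\<close>, and the \<open>\<alpha>\<close>-equation determines the mean of the coefficient of \<open>A\<close> of that order
through \<open>\<omega>'(A0) \<noteq> 0\<close>. Hence the functions \<open>C\<^sub>k\<close> of the hypotheses are the Taylor coefficients of \<open>C(\<epsilon>, p)\<close>. If \<open>C\<^sub>k\<close> had the same value
at \<open>tm\<close> and \<open>tM\<close>, it would be constant on a period, hence constant, and its second derivative would
vanish. So \<open>C(\<epsilon>, tM) - C(\<epsilon>, tm)\<close> is not identically zero, and its zero at \<open>\<epsilon> = 0\<close> is isolated.

The contraction needs \<open>F\<close>, \<open>G\<close> and \<open>\<omega>\<close> on a complex neighbourhood of uniform size, whereas real
analyticity only provides a power series near each real point. The definition \<open>cext\<close> assigns to each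
complex point near the reals a value that does not refer to a centre of expansion; compactness of the
set of phases and times modulo periods then gives a uniform radius (\<open>complex_family_cext\<close>).
\<close>

section \<open>Taylor coefficients and parameter integrals of holomorphic functions\<close>

definition taylor_coeff :: "nat \<Rightarrow> (complex \<Rightarrow> complex) \<Rightarrow> complex" where
  "taylor_coeff n \<phi> = (deriv ^^ n) \<phi> 0 / fact n"

text \<open>
A complex derivative may be computed along the real axis, where all difference quotients are real.
\<close>

lemma has_real_derivative_of_complexification:
  assumes \<phi>: "(\<phi> has_field_derivative D) (at (complex_of_real x))"
    and eq: "eventually (\<lambda>y. \<phi> (of_real y) = of_real (h y)) (nhds x)"
  shows "(h has_real_derivative Re D) (at x)" and "D = of_real (Re D)"
proof -
  have "((\<lambda>y. \<phi> (of_real y)) has_vector_derivative D) (at x)"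
    using has_vector_derivative_real_field[OF \<phi>] .
  then have D: "((\<lambda>y. complex_of_real (h y)) has_vector_derivative D) (at x)"
    using has_vector_derivative_cong_ev[where x=x and S=UNIV and f="\<lambda>y. \<phi> (of_real y)"
        and g="\<lambda>y. complex_of_real (h y)" and f'=D] eq eventually_nhds_x_imp_x[OF eq] by simp
  show R: "(h has_real_derivative Re D) (at x)"
    using has_field_derivative_Re[OF D] by simp
  have "((\<lambda>y. complex_of_real (h y)) has_vector_derivative of_real (Re D)) (at x)"
    using R by (intro has_vector_derivative_of_real) (simp add: has_real_derivative_iff_has_vector_derivative)
  with D show "D = of_real (Re D)"
    using vector_derivative_unique_at by blast
qed

text \<open>
This links the iterated real derivative in \<open>eps_coeff\<close> to the complex one. The induction runs over all
real points of the disc, since the next derivative at \<open>0\<close> depends on the previous one near \<open>0\<close>.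
\<close>

lemma taylor_coeff_complexification:
  assumes hol: "\<phi> holomorphic_on ball 0 e" and e: "e > 0"
    and eq: "\<And>x. \<bar>x\<bar> < e \<Longrightarrow> \<phi> (complex_of_real x) = of_real (h x)"
  shows "taylor_coeff n \<phi> = of_real (eps_coeff n h)"
proof -
  have "(deriv ^^ n) \<phi> (of_real x) = of_real ((deriv ^^ n) h x)" if "\<bar>x\<bar> < e" for x
    using that
  proof (induction n arbitrary: x)
    case 0
    then show ?case by (simp add: eq)
  next
    case (Suc n)
    have "(deriv ^^ n) \<phi> holomorphic_on ball 0 e"
      by (intro holomorphic_higher_deriv hol) auto
    then have 1: "((deriv ^^ n) \<phi> has_field_derivative deriv ((deriv ^^ n) \<phi>) (of_real x)) (at (of_real x))"
      by (rule holomorphic_derivI) (use Suc.prems in auto)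
    have "eventually (\<lambda>y. y \<in> {-e<..<e}) (nhds x)"
      by (rule eventually_nhds_in_open) (use Suc.prems in auto)
    then have 2: "eventually (\<lambda>y. (deriv ^^ n) \<phi> (of_real y) = of_real ((deriv ^^ n) h y)) (nhds x)"
      by eventually_elim (rule Suc.IH, auto)
    show ?case
      using has_real_derivative_of_complexification[OF 1 2] DERIV_imp_deriv by fastforce
  qed
  from this[of 0] show ?thesis
    using e by (simp add: taylor_coeff_def eps_coeff_def)
qed

lemma norm_taylor_coeff_le:
  assumes "\<phi> holomorphic_on ball 0 e" "0 < \<rho>" "\<rho> < e" "\<And>x. norm x = \<rho> \<Longrightarrow> norm (\<phi> x) \<le> B"
  shows "norm (taylor_coeff n \<phi>) \<le> B / \<rho> ^ n"
proof -
  have "norm ((deriv ^^ n) \<phi> 0) \<le> fact n * B / \<rho> ^ n"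
  proof (rule Cauchy_inequality)
    show "\<phi> holomorphic_on ball 0 \<rho>"
      using assms by (intro holomorphic_on_subset[OF assms(1)]) auto
    show "continuous_on (cball 0 \<rho>) \<phi>"
      using assms by (intro holomorphic_on_imp_continuous_on holomorphic_on_subset[OF assms(1)]) auto
  qed (use assms in auto)
  then show ?thesis
    by (simp add: taylor_coeff_def norm_divide field_simps)
qed

text \<open>
Cauchy's estimate on circles whose radius tends to \<open>0\<close>.
\<close>

lemma taylor_coeff_eq_0:
  assumes hol: "\<phi> holomorphic_on ball 0 e" and e: "e > 0"
    and le: "\<And>x. norm x < e \<Longrightarrow> norm (\<phi> x) \<le> K * norm x ^ Suc n"
  shows "taylor_coeff n \<phi> = 0"
proof -
  have *: "norm (taylor_coeff n \<phi>) \<le> K * \<rho>" if "0 < \<rho>" "\<rho> < e" for \<rho>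
  proof -
    have "norm (taylor_coeff n \<phi>) \<le> K * \<rho> ^ Suc n / \<rho> ^ n"
      by (rule norm_taylor_coeff_le[OF hol that]) (use le that in auto)
    with that show ?thesis by simp
  qed
  have "((\<lambda>\<rho>. K * \<rho>) \<longlongrightarrow> K * 0) (at_right 0)"
    by (intro tendsto_intros)
  moreover have "eventually (\<lambda>\<rho>. norm (taylor_coeff n \<phi>) \<le> K * \<rho>) (at_right 0)"
    using eventually_at_right_less[of 0] eventually_at_right_real[OF e]
    by eventually_elim (use * in auto)
  ultimately have "norm (taylor_coeff n \<phi>) \<le> K * 0"
    by (rule tendsto_lowerbound) auto
  then show ?thesis by simp
qed

lemma taylor_coeff_diff:
  assumes "\<phi> holomorphic_on ball 0 e" "\<psi> holomorphic_on ball 0 e" "e > 0"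
  shows "taylor_coeff n (\<lambda>x. \<phi> x - \<psi> x) = taylor_coeff n \<phi> - taylor_coeff n \<psi>"
  using higher_deriv_diff[OF assms(1,2) open_ball, of 0 n] assms(3)
  by (simp add: taylor_coeff_def diff_divide_distrib)

lemma taylor_coeff_cmult:
  assumes "\<phi> holomorphic_on ball 0 e" "e > 0"
  shows "taylor_coeff n (\<lambda>x. c * \<phi> x) = c * taylor_coeff n \<phi>"
  using higher_deriv_cmult[OF assms(1) _ open_ball, of 0 n c] assms(2)
  by (simp add: taylor_coeff_def)

lemma taylor_coeff_monomial: "taylor_coeff n (\<lambda>x. c * x ^ n) = c"
proof -
  have "(\<lambda>x::complex. c * x ^ n) has_fps_expansion (fps_const c * fps_X ^ n)"
    by (intro fps_expansion_intros)
  then have "fps_nth (fps_const c * fps_X ^ n) n = taylor_coeff n (\<lambda>x. c * x ^ n)"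
    unfolding taylor_coeff_def by (rule fps_nth_fps_expansion)
  then show ?thesis by simp
qed

text \<open>
Coefficients of composed functions are compared through this estimate, which avoids expanding any
composition of power series.
\<close>

lemma taylor_coeff_eq_cong:
  assumes "\<phi> holomorphic_on ball 0 e" "\<psi> holomorphic_on ball 0 e" "e > 0"
    and le: "\<And>x. norm x < e \<Longrightarrow> norm (\<phi> x - \<psi> x - c * x ^ n) \<le> K * norm x ^ Suc n"
  shows "taylor_coeff n \<phi> - taylor_coeff n \<psi> = c"
proof -
  have "taylor_coeff n (\<lambda>x. \<phi> x - \<psi> x - c * x ^ n) = 0"
    by (rule taylor_coeff_eq_0[OF _ assms(3) le]) (auto intro!: holomorphic_intros assms)
  moreover have "taylor_coeff n (\<lambda>x. \<phi> x - \<psi> x - c * x ^ n)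
    = taylor_coeff n (\<lambda>x. \<phi> x - \<psi> x) - taylor_coeff n (\<lambda>x. c * x ^ n)"
    by (rule taylor_coeff_diff) (auto intro!: holomorphic_intros assms)
  ultimately show ?thesis
    using taylor_coeff_diff[OF assms(1-3)] by (simp add: taylor_coeff_monomial)
qed

lemma taylor_remainder:
  assumes hol: "\<phi> holomorphic_on ball 0 e" and e: "e > 0"
  obtains K where "K \<ge> 0"
    "\<And>x. norm x < e / 2 \<Longrightarrow> norm (\<phi> x - (\<Sum>j\<le>n. taylor_coeff j \<phi> * x ^ j)) \<le> K * norm x ^ Suc n"
proof -
  have hd: "(deriv ^^ i) \<phi> holomorphic_on ball 0 e" for i
    by (intro holomorphic_higher_deriv hol) auto
  have sub: "cball 0 (e/2) \<subseteq> ball (0::complex) e" using e by auto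
  have "compact ((deriv ^^ Suc n) \<phi> ` cball 0 (e/2))"
    by (intro compact_continuous_image holomorphic_on_imp_continuous_on
        holomorphic_on_subset[OF hd sub]) auto
  then obtain B where B: "B > 0" "\<And>x. x \<in> cball 0 (e/2) \<Longrightarrow> norm ((deriv ^^ Suc n) \<phi> x) \<le> B"
    unfolding bounded_pos ball_simps image_iff by (auto dest!: compact_imp_bounded simp: bounded_pos)
  show ?thesis
  proof (rule that[of "B / fact n"])
    fix x :: complex assume x: "norm x < e / 2"
    have "norm ((deriv ^^ 0) \<phi> x - (\<Sum>i\<le>n. (deriv ^^ i) \<phi> 0 * (x - 0) ^ i / fact i))
      \<le> B * norm (x - 0) ^ Suc n / fact n"
    proof (rule complex_Taylor[of "cball 0 (e/2)" n "\<lambda>i. (deriv ^^ i) \<phi>" B 0 x])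
      fix i and y :: complex assume y: "y \<in> cball 0 (e/2)"
      have "((deriv ^^ i) \<phi> has_field_derivative deriv ((deriv ^^ i) \<phi>) y) (at y)"
        by (rule holomorphic_derivI[OF hd]) (use y sub in auto)
      then show "((deriv ^^ i) \<phi> has_field_derivative (deriv ^^ Suc i) \<phi> y) (at y within cball 0 (e/2))"
        by (simp add: has_field_derivative_at_within)
    qed (use B x e in auto)
    then show "norm (\<phi> x - (\<Sum>j\<le>n. taylor_coeff j \<phi> * x ^ j)) \<le> B / fact n * norm x ^ Suc n"
      by (simp add: taylor_coeff_def)
  qed (use B in auto)
qed

text \<open>
Cauchy's estimate on the circle of radius \<open>e / 2\<close> bounds the \<open>n\<close>-th coefficient of the remainder
\<open>R s\<close> of the first order expansion in time. On that circle the remainder is \<open>o(s - t)\<close> uniformly, by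
uniform continuity of \<open>\<phi>'\<close> on a compact set.
\<close>

lemma has_vector_derivative_taylor_coeff:
  fixes \<phi> \<phi>' :: "complex \<Rightarrow> real \<Rightarrow> complex"
  assumes e: "e > 0"
    and hol: "\<And>t. (\<lambda>x. \<phi> x t) holomorphic_on ball 0 e" "\<And>t. (\<lambda>x. \<phi>' x t) holomorphic_on ball 0 e"
    and der: "\<And>x t. norm x < e \<Longrightarrow> (\<phi> x has_vector_derivative \<phi>' x t) (at t)"
    and cont: "continuous_on (ball 0 e \<times> UNIV) (\<lambda>(x, t). \<phi>' x t)"
  shows "((\<lambda>t. taylor_coeff n (\<lambda>x. \<phi> x t)) has_vector_derivative
           taylor_coeff n (\<lambda>x. \<phi>' x t)) (at t)"
proof -
  define \<rho> where "\<rho> = e / 2"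
  have \<rho>: "0 < \<rho>" "\<rho> < e" using e by (auto simp: \<rho>_def)
  define R where "R = (\<lambda>s x. \<phi> x s - \<phi> x t - of_real (s - t) * \<phi>' x t)"
  have small: "\<exists>d>0. \<forall>s. norm (s - t) < d \<longrightarrow>
      norm (taylor_coeff n (R s)) \<le> \<eta> * norm (s - t)" if \<eta>: "\<eta> > 0" for \<eta>
  proof -
    define \<eta>' where "\<eta>' = \<eta> * \<rho> ^ n"
    have \<eta>': "\<eta>' > 0" using \<eta> \<rho> by (simp add: \<eta>'_def)
    have "uniformly_continuous_on (cball 0 \<rho> \<times> cball t 1) (\<lambda>(x, t). \<phi>' x t)"
      by (intro compact_uniformly_continuous continuous_on_subset[OF cont] compact_Times) (use \<rho> in auto)
    from uniformly_continuous_onE[OF this \<eta>'] obtain d where d: "d > 0" and dd: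
      "\<And>u v. u \<in> cball 0 \<rho> \<times> cball t 1 \<Longrightarrow> v \<in> cball 0 \<rho> \<times> cball t 1 \<Longrightarrow> dist v u < d \<Longrightarrow>
        dist (case v of (x, t) \<Rightarrow> \<phi>' x t) (case u of (x, t) \<Rightarrow> \<phi>' x t) < \<eta>'"
      by blast
    have near: "norm (\<phi>' x s - \<phi>' x t) \<le> \<eta>'" if "norm x = \<rho>" "norm (s - t) < min d 1" for x s
    proof -
      have "\<bar>t - s\<bar> \<le> 1" using that(2) by (simp add: abs_minus_commute)
      then have "dist (\<phi>' x s) (\<phi>' x t) < \<eta>'"
        using dd[of "(x, t)" "(x, s)"] that by (simp add: dist_norm dist_Pair_Pair)
      then show ?thesis by (simp add: dist_norm)
    qed
    show ?thesis
    proof (intro exI[of _ "min d 1"] conjI allI impI)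
      fix s assume s: "norm (s - t) < min d 1"
      have bd: "norm (R s x) \<le> \<eta>' * norm (s - t)" if x: "norm x = \<rho>" for x
      proof -
        have "norm ((\<phi> x s - of_real s * \<phi>' x t) - (\<phi> x t - of_real t * \<phi>' x t)) \<le> \<eta>' * norm (s - t)"
        proof (rule differentiable_bound[of "ball t (min d 1)" "\<lambda>s. \<phi> x s - of_real s * \<phi>' x t"
              "\<lambda>u h. h *\<^sub>R (\<phi>' x u - \<phi>' x t)"])
          fix u assume u: "u \<in> ball t (min d 1)"
          have "((\<lambda>s. s *\<^sub>R \<phi>' x t) has_vector_derivative 1 *\<^sub>R \<phi>' x t) (at u)"
            unfolding has_vector_derivative_def by (auto intro!: derivative_eq_intros)
          then have "((\<lambda>s. \<phi> x s - s *\<^sub>R \<phi>' x t) has_vector_derivative \<phi>' x u - 1 *\<^sub>R \<phi>' x t) (at u)"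
            by (intro has_vector_derivative_diff der) (use x \<rho> in auto)
          then show "((\<lambda>s. \<phi> x s - of_real s * \<phi>' x t) has_derivative (\<lambda>h. h *\<^sub>R (\<phi>' x u - \<phi>' x t)))
               (at u within ball t (min d 1))"
            by (simp add: has_vector_derivative_def scaleR_conv_of_real has_derivative_at_withinI)
          have "norm (\<phi>' x u - \<phi>' x t) \<le> \<eta>'"
            by (rule near[OF x]) (use u in \<open>auto simp: dist_norm norm_minus_commute\<close>)
          then show "onorm (\<lambda>h. h *\<^sub>R (\<phi>' x u - \<phi>' x t)) \<le> \<eta>'"
            by (intro onorm_bound) (use \<eta>' in \<open>auto simp: mult.commute[of \<eta>'] intro!: mult_left_mono\<close>)
        qed (use s d in \<open>auto simp: dist_norm norm_minus_commute\<close>)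
        then show ?thesis by (simp add: R_def algebra_simps)
      qed
      have "norm (taylor_coeff n (R s)) \<le> \<eta>' * norm (s - t) / \<rho> ^ n"
      proof (rule norm_taylor_coeff_le[OF _ \<rho> bd])
        show "R s holomorphic_on ball 0 e"
          unfolding R_def by (intro holomorphic_intros hol)
      qed
      then show "norm (taylor_coeff n (R s)) \<le> \<eta> * norm (s - t)"
        using \<rho> by (simp add: \<eta>'_def)
    qed (use d in auto)
  qed
  have R: "taylor_coeff n (R s) = taylor_coeff n (\<lambda>x. \<phi> x s) - taylor_coeff n (\<lambda>x. \<phi> x t)
     - (s - t) *\<^sub>R taylor_coeff n (\<lambda>x. \<phi>' x t)" for s
  proof -
    have "taylor_coeff n (R s) = taylor_coeff n (\<lambda>x. \<phi> x s - \<phi> x t)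
         - taylor_coeff n (\<lambda>x. of_real (s - t) * \<phi>' x t)"
      unfolding R_def by (rule taylor_coeff_diff) (auto intro!: holomorphic_intros hol e)
    also have "taylor_coeff n (\<lambda>x. \<phi> x s - \<phi> x t) = taylor_coeff n (\<lambda>x. \<phi> x s) - taylor_coeff n (\<lambda>x. \<phi> x t)"
      by (rule taylor_coeff_diff[OF hol(1) hol(1) e])
    also have "taylor_coeff n (\<lambda>x. of_real (s - t) * \<phi>' x t) = of_real (s - t) * taylor_coeff n (\<lambda>x. \<phi>' x t)"
      by (rule taylor_coeff_cmult[OF hol(2) e])
    finally show ?thesis by (simp add: scaleR_conv_of_real)
  qed
  show ?thesis
    unfolding has_vector_derivative_def has_derivative_at_alt
    using small by (auto simp: R bounded_linear_scaleR_left)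
qed

lemma norm_deriv_le:
  assumes "\<phi> holomorphic_on ball z e" "0 < e" "\<And>x. x \<in> ball z e \<Longrightarrow> norm (\<phi> x) \<le> B"
  shows "norm (deriv \<phi> z) \<le> 2 * B / e"
proof -
  have "norm ((deriv ^^ 1) \<phi> z) \<le> fact 1 * B / (e / 2) ^ 1"
  proof (rule Cauchy_inequality)
    show "\<phi> holomorphic_on ball z (e / 2)"
      using assms by (intro holomorphic_on_subset[OF assms(1)]) auto
    show "continuous_on (cball z (e / 2)) \<phi>"
      using assms by (intro holomorphic_on_imp_continuous_on holomorphic_on_subset[OF assms(1)]) auto
  qed (use assms in \<open>auto simp: dist_norm\<close>)
  then show ?thesis by (simp add: field_simps)
qed

text \<open>
Cauchy's estimate on discs of a fixed radius turns uniform closeness of \<open>k z s\<close> and \<open>k z s0\<close> into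
closeness of the \<open>z\<close>-derivatives, which reduces joint continuity to continuity in \<open>z\<close> for \<open>s = s0\<close>.
\<close>

lemma continuous_on_deriv_param:
  fixes k :: "complex \<Rightarrow> 'b::metric_space \<Rightarrow> complex"
  assumes U: "open U" and S: "compact S"
    and cont: "continuous_on (U \<times> S) (\<lambda>(z, s). k z s)"
    and hol: "\<And>s. s \<in> S \<Longrightarrow> (\<lambda>z. k z s) holomorphic_on U"
  shows "continuous_on (U \<times> S) (\<lambda>(z, s). deriv (\<lambda>z. k z s) z)"
proof (rule continuous_onI)
  fix x and \<eta> :: real assume x: "x \<in> U \<times> S" and \<eta>: "\<eta> > 0"
  obtain z0 s0 where [simp]: "x = (z0, s0)" by (cases x)
  have z0: "z0 \<in> U" "s0 \<in> S" using x by auto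
  obtain e where e: "e > 0" "cball z0 (2 * e) \<subseteq> U"
  proof -
    obtain e' where "e' > 0" "cball z0 e' \<subseteq> U" using U z0 open_contains_cball by blast
    then show ?thesis using that[of "e'/2"] by auto
  qed
  define \<eta>' where "\<eta>' = \<eta> / 2 * e / 2"
  have \<eta>': "\<eta>' > 0" using \<eta> e by (simp add: \<eta>'_def)
  have "uniformly_continuous_on (cball z0 (2*e) \<times> S) (\<lambda>(z, s). k z s)"
    by (intro compact_uniformly_continuous continuous_on_subset[OF cont] compact_Times S) (use e in auto)
  from uniformly_continuous_onE[OF this \<eta>'] obtain d where d: "d > 0" and dd:
    "\<And>u v. u \<in> cball z0 (2*e) \<times> S \<Longrightarrow> v \<in> cball z0 (2*e) \<times> S \<Longrightarrow> dist v u < d \<Longrightarrow>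
      dist (case v of (x, t) \<Rightarrow> k x t) (case u of (x, t) \<Rightarrow> k x t) < \<eta>'"
    by blast
  have sdep: "norm (deriv (\<lambda>z. k z s) z - deriv (\<lambda>z. k z s0) z) \<le> \<eta> / 2"
    if "z \<in> ball z0 e" "s \<in> S" "dist s s0 < d" for z s
  proof -
    have sub: "ball z e \<subseteq> cball z0 (2*e)"
    proof
      fix w assume "w \<in> ball z e"
      then show "w \<in> cball z0 (2*e)"
        using that(1) dist_triangle[of z0 w z] by auto
    qed
    have sub': "ball z e \<subseteq> U" using sub e by auto
    have zU: "z \<in> U" using sub' e(1) by auto
    have "norm (deriv (\<lambda>z. k z s - k z s0) z) \<le> 2 * \<eta>' / e"
    proof (rule norm_deriv_le)
      show "(\<lambda>z. k z s - k z s0) holomorphic_on ball z e"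
        by (intro holomorphic_on_diff holomorphic_on_subset[OF hol sub'] that z0)
      fix w assume w: "w \<in> ball z e"
      have "dist (w, s) (w, s0) < d" using that by (simp add: dist_Pair_Pair)
      then have "dist (k w s) (k w s0) < \<eta>'"
        using dd[of "(w, s0)" "(w, s)"] sub w that z0 by auto
      then show "norm (k w s - k w s0) \<le> \<eta>'" by (simp add: dist_norm)
    qed (use e in auto)
    also have "deriv (\<lambda>z. k z s - k z s0) z = deriv (\<lambda>z. k z s) z - deriv (\<lambda>z. k z s0) z"
      by (intro deriv_diff holomorphic_on_imp_differentiable_at[OF hol U zU] that z0)
    also have "2 * \<eta>' / e = \<eta> / 2" using e by (simp add: \<eta>'_def)
    finally show ?thesis .
  qed
  have "isCont (deriv (\<lambda>z. k z s0)) z0"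
    using holomorphic_deriv[OF hol[OF z0(2)] U] holomorphic_on_imp_continuous_on U z0
      continuous_on_eq_continuous_at by blast
  then obtain d' where d': "d' > 0" and dd': "\<And>z. dist z z0 < d' \<Longrightarrow>
      dist (deriv (\<lambda>z. k z s0) z) (deriv (\<lambda>z. k z s0) z0) < \<eta> / 2"
    using \<eta> unfolding continuous_at_eps_delta by (metis half_gt_zero)
  show "\<exists>d>0. \<forall>x'\<in>U \<times> S. dist x' x < d \<longrightarrow>
      dist (case x' of (z, s) \<Rightarrow> deriv (\<lambda>z. k z s) z) (case x of (z, s) \<Rightarrow> deriv (\<lambda>z. k z s) z) \<le> \<eta>"
  proof (intro exI[of _ "min d (min d' e)"] conjI ballI impI)
    fix x' assume x': "x' \<in> U \<times> S" "dist x' x < min d (min d' e)"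
    obtain z s where [simp]: "x' = (z, s)" by (cases x')
    have "dist z z0 < min d (min d' e)" "dist s s0 < min d (min d' e)"
      using x'(2) dist_fst_le[of x' x] dist_snd_le[of x' x] by simp_all
    then have "norm (deriv (\<lambda>z. k z s) z - deriv (\<lambda>z. k z s0) z) \<le> \<eta> / 2"
      "dist (deriv (\<lambda>z. k z s0) z) (deriv (\<lambda>z. k z s0) z0) < \<eta> / 2"
      using x' sdep[of z s] dd'[of z] by (simp_all add: dist_commute)
    then show "dist (case x' of (z, s) \<Rightarrow> deriv (\<lambda>z. k z s) z)
        (case x of (z, s) \<Rightarrow> deriv (\<lambda>z. k z s) z) \<le> \<eta>"
      using dist_triangle[of "deriv (\<lambda>z. k z s) z" "deriv (\<lambda>z. k z s0) z0" "deriv (\<lambda>z. k z s0) z"]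
      by (simp add: dist_norm)
  qed (use d d' e in auto)
qed

lemma has_field_derivative_param_integral:
  fixes k :: "complex \<Rightarrow> real \<Rightarrow> complex"
  assumes U: "open U" 
    and cont: "continuous_on (U \<times> {a..b}) (\<lambda>(z, s). k z s)"
    and hol: "\<And>s. s \<in> {a..b} \<Longrightarrow> (\<lambda>z. k z s) holomorphic_on U"
    and z: "z \<in> U"
  shows "((\<lambda>z. integral {a..b} (k z)) has_field_derivative
      integral {a..b} (\<lambda>s. deriv (\<lambda>z. k z s) z)) (at z)"
proof -
  obtain e where e: "e > 0" "ball z e \<subseteq> U"
    using U z open_contains_ball by blast
  have "((\<lambda>z. integral (cbox a b) (k z)) has_field_derivative
      integral (cbox a b) (\<lambda>s. deriv (\<lambda>z. k z s) z)) (at z within ball z e)"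
  proof (rule leibniz_rule_field_derivative)
    fix x t assume "x \<in> ball z e" and t: "t \<in> cbox a b"
    then have "x \<in> U" using e by auto
    then show "((\<lambda>x. k x t) has_field_derivative deriv (\<lambda>z. k z t) x) (at x within ball z e)"
      using holomorphic_derivI[OF hol U] t by (auto intro: has_field_derivative_at_within)
  next
    fix x assume "x \<in> ball z e"
    then have "Pair x ` {a..b} \<subseteq> U \<times> {a..b}" using e by auto
    then have "continuous_on {a..b} (k x)"
      using continuous_on_compose2[OF cont continuous_on_Pair[OF continuous_on_const continuous_on_id],
          of x "{a..b}"] by simp
    then show "k x integrable_on cbox a b" by (simp add: integrable_continuous_real)
  next
    show "continuous_on (ball z e \<times> cbox a b) (\<lambda>(x, t). deriv (\<lambda>z. k z t) x)"
      using continuous_on_deriv_param[OF U _ cont hol] e(2)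
      by (auto intro: continuous_on_subset)
  qed (use e in auto)
  then show ?thesis using e(1) by (simp add: at_within_open[of z "ball z e"])
qed

lemma holomorphic_param_integral:
  fixes k :: "complex \<Rightarrow> real \<Rightarrow> complex"
  assumes "open U" "continuous_on (U \<times> {a..b}) (\<lambda>(z, s). k z s)"
    and "\<And>s. s \<in> {a..b} \<Longrightarrow> (\<lambda>z. k z s) holomorphic_on U"
  shows "(\<lambda>z. integral {a..b} (k z)) holomorphic_on U"
  using has_field_derivative_param_integral[OF assms] assms(1)
  by (auto simp: holomorphic_on_open)

text \<open>
On the type of real numbers \<open>Basis\<close> is the singleton of \<open>1\<close>, so a multi-index \<open>m\<close> amounts to the number
\<open>m 1\<close> and the series in the definition is an ordinary power series.
\<close>

lemma real_analytic_on_holomorphic: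
  assumes hol: "\<phi> holomorphic_on ball 0 e"
    and eq: "\<And>x. \<bar>x\<bar> < e \<Longrightarrow> \<phi> (complex_of_real x) = of_real (h x)"
  shows "real_analytic_on h {-e<..<e}"
  unfolding real_analytic_on_def
proof
  fix x assume x: "x \<in> {-e<..<e}"
  define r where "r = e - \<bar>x\<bar>"
  have r: "r > 0" using x by (auto simp: r_def)
  define a where "a = (\<lambda>n. (deriv ^^ n) \<phi> (of_real x) / fact n)"
  have sub: "ball (complex_of_real x) r \<subseteq> ball 0 e"
  proof
    fix w assume "w \<in> ball (complex_of_real x) r"
    then show "w \<in> ball 0 e"
      using dist_triangle[of 0 w "complex_of_real x"] by (simp add: r_def)
  qed
  have ps: "(\<lambda>n. a n * (w - of_real x) ^ n) sums \<phi> w" if "w \<in> ball (of_real x) r" for w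
    unfolding a_def by (rule holomorphic_power_series[OF holomorphic_on_subset[OF hol sub] that])
  have hs: "((\<lambda>n. Re (a n) * (y - x) ^ n) has_sum h y) UNIV" if y: "y \<in> ball x r" for y
  proof -
    \<comment> \<open>Convergence at the larger radius \<open>\<rho>\<close> gives absolute convergence at \<open>y - x\<close>.\<close>
    define \<rho> where "\<rho> = (\<bar>y - x\<bar> + r) / 2"
    have \<rho>: "\<bar>y - x\<bar> < \<rho>" "\<rho> < r" "0 < \<rho>" using y r by (auto simp: \<rho>_def dist_real_def)
    have "summable (\<lambda>n. a n * (of_real \<rho>) ^ n)"
      using sums_summable[OF ps[of "of_real x + of_real \<rho>"]] \<rho> by (simp add: dist_norm)
    then have "summable (\<lambda>n. norm (a n * (of_real (y - x)) ^ n))"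
      by (rule powser_insidea) (use \<rho> in \<open>simp del: of_real_diff\<close>)
    moreover have "(\<lambda>n. a n * (of_real (y - x)) ^ n) sums \<phi> (of_real y)"
    proof -
      have "dist (complex_of_real x) (of_real y) < r"
        using y by (simp only: dist_of_real mem_ball)
      then show ?thesis using ps[of "of_real y"] by simp
    qed
    ultimately have "((\<lambda>n. a n * (of_real (y - x)) ^ n) has_sum \<phi> (of_real y)) UNIV"
      by (rule norm_summable_imp_has_sum)
    then have "((\<lambda>n. Re (a n * (of_real (y - x)) ^ n)) has_sum Re (\<phi> (of_real y))) UNIV"
      by (rule has_sum_Re)
    moreover have "\<bar>y\<bar> < e" using y by (auto simp: r_def dist_real_def)
    ultimately show ?thesis
      by (simp add: eq flip: of_real_power del: of_real_diff)
  qed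
  have bij: "bij_betw (\<lambda>m::real \<Rightarrow> nat. m 1) (Basis \<rightarrow>\<^sub>E UNIV) UNIV"
    by (rule bij_betwI[where g = "\<lambda>n. \<lambda>b\<in>Basis. n"])
      (auto simp: PiE_def extensional_def fun_eq_iff)
  show "\<exists>r>0. \<exists>c. \<forall>y\<in>ball x r.
     ((\<lambda>m. c m * (\<Prod>b\<in>Basis. ((y - x) \<bullet> b) ^ m b)) has_sum h y) (Basis \<rightarrow>\<^sub>E UNIV)"
  proof (intro exI[of _ r] exI[of _ "\<lambda>m. Re (a (m 1))"] conjI ballI)
    fix y assume "y \<in> ball x r"
    from has_sum_reindex_bij_betw[OF bij, THEN iffD2, OF hs[OF this]]
    show "((\<lambda>m. Re (a (m 1)) * (\<Prod>b\<in>Basis. ((y - x) \<bullet> b) ^ m b)) has_sum h y) (Basis \<rightarrow>\<^sub>E UNIV)"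
      by simp
  qed (rule r)
qed

section \<open>Complexification of real analytic functions\<close>

text \<open>
The variables are given as a function on \<open>Basis\<close>, so that complex values can be substituted into an
expansion on a real Euclidean space.
\<close>

definition power_sum :: "(('a::euclidean_space \<Rightarrow> nat) \<Rightarrow> real) \<Rightarrow> ('a \<Rightarrow> complex) \<Rightarrow> complex" where
  "power_sum c z = (\<Sum>\<^sub>\<infinity>m\<in>Basis \<rightarrow>\<^sub>E UNIV. of_real (c m) * (\<Prod>b\<in>Basis. z b ^ m b))"

definition power_summable :: "(('a::euclidean_space \<Rightarrow> nat) \<Rightarrow> real) \<Rightarrow> real \<Rightarrow> bool" where
  "power_summable c \<rho> \<longleftrightarrow> (\<lambda>m. \<bar>c m\<bar> * (\<Prod>b\<in>Basis. \<rho> ^ m b)) summable_on (Basis \<rightarrow>\<^sub>E UNIV)"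

lemma norm_power_term_le:
  assumes "\<And>b. b \<in> Basis \<Longrightarrow> norm (z b) \<le> \<rho>"
  shows "norm (complex_of_real (c m) * (\<Prod>b\<in>Basis. z b ^ m b)) \<le> \<bar>c m\<bar> * (\<Prod>b\<in>(Basis :: 'a::euclidean_space set). \<rho> ^ m b)"
  unfolding norm_mult norm_of_real prod_norm[symmetric] norm_power
  by (intro mult_left_mono prod_mono) (auto intro!: power_mono assms)

lemma uniform_limit_power_sum:
  assumes "power_summable c \<rho>" "\<And>b y. b \<in> Basis \<Longrightarrow> y \<in> Y \<Longrightarrow> norm (z b y) \<le> \<rho>"
  shows "uniform_limit Y (\<lambda>X y. \<Sum>m\<in>X. of_real (c m) * (\<Prod>b\<in>Basis. z b y ^ m b))
    (\<lambda>y. power_sum c (\<lambda>b. z b y)) (finite_subsets_at_top (Basis \<rightarrow>\<^sub>E UNIV))"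
  unfolding power_sum_def
proof (rule Weierstrass_m_test_general)
  fix m y assume "y \<in> Y"
  then show "norm (complex_of_real (c m) * (\<Prod>b\<in>Basis. z b y ^ m b)) \<le> \<bar>c m\<bar> * (\<Prod>b\<in>(Basis::'a set). \<rho> ^ m b)"
    by (intro norm_power_term_le assms(2))
qed (use assms(1) in \<open>simp add: power_summable_def\<close>)

lemma continuous_on_power_sum:
  assumes "power_summable c \<rho>" "\<And>b y. b \<in> Basis \<Longrightarrow> y \<in> Y \<Longrightarrow> norm (z b y) \<le> \<rho>"
    and "\<And>b. b \<in> Basis \<Longrightarrow> continuous_on Y (z b)"
  shows "continuous_on Y (\<lambda>y. power_sum c (\<lambda>b. z b y))"
proof (rule uniform_limit_theorem)
  show "uniform_limit Y (\<lambda>X y. \<Sum>m\<in>X. of_real (c m) * (\<Prod>b\<in>Basis. z b y ^ m b))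
    (\<lambda>y. power_sum c (\<lambda>b. z b y)) (finite_subsets_at_top (Basis \<rightarrow>\<^sub>E UNIV))"
    by (rule uniform_limit_power_sum[OF assms(1,2)])
  show "\<forall>\<^sub>F X in finite_subsets_at_top (Basis \<rightarrow>\<^sub>E UNIV).
      continuous_on Y (\<lambda>y. \<Sum>m\<in>X. of_real (c m) * (\<Prod>b\<in>Basis. z b y ^ m b))"
    by (intro always_eventually allI continuous_intros assms(3))
qed auto

lemma holomorphic_on_power_sum:
  assumes "open U" "power_summable c \<rho>" "\<And>b y. b \<in> Basis \<Longrightarrow> y \<in> U \<Longrightarrow> norm (z b y) \<le> \<rho>"
    and "\<And>b. b \<in> Basis \<Longrightarrow> z b holomorphic_on U"
  shows "(\<lambda>y. power_sum c (\<lambda>b. z b y)) holomorphic_on U"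
proof -
  have "\<exists>e>0. (\<lambda>y. power_sum c (\<lambda>b. z b y)) holomorphic_on ball u e" if "u \<in> U" for u
  proof -
    obtain e where e: "e > 0" "cball u e \<subseteq> U"
      using assms(1) \<open>u \<in> U\<close> open_contains_cball by blast
    have hol: "(\<lambda>y. \<Sum>m\<in>X. of_real (c m) * (\<Prod>b\<in>Basis. z b y ^ m b)) holomorphic_on U" for X
      by (intro holomorphic_intros assms(4))
    have "uniform_limit (cball u e) (\<lambda>X y. \<Sum>m\<in>X. of_real (c m) * (\<Prod>b\<in>Basis. z b y ^ m b))
        (\<lambda>y. power_sum c (\<lambda>b. z b y)) (finite_subsets_at_top (Basis \<rightarrow>\<^sub>E UNIV))"
      by (rule uniform_limit_power_sum[OF assms(2)]) (use assms(3) e in auto)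
    then have "(\<lambda>y. power_sum c (\<lambda>b. z b y)) holomorphic_on ball u e"
    proof (rule holomorphic_uniform_limit[rotated])
      show "\<forall>\<^sub>F X in finite_subsets_at_top (Basis \<rightarrow>\<^sub>E UNIV).
         continuous_on (cball u e) (\<lambda>y. \<Sum>m\<in>X. of_real (c m) * (\<Prod>b\<in>Basis. z b y ^ m b)) \<and>
         (\<lambda>y. \<Sum>m\<in>X. of_real (c m) * (\<Prod>b\<in>Basis. z b y ^ m b)) holomorphic_on ball u e"
        by (intro always_eventually allI conjI holomorphic_on_imp_continuous_on
            holomorphic_on_subset[OF hol]) (use e ball_subset_cball[of u e] in auto)
    qed auto
    with e show ?thesis by blast
  qed
  then have "\<exists>f'. ((\<lambda>y. power_sum c (\<lambda>b. z b y)) has_field_derivative f') (at u)" if "u \<in> U" for u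
  proof -
    from \<open>\<And>u. u \<in> U \<Longrightarrow> \<exists>e>0. (\<lambda>y. power_sum c (\<lambda>b. z b y)) holomorphic_on ball u e\<close>[OF that]
    obtain e where "e > 0" "(\<lambda>y. power_sum c (\<lambda>b. z b y)) holomorphic_on ball u e" by blast
    from holomorphic_derivI[OF this(2) open_ball, of u] this(1) show ?thesis by auto
  qed
  then show ?thesis using assms(1) by (simp add: holomorphic_on_open)
qed

lemma norm_power_sum_le:
  assumes "power_summable c \<rho>" "\<And>b. b \<in> Basis \<Longrightarrow> norm (z b) \<le> \<rho>"
  shows "norm (power_sum c z) \<le> (\<Sum>\<^sub>\<infinity>m\<in>Basis \<rightarrow>\<^sub>E UNIV. \<bar>c m\<bar> * (\<Prod>b\<in>Basis. \<rho> ^ m b))"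
proof -
  have *: "(\<lambda>m. norm (complex_of_real (c m) * (\<Prod>b\<in>Basis. z b ^ m b))) summable_on (Basis \<rightarrow>\<^sub>E UNIV)"
    using assms(1) unfolding power_summable_def
    by (rule Infinite_Sum.abs_summable_on_comparison_test') (intro norm_power_term_le assms(2))
  have "norm (power_sum c z) \<le> (\<Sum>\<^sub>\<infinity>m\<in>Basis \<rightarrow>\<^sub>E UNIV. norm (complex_of_real (c m) * (\<Prod>b\<in>Basis. z b ^ m b)))"
    unfolding power_sum_def by (rule norm_infsum_bound[OF *])
  also have "\<dots> \<le> (\<Sum>\<^sub>\<infinity>m\<in>Basis \<rightarrow>\<^sub>E UNIV. \<bar>c m\<bar> * (\<Prod>b\<in>Basis. \<rho> ^ m b))"
    using assms by (intro infsum_mono * norm_power_term_le) (auto simp: power_summable_def)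
  finally show ?thesis .
qed

lemma power_sum_of_real:
  assumes "((\<lambda>m. c m * (\<Prod>b\<in>Basis. z b ^ m b)) has_sum s) (Basis \<rightarrow>\<^sub>E UNIV)"
  shows "power_sum c (\<lambda>b. of_real (z b)) = of_real s"
proof -
  have "((\<lambda>m. complex_of_real (c m * (\<Prod>b\<in>Basis. z b ^ m b))) has_sum of_real s) (Basis \<rightarrow>\<^sub>E UNIV)"
    using assms by (rule has_sum_of_real)
  from infsumI[OF this] show ?thesis by (simp add: power_sum_def)
qed

text \<open>
Convergence at the corner of a cube, where all coordinates equal \<open>\<rho>\<close>, is absolute convergence on the
whole polydisc of radius \<open>\<rho>\<close>. The cube is chosen inside the ball on which the expansion is valid.
\<close>

lemma real_analytic_on_power_sum:
  fixes f :: "'a::euclidean_space \<Rightarrow> real"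
  assumes "real_analytic_on f S" "open S" "x \<in> S"
  obtains \<rho> c where "\<rho> > 0" "power_summable c \<rho>"
    "\<And>y. (\<And>b. b \<in> Basis \<Longrightarrow> \<bar>y \<bullet> b\<bar> \<le> \<rho>) \<Longrightarrow> x + y \<in> S \<and> power_sum c (\<lambda>b. of_real (y \<bullet> b)) = of_real (f (x + y))"
proof -
  obtain r c where r: "r > 0" and hs: "\<And>y. y \<in> ball x r \<Longrightarrow>
      ((\<lambda>m. c m * (\<Prod>b\<in>Basis. ((y - x) \<bullet> b) ^ m b)) has_sum f y) (Basis \<rightarrow>\<^sub>E UNIV)"
    using assms unfolding real_analytic_on_def by meson
  obtain r' where r': "r' > 0" "ball x r' \<subseteq> S" using assms open_contains_ball by blast
  define \<rho> where "\<rho> = min r r' / (2 * DIM('a))"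
  have \<rho>: "\<rho> > 0" using r r' by (simp add: \<rho>_def)
  have near: "x + y \<in> ball x r \<inter> ball x r'" if "\<And>b. b \<in> Basis \<Longrightarrow> \<bar>y \<bullet> b\<bar> \<le> \<rho>" for y
  proof -
    have "norm y \<le> (\<Sum>b\<in>Basis. \<bar>y \<bullet> b\<bar>)" by (rule norm_le_l1)
    also have "\<dots> \<le> (\<Sum>b\<in>(Basis::'a set). \<rho>)" by (intro sum_mono that)
    also have "\<dots> = min r r' / 2" by (simp add: \<rho>_def)
    finally show ?thesis using r r' by (auto simp: dist_norm)
  qed
  show ?thesis
  proof (rule that[OF \<rho>])
    \<comment> \<open>The corner of the cube of half side \<open>\<rho>\<close>.\<close>
    define y0 :: 'a where "y0 = (\<Sum>b\<in>Basis. \<rho> *\<^sub>R b)"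
    have y0: "y0 \<bullet> b = \<rho>" if "b \<in> Basis" for b
      using that by (simp add: y0_def)
    have "x + y0 \<in> ball x r" using near[of y0] y0 \<rho> by simp
    from hs[OF this] have "(\<lambda>m. c m * (\<Prod>b\<in>Basis. \<rho> ^ m b)) summable_on (Basis \<rightarrow>\<^sub>E UNIV)"
      by (auto simp: y0 cong: prod.cong dest: has_sum_imp_summable)
    then have "(\<lambda>m. norm (c m * (\<Prod>b\<in>Basis. \<rho> ^ m b))) summable_on (Basis \<rightarrow>\<^sub>E UNIV)"
      by (rule summable_on_iff_abs_summable_on_real[THEN iffD1])
    then show "power_summable c \<rho>"
      using \<rho> by (simp add: power_summable_def abs_mult abs_prod)
  next
    fix y :: 'a assume "\<And>b. b \<in> Basis \<Longrightarrow> \<bar>y \<bullet> b\<bar> \<le> \<rho>"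
    from near[OF this] have xy: "x + y \<in> ball x r" "x + y \<in> ball x r'" by auto
    have "power_sum c (\<lambda>b. of_real (y \<bullet> b)) = of_real (f (x + y))"
      using hs[OF xy(1)] by (intro power_sum_of_real) simp
    with xy(2) r'(2) show "x + y \<in> S \<and> power_sum c (\<lambda>b. of_real (y \<bullet> b)) = of_real (f (x + y))"
      by blast
  qed
qed

lemma continuous_on_locally:
  fixes f :: "'a::t2_space \<Rightarrow> 'b::topological_space"
  assumes "\<And>x. x \<in> S \<Longrightarrow> \<exists>V. open V \<and> x \<in> V \<and> continuous_on (S \<inter> V) f"
  shows "continuous_on S f"
  unfolding continuous_on_eq_continuous_within
proof
  fix x assume x: "x \<in> S"
  then obtain V where V: "open V" "x \<in> V" "continuous_on (S \<inter> V) f" using assms by blast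
  have "at x within (S \<inter> V) = at x within S"
    by (rule at_within_nhd[OF V(2,1)]) auto
  moreover have "continuous (at x within (S \<inter> V)) f"
    using V x by (auto simp: continuous_on_eq_continuous_within)
  ultimately show "continuous (at x within S) f" by simp
qed

text \<open>
Four complex coordinates in the form that \<open>power_sum\<close> expects: on a basis vector all but one of the
four factors vanish.
\<close>

definition coords :: "complex \<Rightarrow> complex \<Rightarrow> complex \<Rightarrow> complex \<Rightarrow> real \<times> real \<times> real \<times> real \<Rightarrow> complex" where
  "coords z1 z2 z3 z4 b = of_real (fst b) * z1 + of_real (fst (snd b)) * z2
     + of_real (fst (snd (snd b))) * z3 + of_real (snd (snd (snd b))) * z4"

lemma coords_of_real:
  "coords (of_real y1) (of_real y2) (of_real y3) (of_real y4) b = of_real ((y1, y2, y3, y4) \<bullet> b)"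
  by (cases b) (simp add: coords_def inner_prod_def algebra_simps)

lemma norm_coords_le:
  assumes "b \<in> Basis" "norm z1 \<le> \<rho>" "norm z2 \<le> \<rho>" "norm z3 \<le> \<rho>" "norm z4 \<le> \<rho>"
  shows "norm (coords z1 z2 z3 z4 b) \<le> \<rho>"
  using assms by (auto simp: Basis_prod_def coords_def)

text \<open>
The complexification of \<open>H\<close> in its first three arguments, as a function given by a formula: \<open>H\<close> is
restricted to the real line through \<open>(Re z1, Re z2, Re z3)\<close> with direction \<open>(Im z1, Im z2, Im z3)\<close>,
continued to complex times of modulus less than \<open>2\<close>, and evaluated at the time \<open>\<i>\<close>. As no centre of
expansion enters, the local expansions of \<open>H\<close> all represent the same function, and periods of \<open>H\<close> are
inherited.
\<close>

definition cext :: "(real \<Rightarrow> real \<Rightarrow> real \<Rightarrow> real \<Rightarrow> real) \<Rightarrow> complex \<Rightarrow> complex \<Rightarrow> complex \<Rightarrow> real \<Rightarrow> complex" where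
  "cext H z1 z2 z3 s = (SOME \<phi>. \<phi> holomorphic_on ball 0 2 \<and>
     (\<forall>\<tau>. \<bar>\<tau>\<bar> < 2 \<longrightarrow> \<phi> (of_real \<tau>) =
        of_real (H (Re z1 + \<tau> * Im z1) (Re z2 + \<tau> * Im z2) (Re z3 + \<tau> * Im z3) s))) \<i>"

text \<open>
By the identity theorem the continuation from a real interval is unique.
\<close>

lemma cext_eqI:
  assumes "\<phi> holomorphic_on ball 0 2"
    and "\<And>\<tau>. \<bar>\<tau>\<bar> < 2 \<Longrightarrow> \<phi> (of_real \<tau>) =
       of_real (H (Re z1 + \<tau> * Im z1) (Re z2 + \<tau> * Im z2) (Re z3 + \<tau> * Im z3) s)"
  shows "cext H z1 z2 z3 s = \<phi> \<i>"
proof -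
  define is_ext where "is_ext = (\<lambda>\<phi>. \<phi> holomorphic_on ball 0 2 \<and>
     (\<forall>\<tau>. \<bar>\<tau>\<bar> < 2 \<longrightarrow> \<phi> (complex_of_real \<tau>) =
        complex_of_real (H (Re z1 + \<tau> * Im z1) (Re z2 + \<tau> * Im z2) (Re z3 + \<tau> * Im z3) s)))"
  define \<psi> where "\<psi> = (SOME \<phi>. is_ext \<phi>)"
  have "is_ext \<phi>" using assms by (auto simp: is_ext_def)
  then have \<psi>: "is_ext \<psi>" unfolding \<psi>_def by (rule someI[of is_ext])
  have lim: "0 islimpt (complex_of_real ` {-2<..<2})"
    unfolding islimpt_approachable
  proof (intro allI impI)
    fix e :: real assume "e > 0"
    then show "\<exists>x'\<in>complex_of_real ` {-2<..<2}. x' \<noteq> 0 \<and> dist x' 0 < e"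
      by (intro bexI[of _ "of_real (min 1 (e/2))"]) (auto simp: min_def)
  qed
  have eq: "\<psi> (of_real \<tau>) - \<phi> (of_real \<tau>) = 0" if "\<bar>\<tau>\<bar> < 2" for \<tau> :: real
    using \<psi> assms(2)[OF that] that by (simp add: is_ext_def)
  then have "(\<lambda>w. \<psi> w - \<phi> w) constant_on (complex_of_real ` {-2<..<2})"
    unfolding constant_on_def by (auto intro!: exI[of _ 0])
  moreover have "(\<lambda>w. \<psi> w - \<phi> w) holomorphic_on ball 0 2"
    using \<psi> assms(1) by (intro holomorphic_on_diff) (auto simp: is_ext_def)
  moreover have "complex_of_real ` {-2<..<2} \<subseteq> ball 0 2" by auto
  ultimately have "(\<lambda>w. \<psi> w - \<phi> w) constant_on ball 0 2"
    using analytic_continuation'[OF _ open_ball connected_ball _ _ lim] by simp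
  then obtain c where c: "\<And>w. w \<in> ball 0 2 \<Longrightarrow> \<psi> w - \<phi> w = c" unfolding constant_on_def by auto
  have "c = 0" using c[of "of_real 0"] eq[of 0] by simp
  then have "\<psi> \<i> = \<phi> \<i>" using c[of \<i>] by simp
  then show ?thesis by (simp add: cext_def \<psi>_def is_ext_def)
qed

lemma cext_of_real [simp]:
  "cext H (of_real y1) (of_real y2) (of_real y3) s = of_real (H y1 y2 y3 s)"
  by (rule cext_eqI[where \<phi> = "\<lambda>_. of_real (H y1 y2 y3 s)"]) auto

lemma cext_periodic:
  assumes "\<And>\<alpha> A C t. H (\<alpha> + d1) A C (t + d2) = H \<alpha> A C t"
  shows "cext H (z1 + of_real d1) z2 z3 (s + d2) = cext H z1 z2 z3 s"
proof -
  have "H (Re z1 + d1 + \<tau> * Im z1) A C (s + d2) = H (Re z1 + \<tau> * Im z1) A C s" for \<tau> A C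
    using assms[of "Re z1 + \<tau> * Im z1" A C s] by (simp add: add_ac)
  then show ?thesis by (simp add: cext_def)
qed

text \<open>
The radius is a third of the radius of convergence because a point with complex time \<open>\<tau>\<close> has
coordinates of modulus at most \<open>\<bar>Re z - x\<bar> + \<bar>\<tau>\<bar> \<bar>Im z\<bar>\<close>, and \<open>\<bar>\<tau>\<bar> < 2\<close>.
\<close>

lemma cext_eq_power_sum:
  assumes an: "real_analytic_on (\<lambda>(\<alpha>, A, C, t). H \<alpha> A C t) (UNIV \<times> W \<times> UNIV \<times> UNIV)"
    and W: "open W" "x2 \<in> W"
  obtains r c \<rho> where "r > 0" "power_summable c \<rho>"
    "\<And>z1 z2 z3 s. norm (z1 - of_real x1) < r \<Longrightarrow> norm (z2 - of_real x2) < r \<Longrightarrow>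
      norm (z3 - of_real x3) < r \<Longrightarrow> \<bar>s - x4\<bar> < r \<Longrightarrow>
      cext H z1 z2 z3 s = power_sum c (coords (z1 - of_real x1) (z2 - of_real x2) (z3 - of_real x3) (of_real (s - x4))) \<and>
      (\<forall>b\<in>Basis. norm (coords (z1 - of_real x1) (z2 - of_real x2) (z3 - of_real x3) (of_real (s - x4)) b) \<le> \<rho>)"
proof -
  have "open (UNIV \<times> W \<times> (UNIV :: real set) \<times> (UNIV :: real set))"
    using W by (intro open_Times) auto
  then obtain \<rho> c where \<rho>: "\<rho> > 0" "power_summable c \<rho>" and
    ev: "\<And>y. (\<And>b. b \<in> Basis \<Longrightarrow> \<bar>y \<bullet> b\<bar> \<le> \<rho>) \<Longrightarrow>
      (x1, x2, x3, x4) + y \<in> (UNIV \<times> W \<times> UNIV \<times> UNIV) \<and>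
      power_sum c (\<lambda>b. of_real (y \<bullet> b)) = of_real (case (x1, x2, x3, x4) + y of (\<alpha>, A, C, t) \<Rightarrow> H \<alpha> A C t)"
    using real_analytic_on_power_sum[OF an, of "(x1, x2, x3, x4)"] W by blast
  show ?thesis
  proof (rule that[of "\<rho> / 3" c \<rho>])
    fix z1 z2 z3 :: complex and s :: real
    assume z: "norm (z1 - of_real x1) < \<rho> / 3" "norm (z2 - of_real x2) < \<rho> / 3"
      "norm (z3 - of_real x3) < \<rho> / 3" and s: "\<bar>s - x4\<bar> < \<rho> / 3"
    define Z where "Z = (\<lambda>\<tau>. coords (of_real (Re z1 - x1) + \<tau> * of_real (Im z1))
      (of_real (Re z2 - x2) + \<tau> * of_real (Im z2)) (of_real (Re z3 - x3) + \<tau> * of_real (Im z3))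
      (of_real (s - x4)))"
    have le: "norm (of_real (Re z - x) + \<tau> * of_real (Im z)) \<le> \<rho>"
      if "norm (z - of_real x) < \<rho> / 3" "norm \<tau> \<le> 2" for z \<tau> :: complex and x :: real
    proof -
      have "\<bar>Re z - x\<bar> < \<rho> / 3" "\<bar>Im z\<bar> < \<rho> / 3"
        using abs_Re_le_cmod[of "z - of_real x"] abs_Im_le_cmod[of "z - of_real x"] that by auto
      moreover have "norm (of_real (Re z - x) + \<tau> * of_real (Im z)) \<le> \<bar>Re z - x\<bar> + norm \<tau> * \<bar>Im z\<bar>"
        using norm_triangle_ineq[of "of_real (Re z - x)" "\<tau> * of_real (Im z)"]
        by (simp only: norm_mult norm_of_real)
      moreover have "norm \<tau> * \<bar>Im z\<bar> \<le> 2 * \<bar>Im z\<bar>" using that by (intro mult_right_mono) auto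
      ultimately show ?thesis by linarith
    qed
    have Zle: "norm (Z \<tau> b) \<le> \<rho>" if "norm \<tau> \<le> 2" "b \<in> Basis" for \<tau> b
      unfolding Z_def by (intro norm_coords_le le that z)
        (use s \<rho> in \<open>auto simp del: of_real_diff\<close>)
    have hol: "(\<lambda>\<tau>. power_sum c (\<lambda>b. Z \<tau> b)) holomorphic_on ball 0 2"
    proof (rule holomorphic_on_power_sum[OF _ \<rho>(2)])
      fix b :: "real \<times> real \<times> real \<times> real"
      show "(\<lambda>\<tau>. Z \<tau> b) holomorphic_on ball 0 2"
        unfolding Z_def coords_def by (intro holomorphic_intros)
    qed (use Zle in auto)
    have "cext H z1 z2 z3 s = power_sum c (\<lambda>b. Z \<i> b)"
    proof (rule cext_eqI[OF hol])
      fix \<tau> :: real assume \<tau>: "\<bar>\<tau>\<bar> < 2"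
      define y where "y = (Re z1 - x1 + \<tau> * Im z1, Re z2 - x2 + \<tau> * Im z2, Re z3 - x3 + \<tau> * Im z3, s - x4)"
      have Zy: "Z (of_real \<tau>) b = of_real (y \<bullet> b)" for b
        unfolding Z_def y_def coords_of_real[symmetric] by simp
      have "\<bar>y \<bullet> b\<bar> \<le> \<rho>" if "b \<in> Basis" for b
        using Zle[of "of_real \<tau>" b] \<tau> that by (simp add: Zy)
      from ev[OF this] show "power_sum c (\<lambda>b. Z (of_real \<tau>) b) =
        of_real (H (Re z1 + \<tau> * Im z1) (Re z2 + \<tau> * Im z2) (Re z3 + \<tau> * Im z3) s)"
        unfolding Zy by (simp add: y_def)
    qed
    moreover have "Z \<i> = coords (z1 - of_real x1) (z2 - of_real x2) (z3 - of_real x3) (of_real (s - x4))"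
    proof -
      have "of_real (Re z - x) + \<i> * of_real (Im z) = z - of_real x" for z x
        by (simp add: complex_eq_iff)
      note * = this
      show ?thesis unfolding Z_def * ..
    qed
    ultimately show "cext H z1 z2 z3 s = power_sum c (coords (z1 - of_real x1) (z2 - of_real x2) (z3 - of_real x3) (of_real (s - x4))) \<and>
      (\<forall>b\<in>Basis. norm (coords (z1 - of_real x1) (z2 - of_real x2) (z3 - of_real x3) (of_real (s - x4)) b) \<le> \<rho>)"
      using Zle[of \<i>] by simp
  qed (use \<rho> in auto)
qed

text \<open>
Functions of a phase \<open>p\<close>, a real time \<open>t\<close> and three complex variables in a polydisc. Holomorphy in the
complex variables is expressed by composition with holomorphic curves, which is the form in which it is
applied.
\<close>

definition complex_family :: "real \<Rightarrow> real \<Rightarrow> real set \<Rightarrow> real \<Rightarrow>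
    (real \<Rightarrow> real \<Rightarrow> complex \<Rightarrow> complex \<Rightarrow> complex \<Rightarrow> complex) \<Rightarrow> bool" where
  "complex_family r B P T h \<longleftrightarrow>
     continuous_on (P \<times> UNIV \<times> ball 0 r \<times> ball 0 r \<times> ball 0 r) (\<lambda>(p, t, x, y, z). h p t x y z) \<and>
     (\<forall>p\<in>P. \<forall>t U a b c. open U \<and> a holomorphic_on U \<and> b holomorphic_on U \<and> c holomorphic_on U \<and>
        a ` U \<subseteq> ball 0 r \<and> b ` U \<subseteq> ball 0 r \<and> c ` U \<subseteq> ball 0 r \<longrightarrow>
        (\<lambda>\<epsilon>. h p t (a \<epsilon>) (b \<epsilon>) (c \<epsilon>)) holomorphic_on U) \<and>
     (\<forall>p\<in>P. \<forall>t. \<forall>x\<in>ball 0 r. \<forall>y\<in>ball 0 r. \<forall>z\<in>ball 0 r. norm (h p t x y z) \<le> B) \<and>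
     (\<forall>p\<in>P. \<forall>t x y z. h p (t + T) x y z = h p t x y z)"

text \<open>
A single power series, centred at \<open>(X1, X2, X3, X4)\<close>, represents \<open>h\<close> for \<open>(p, t) \<in> N\<close>. The radius \<open>r\<close>
and the bound \<open>B\<close> are parameters, so that one pair can be required for all the sets \<open>N\<close> of a cover.
\<close>

definition power_sum_on :: "real set \<Rightarrow> real \<Rightarrow> real \<Rightarrow> real \<Rightarrow> real \<Rightarrow> (real \<Rightarrow> real) \<Rightarrow>
    (real \<Rightarrow> real \<Rightarrow> complex \<Rightarrow> complex \<Rightarrow> complex \<Rightarrow> complex) \<Rightarrow> (real \<times> real) set \<Rightarrow> bool" where
  "power_sum_on P r B u1 u2 C0 h N \<longleftrightarrow> (\<exists>c \<rho> X1 X2 X3 X4. power_summable c \<rho> \<and>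
     (\<Sum>\<^sub>\<infinity>m\<in>Basis \<rightarrow>\<^sub>E UNIV. \<bar>c m\<bar> * (\<Prod>b\<in>Basis. \<rho> ^ m b)) \<le> B \<and>
     (\<forall>p t x y z. (p, t) \<in> N \<longrightarrow> p \<in> P \<longrightarrow> x \<in> ball 0 r \<longrightarrow> y \<in> ball 0 r \<longrightarrow> z \<in> ball 0 r \<longrightarrow>
        h p t x y z = power_sum c (coords (of_real (u1 * t - X1) + x) (of_real (u2 - X2) + y)
            (of_real (C0 p - X3) + z) (of_real (t + p - X4))) \<and>
        (\<forall>b\<in>Basis. norm (coords (of_real (u1 * t - X1) + x) (of_real (u2 - X2) + y)
            (of_real (C0 p - X3) + z) (of_real (t + p - X4)) b) \<le> \<rho>)))"

lemma complex_family_local: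
  assumes loc: "\<And>p t. p \<in> P \<Longrightarrow> \<exists>N. open N \<and> (p, t) \<in> N \<and> power_sum_on P r B u1 u2 C0 h N"
    and C0: "continuous_on P C0"
    and per: "\<And>p t x y z. h p (t + T) x y z = h p t x y z"
  shows "complex_family r B P T h"
  unfolding complex_family_def
proof (intro conjI ballI allI impI per)
  show "continuous_on (P \<times> UNIV \<times> ball 0 r \<times> ball 0 r \<times> ball 0 r) (\<lambda>(p, t, x, y, z). h p t x y z)"
    (is "continuous_on ?S ?f")
  proof (rule continuous_on_locally)
    fix w assume w: "w \<in> ?S"
    obtain p t v where [simp]: "w = (p, t, v)" by (cases w)
    have p: "p \<in> P" using w by auto
    obtain N where N: "open N" "(p, t) \<in> N" "power_sum_on P r B u1 u2 C0 h N"
      using loc[OF p, of t] by blast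
    from N(3) obtain c \<rho> X1 X2 X3 X4 where c: "power_summable c \<rho>"
      and eq: "\<And>p t x y z. (p, t) \<in> N \<Longrightarrow> p \<in> P \<Longrightarrow> x \<in> ball 0 r \<Longrightarrow> y \<in> ball 0 r \<Longrightarrow> z \<in> ball 0 r \<Longrightarrow>
         h p t x y z = power_sum c (coords (of_real (u1 * t - X1) + x) (of_real (u2 - X2) + y)
            (of_real (C0 p - X3) + z) (of_real (t + p - X4)))"
        "\<And>p t x y z b. (p, t) \<in> N \<Longrightarrow> p \<in> P \<Longrightarrow> x \<in> ball 0 r \<Longrightarrow> y \<in> ball 0 r \<Longrightarrow> z \<in> ball 0 r \<Longrightarrow>
         b \<in> Basis \<Longrightarrow> norm (coords (of_real (u1 * t - X1) + x) (of_real (u2 - X2) + y)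
            (of_real (C0 p - X3) + z) (of_real (t + p - X4)) b) \<le> \<rho>"
      unfolding power_sum_on_def by blast
    define V :: "(real \<times> real \<times> complex \<times> complex \<times> complex) set"
      where "V = (\<lambda>w. (fst w, fst (snd w))) -` N"
    have "open V" unfolding V_def
      by (intro open_vimage N continuous_intros)
    moreover have "w \<in> V" using N by (simp add: V_def)
    moreover have "continuous_on (?S \<inter> V) ?f"
    proof -
      define Z where "Z = (\<lambda>b (p, t, x, y, z). coords (of_real (u1 * t - X1) + x) (of_real (u2 - X2) + y)
            (of_real (C0 p - X3) + z) (of_real (t + p - X4)) b)"
      have "continuous_on (?S \<inter> V) (\<lambda>w. power_sum c (\<lambda>b. Z b w))"
      proof (rule continuous_on_power_sum[OF c])
        fix b :: "real \<times> real \<times> real \<times> real" and w' assume "b \<in> Basis" "w' \<in> ?S \<inter> V"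
        then show "norm (Z b w') \<le> \<rho>"
          using eq(2)[of "fst w'" "fst (snd w')" "fst (snd (snd w'))" "fst (snd (snd (snd w')))"
              "snd (snd (snd (snd w')))" b]
          by (cases w') (simp add: Z_def V_def)
      next
        fix b :: "real \<times> real \<times> real \<times> real"
        have "continuous_on (?S \<inter> V) (\<lambda>w. C0 (fst w))"
          by (rule continuous_on_compose2[OF C0]) (auto intro!: continuous_intros)
        then show "continuous_on (?S \<inter> V) (Z b)"
          unfolding Z_def coords_def case_prod_beta' by (intro continuous_intros)
      qed
      moreover have "power_sum c (\<lambda>b. Z b w) = ?f w" if "w \<in> ?S \<inter> V" for w
        using eq(1) that by (auto simp: Z_def V_def)
      ultimately show ?thesis
        using continuous_on_cong[of "?S \<inter> V" "?S \<inter> V" "\<lambda>w. power_sum c (\<lambda>b. Z b w)" ?f] by blast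
    qed
    ultimately show "\<exists>V. open V \<and> w \<in> V \<and> continuous_on (?S \<inter> V) ?f" by blast
  qed
next
  fix p t U a b c
  assume p: "p \<in> P" and H: "open U \<and> a holomorphic_on U \<and> b holomorphic_on U \<and> c holomorphic_on U \<and>
        a ` U \<subseteq> ball 0 r \<and> b ` U \<subseteq> ball 0 r \<and> c ` U \<subseteq> ball 0 r"
  obtain N where N: "open N" "(p, t) \<in> N" "power_sum_on P r B u1 u2 C0 h N"
    using loc[OF p, of t] by blast
  from N(2,3) p obtain k \<rho> X1 X2 X3 X4 where k: "power_summable k \<rho>"
    and eq: "\<And>x y z. x \<in> ball 0 r \<Longrightarrow> y \<in> ball 0 r \<Longrightarrow> z \<in> ball 0 r \<Longrightarrow>
       h p t x y z = power_sum k (coords (of_real (u1 * t - X1) + x) (of_real (u2 - X2) + y)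
          (of_real (C0 p - X3) + z) (of_real (t + p - X4)))"
      "\<And>x y z b. x \<in> ball 0 r \<Longrightarrow> y \<in> ball 0 r \<Longrightarrow> z \<in> ball 0 r \<Longrightarrow>
       b \<in> Basis \<Longrightarrow> norm (coords (of_real (u1 * t - X1) + x) (of_real (u2 - X2) + y)
          (of_real (C0 p - X3) + z) (of_real (t + p - X4)) b) \<le> \<rho>"
    unfolding power_sum_on_def by blast
  have mem: "a \<epsilon> \<in> ball 0 r" "b \<epsilon> \<in> ball 0 r" "c \<epsilon> \<in> ball 0 r" if "\<epsilon> \<in> U" for \<epsilon>
    using H that by blast+
  define Z where "Z = (\<lambda>j \<epsilon>. coords (of_real (u1 * t - X1) + a \<epsilon>) (of_real (u2 - X2) + b \<epsilon>)
          (of_real (C0 p - X3) + c \<epsilon>) (of_real (t + p - X4)) j)"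
  have "(\<lambda>\<epsilon>. power_sum k (\<lambda>j. Z j \<epsilon>)) holomorphic_on U"
  proof (rule holomorphic_on_power_sum[OF _ k])
    fix j :: "real \<times> real \<times> real \<times> real"
    show "Z j holomorphic_on U"
      unfolding Z_def coords_def by (intro holomorphic_intros) (use H in auto)
    show "norm (Z j \<epsilon>) \<le> \<rho>" if "j \<in> Basis" "\<epsilon> \<in> U" for \<epsilon>
      unfolding Z_def by (intro eq(2) mem that)
  qed (use H in auto)
  moreover have "power_sum k (\<lambda>j. Z j \<epsilon>) = h p t (a \<epsilon>) (b \<epsilon>) (c \<epsilon>)" if "\<epsilon> \<in> U" for \<epsilon>
    using eq(1)[OF mem[OF that]] by (simp add: Z_def)
  ultimately show "(\<lambda>\<epsilon>. h p t (a \<epsilon>) (b \<epsilon>) (c \<epsilon>)) holomorphic_on U"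
    by (rule holomorphic_transform)
next
  fix p t :: real and x y z :: complex
  assume p: "p \<in> P" and xyz: "x \<in> ball 0 r" "y \<in> ball 0 r" "z \<in> ball 0 r"
  obtain N where N: "open N" "(p, t) \<in> N" "power_sum_on P r B u1 u2 C0 h N"
    using loc[OF p, of t] by blast
  from N(2,3) p xyz obtain k \<rho> X1 X2 X3 X4 where k: "power_summable k \<rho>"
      "(\<Sum>\<^sub>\<infinity>m\<in>Basis \<rightarrow>\<^sub>E UNIV. \<bar>k m\<bar> * (\<Prod>b\<in>Basis. \<rho> ^ m b)) \<le> B"
    and eq: "h p t x y z = power_sum k (coords (of_real (u1 * t - X1) + x) (of_real (u2 - X2) + y)
          (of_real (C0 p - X3) + z) (of_real (t + p - X4)))"
      "\<And>b. b \<in> Basis \<Longrightarrow> norm (coords (of_real (u1 * t - X1) + x) (of_real (u2 - X2) + y)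
          (of_real (C0 p - X3) + z) (of_real (t + p - X4)) b) \<le> \<rho>"
    unfolding power_sum_on_def by blast
  show "norm (h p t x y z) \<le> B"
    unfolding eq(1) by (rule order_trans[OF norm_power_sum_le[OF k(1)] k(2)]) (rule eq(2))
qed

lemma periodic_int_multiple:
  fixes h :: "real \<Rightarrow> 'a"
  assumes "\<And>x. h (x + d) = h x"
  shows "h (x + d * of_int n) = h x"
proof (induction n rule: int_induct[where k = 0])
  case (step1 i)
  then show ?case using assms[of "x + d * of_int i"] by (simp add: algebra_simps)
next
  case (step2 i)
  then show ?case using assms[of "x + d * of_int (i - 1)"] by (simp add: algebra_simps)
qed simp

text \<open>
Near each phase and time the complexification along the unperturbed orbit is a single power series.
Finitely many of these neighbourhoods cover the phases and one period of time, which gives a common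
radius and a common bound; periodicity carries them to all times.
\<close>

lemma complex_family_cext:
  fixes u1 u2 T :: real and C0 :: "real \<Rightarrow> real"
  assumes an: "real_analytic_on (\<lambda>(\<alpha>, A, C, t). H \<alpha> A C t) (UNIV \<times> W \<times> UNIV \<times> UNIV)"
    and W: "open W" "u2 \<in> W"
    and P: "compact P" and C0: "continuous_on P C0" and T: "T > 0"
    and per: "\<And>\<alpha> A C t. H (\<alpha> + u1 * T) A C (t + T) = H \<alpha> A C t"
  defines "h \<equiv> \<lambda>p t x y z. cext H (of_real (u1 * t) + x) (of_real u2 + y) (of_real (C0 p) + z) (t + p)"
  obtains r B where "r > 0" "complex_family r B P T h"
proof -
  have hper: "h p (t + T) x y z = h p t x y z" for p t x y z
    using cext_periodic[of H "u1 * T" T "of_real (u1 * t) + x" "of_real u2 + y" "of_real (C0 p) + z" "t + p"]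
      per by (simp add: h_def algebra_simps)
  have base: "\<exists>\<delta> R B. \<delta> > 0 \<and> R > 0 \<and> power_sum_on P R B u1 u2 C0 h (ball (p0, t0) \<delta>)" if p0: "p0 \<in> P" for p0 t0
  proof -
    obtain r c \<rho> where r: "r > 0" "power_summable c \<rho>" and
      eq: "\<And>z1 z2 z3 s. norm (z1 - of_real (u1 * t0)) < r \<Longrightarrow> norm (z2 - of_real u2) < r \<Longrightarrow>
        norm (z3 - of_real (C0 p0)) < r \<Longrightarrow> \<bar>s - (t0 + p0)\<bar> < r \<Longrightarrow>
        cext H z1 z2 z3 s = power_sum c (coords (z1 - of_real (u1 * t0)) (z2 - of_real u2) (z3 - of_real (C0 p0)) (of_real (s - (t0 + p0)))) \<and>
        (\<forall>b\<in>Basis. norm (coords (z1 - of_real (u1 * t0)) (z2 - of_real u2) (z3 - of_real (C0 p0)) (of_real (s - (t0 + p0))) b) \<le> \<rho>)"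
      using cext_eq_power_sum[OF an W, of "u1 * t0" "C0 p0" "t0 + p0"] by blast
    obtain d where d: "d > 0" "\<And>p. p \<in> P \<Longrightarrow> dist p p0 < d \<Longrightarrow> \<bar>C0 p - C0 p0\<bar> < r / 2"
      using C0 p0 r(1) unfolding continuous_on_iff dist_real_def by (meson half_gt_zero)
    define \<delta> where "\<delta> = min d (r / (4 * (\<bar>u1\<bar> + 1)))"
    have \<delta>: "\<delta> > 0" using d r by (simp add: \<delta>_def)
    have \<delta>1: "\<delta> \<le> r / (4 * (\<bar>u1\<bar> + 1))" by (simp add: \<delta>_def)
    have u: "\<bar>u1\<bar> * \<delta> < r / 2" "\<delta> \<le> r / 4"
    proof -
      have "(\<bar>u1\<bar> + 1) * \<delta> \<le> r / 4"
        using \<delta>1 by (simp add: field_simps)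
      moreover have "\<bar>u1\<bar> * \<delta> \<le> (\<bar>u1\<bar> + 1) * \<delta>" "1 * \<delta> \<le> (\<bar>u1\<bar> + 1) * \<delta>"
        using \<delta> by (intro mult_right_mono; simp)+
      ultimately show "\<bar>u1\<bar> * \<delta> < r / 2" "\<delta> \<le> r / 4" using r by linarith+
    qed
    have "power_sum_on P (r / 2) (\<Sum>\<^sub>\<infinity>m\<in>Basis \<rightarrow>\<^sub>E UNIV. \<bar>c m\<bar> * (\<Prod>b\<in>Basis. \<rho> ^ m b)) u1 u2 C0 h (ball (p0, t0) \<delta>)"
      unfolding power_sum_on_def
    proof (rule exI[of _ c], rule exI[of _ \<rho>], rule exI[of _ "u1 * t0"], rule exI[of _ u2],
        rule exI[of _ "C0 p0"], rule exI[of _ "t0 + p0"], intro conjI r(2) order_refl allI impI)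
      fix p t :: real and x y z :: complex
      assume pt: "(p, t) \<in> ball (p0, t0) \<delta>" "p \<in> P" and xyz: "x \<in> ball 0 (r/2)" "y \<in> ball 0 (r/2)" "z \<in> ball 0 (r/2)"
      have dp: "dist p p0 < \<delta>" "dist t t0 < \<delta>"
        using pt(1) dist_fst_le[of "(p0, t0)" "(p, t)"] dist_snd_le[of "(p0, t0)" "(p, t)"]
        by (auto simp: dist_commute)
      have sh: "norm (of_real a + v) < r" if "\<bar>a\<bar> < r / 2" "v \<in> ball 0 (r/2)" for a :: real and v :: complex
        using norm_triangle_ineq[of "of_real a" v] that by simp
      have "\<bar>u1 * (t - t0)\<bar> \<le> \<bar>u1\<bar> * \<delta>"
        using dp unfolding abs_mult by (intro mult_left_mono) (auto simp: dist_real_def)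
      then have 1: "\<bar>u1 * t - u1 * t0\<bar> < r / 2" using u by (simp add: algebra_simps)
      have 2: "\<bar>C0 p - C0 p0\<bar> < r / 2" using d(2)[OF pt(2)] dp by (simp add: \<delta>_def)
      have 3: "\<bar>(t + p) - (t0 + p0)\<bar> < r" using dp u r unfolding dist_real_def by linarith
      have sub: "of_real a + v - of_real b = of_real (a - b) + v" for a b :: real and v :: complex by simp
      note e = eq[of "of_real (u1 * t) + x" "of_real u2 + y" "of_real (C0 p) + z" "t + p", unfolded sub]
      have e': "h p t x y z = power_sum c (coords (of_real (u1 * t - u1 * t0) + x) (of_real (u2 - u2) + y)
            (of_real (C0 p - C0 p0) + z) (of_real (t + p - (t0 + p0)))) \<and>
         (\<forall>b\<in>Basis. norm (coords (of_real (u1 * t - u1 * t0) + x) (of_real (u2 - u2) + y)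
            (of_real (C0 p - C0 p0) + z) (of_real (t + p - (t0 + p0))) b) \<le> \<rho>)"
        unfolding h_def
        by (rule e[OF sh[OF 1 xyz(1)] sh[OF _ xyz(2)] sh[OF 2 xyz(3)] 3]) (use r in simp)
      from e' show "h p t x y z = power_sum c (coords (of_real (u1 * t - u1 * t0) + x) (of_real (u2 - u2) + y)
            (of_real (C0 p - C0 p0) + z) (of_real (t + p - (t0 + p0))))" by blast
      from e' show "\<forall>b\<in>Basis. norm (coords (of_real (u1 * t - u1 * t0) + x) (of_real (u2 - u2) + y)
            (of_real (C0 p - C0 p0) + z) (of_real (t + p - (t0 + p0))) b) \<le> \<rho>" by blast
    qed
    with \<delta> r show ?thesis by (meson half_gt_zero)
  qed
  have mono: "power_sum_on P R' B' u1 u2 C0 h N'"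
    if "power_sum_on P R B u1 u2 C0 h N" "R' \<le> R" "B \<le> B'" "N' \<subseteq> N" for R R' B B' N N'
  proof -
    have "ball 0 R' \<subseteq> (ball 0 R :: complex set)" using that by (simp add: subset_ball)
    then show ?thesis using that unfolding power_sum_on_def
      by (meson order_trans subsetD)
  qed
  obtain \<delta> R B where base: "\<And>w. w \<in> P \<times> {0..T} \<Longrightarrow> \<delta> w > 0 \<and> R w > 0 \<and> power_sum_on P (R w) (B w) u1 u2 C0 h (ball w (\<delta> w))"
  proof -
    have "\<forall>w\<in>P \<times> {0..T}. \<exists>\<delta> R B. \<delta> > 0 \<and> R > 0 \<and> power_sum_on P R B u1 u2 C0 h (ball w \<delta>)"
      using base by auto
    then show ?thesis using that by metis
  qed
  have "compact (P \<times> {0..T})" using P by (intro compact_Times) auto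
  moreover have "P \<times> {0..T} \<subseteq> (\<Union>w\<in>P \<times> {0..T}. ball w (\<delta> w))"
    using base by (auto intro!: UN_I)
  ultimately obtain D where D: "D \<subseteq> P \<times> {0..T}" "finite D" "P \<times> {0..T} \<subseteq> (\<Union>w\<in>D. ball w (\<delta> w))"
    using compactE_image[of "P \<times> {0..T}" "P \<times> {0..T}" "\<lambda>w. ball w (\<delta> w)"] by blast
  define r where "r = Min (insert 1 (R ` D))"
  define b where "b = Max (insert 0 (B ` D))"
  have r: "r > 0" using D base by (auto simp: r_def)
  have good: "power_sum_on P r b u1 u2 C0 h (ball w (\<delta> w))" if "w \<in> D" for w
  proof (rule mono)
    show "power_sum_on P (R w) (B w) u1 u2 C0 h (ball w (\<delta> w))" using base D that by blast
    show "r \<le> R w" "B w \<le> b" using D that by (auto simp: r_def b_def)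
  qed auto
  have hper': "h p (t + of_int n * T) x y z = h p t x y z" for p t x y z n
    using periodic_int_multiple[of "\<lambda>t. h p t x y z" T t n] hper by (simp add: mult.commute)
  have "complex_family r b P T h"
  proof (rule complex_family_local[where h = h and T = T, OF _ C0 hper])
    fix p t assume p: "p \<in> P"
    \<comment> \<open>Shifting \<open>t\<close> by \<open>n\<close> periods brings it into \<open>{0..T}\<close>; the centre of the series shifts along.\<close>
    define n where "n = \<lfloor>t / T\<rfloor>"
    have "of_int n \<le> t / T" "t / T < of_int n + 1" by (auto simp: n_def)
    then have "of_int n * T \<le> t" "t \<le> (of_int n + 1) * T" using T by (auto simp: field_simps)
    then have "(p, t - of_int n * T) \<in> P \<times> {0..T}" using p by (auto simp: algebra_simps)
    then obtain w where w: "w \<in> D" "(p, t - of_int n * T) \<in> ball w (\<delta> w)" using D by blast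
    define N where "N = (\<lambda>v. (fst v, snd v - of_int n * T)) -` ball w (\<delta> w)"
    have "open N" unfolding N_def by (intro open_vimage continuous_intros) auto
    moreover have "(p, t) \<in> N" using w by (simp add: N_def)
    moreover have "power_sum_on P r b u1 u2 C0 h N"
    proof -
      from good[OF w(1)] obtain c \<rho> X1 X2 X3 X4 where c: "power_summable c \<rho>"
         "(\<Sum>\<^sub>\<infinity>m\<in>Basis \<rightarrow>\<^sub>E UNIV. \<bar>c m\<bar> * (\<Prod>b\<in>Basis. \<rho> ^ m b)) \<le> b"
        and eq: "\<And>p t x y z. (p, t) \<in> ball w (\<delta> w) \<Longrightarrow> p \<in> P \<Longrightarrow> x \<in> ball 0 r \<Longrightarrow> y \<in> ball 0 r \<Longrightarrow> z \<in> ball 0 r \<Longrightarrow>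
         h p t x y z = power_sum c (coords (of_real (u1 * t - X1) + x) (of_real (u2 - X2) + y)
            (of_real (C0 p - X3) + z) (of_real (t + p - X4))) \<and>
         (\<forall>b\<in>Basis. norm (coords (of_real (u1 * t - X1) + x) (of_real (u2 - X2) + y)
            (of_real (C0 p - X3) + z) (of_real (t + p - X4)) b) \<le> \<rho>)"
        unfolding power_sum_on_def by blast
      have sh: "u1 * (t - of_int n * T) - X1 = u1 * t - (X1 + u1 * of_int n * T)"
        "t - of_int n * T + p - X4 = t + p - (X4 + of_int n * T)" for t p
        by (simp_all add: algebra_simps)
      have eq': "h p t x y z = power_sum c (coords (of_real (u1 * t - (X1 + u1 * of_int n * T)) + x) (of_real (u2 - X2) + y)
            (of_real (C0 p - X3) + z) (of_real (t + p - (X4 + of_int n * T)))) \<and>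
         (\<forall>b\<in>Basis. norm (coords (of_real (u1 * t - (X1 + u1 * of_int n * T)) + x) (of_real (u2 - X2) + y)
            (of_real (C0 p - X3) + z) (of_real (t + p - (X4 + of_int n * T))) b) \<le> \<rho>)"
        if "(p, t) \<in> N" "p \<in> P" "x \<in> ball 0 r" "y \<in> ball 0 r" "z \<in> ball 0 r" for p t x y z
      proof -
        have "(p, t - of_int n * T) \<in> ball w (\<delta> w)" using that(1) by (simp add: N_def)
        note eq[OF this that(2-), unfolded sh]
        moreover have "h p (t - of_int n * T) x y z = h p t x y z"
          using hper'[of p "t - of_int n * T" n] by simp
        ultimately show ?thesis by simp
      qed
      show ?thesis
        unfolding power_sum_on_def
        by (rule exI[of _ c], rule exI[of _ \<rho>], rule exI[of _ "X1 + u1 * of_int n * T"], rule exI[of _ X2],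
            rule exI[of _ X3], rule exI[of _ "X4 + of_int n * T"]) (use c eq' in blast)
    qed
    ultimately show "\<exists>N. open N \<and> (p, t) \<in> N \<and> power_sum_on P r b u1 u2 C0 h N" by blast
  qed
  with r show ?thesis by (rule that)
qed

text \<open>
The frequency is treated as a function of all variables that depends on the last one only; thus the
estimates for complex families apply to it.
\<close>

lemma complex_family_one_variable:
  fixes \<omega> :: "real \<Rightarrow> real"
  assumes "real_analytic_on \<omega> W" "open W" "A0 \<in> W"
  obtains r B v where "r > 0" "\<And>P T. complex_family r B P T (\<lambda>p t x y z. v z)"
    "\<And>y. \<bar>y\<bar> < r \<Longrightarrow> v (of_real y) = of_real (\<omega> (A0 + y) - \<omega> A0)"
proof -
  obtain \<rho> c where \<rho>: "\<rho> > 0" and c: "power_summable c \<rho>" and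
    ev': "\<And>y. (\<And>b. b \<in> Basis \<Longrightarrow> \<bar>y \<bullet> b\<bar> \<le> \<rho>) \<Longrightarrow>
       A0 + y \<in> W \<and> power_sum c (\<lambda>b. of_real (y \<bullet> b)) = of_real (\<omega> (A0 + y))"
    using real_analytic_on_power_sum[OF assms] by metis
  have ev: "power_sum c (\<lambda>b::real. of_real (y * b)) = of_real (\<omega> (A0 + y))" if "\<bar>y\<bar> \<le> \<rho>" for y
    using ev'[of y] that by simp
  define w where "w = (\<lambda>z. power_sum c (\<lambda>b::real. z))"
  have w: "w (of_real y) = of_real (\<omega> (A0 + y))" if "\<bar>y\<bar> \<le> \<rho>" for y
  proof -
    have "power_sum c (\<lambda>b::real. complex_of_real y) = power_sum c (\<lambda>b::real. of_real (y * b))"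
      unfolding power_sum_def by simp
    then show ?thesis using ev[OF that] by (simp add: w_def)
  qed
  define B where "B = (\<Sum>\<^sub>\<infinity>m\<in>Basis \<rightarrow>\<^sub>E UNIV. \<bar>c m\<bar> * (\<Prod>b\<in>Basis. \<rho> ^ m b)) + \<bar>\<omega> A0\<bar>"
  have bd: "norm (w z - of_real (\<omega> A0)) \<le> B" if "norm z < \<rho>" for z
    using norm_power_sum_le[OF c, of "\<lambda>_. z"] norm_triangle_ineq4[of "w z" "of_real (\<omega> A0)"] that
    by (simp add: w_def B_def)
  have hol: "(\<lambda>\<epsilon>. w (a \<epsilon>)) holomorphic_on U"
    if "open U" "a holomorphic_on U" "a ` U \<subseteq> ball 0 \<rho>" for a U
    unfolding w_def using that by (intro holomorphic_on_power_sum[OF _ c]) (auto simp: image_subset_iff less_imp_le)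
  have cont: "continuous_on S (\<lambda>u. w (a u))" if "continuous_on S a" "a ` S \<subseteq> ball 0 \<rho>"
    for a :: "real \<times> real \<times> complex \<times> complex \<times> complex \<Rightarrow> complex" and S
    unfolding w_def using that by (intro continuous_on_power_sum[OF c]) (auto simp: image_subset_iff less_imp_le)
  show ?thesis
  proof (rule that[OF \<rho>])
    show "complex_family \<rho> B P T (\<lambda>p t x y z. w z - of_real (\<omega> A0))" for P T
      unfolding complex_family_def
    proof (intro conjI ballI allI impI)
      show "continuous_on (P \<times> (UNIV :: real set) \<times> (ball 0 \<rho> :: complex set) \<times> (ball 0 \<rho> :: complex set) \<times> ball 0 \<rho>)
          (\<lambda>(p, t, x, y, z). w z - of_real (\<omega> A0))"
        (is "continuous_on ?S _")
      proof -
        have "continuous_on ?S (\<lambda>u. w (snd (snd (snd (snd u)))))"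
          by (rule cont) (auto intro!: continuous_intros)
        then show ?thesis
          unfolding case_prod_beta' by (rule continuous_on_diff[OF _ continuous_on_const])
      qed
    qed (auto intro!: holomorphic_intros hol bd)
  qed (use w \<rho> in auto)
qed

section \<open>Lipschitz estimates\<close>

lemma holomorphic_lipschitz:
  assumes hol: "\<phi> holomorphic_on ball 0 r" and bd: "\<And>x. x \<in> ball 0 r \<Longrightarrow> norm (\<phi> x) \<le> B"
    and x: "x \<in> ball 0 (r/2)" "x' \<in> ball 0 (r/2)"
  shows "norm (\<phi> x - \<phi> x') \<le> 4 * B / r * norm (x - x')"
proof (rule field_differentiable_bound[OF convex_ball _ _ x])
  have r: "r > 0" using x by (metis ball_eq_empty empty_iff half_gt_zero_iff linorder_not_le)
  fix z assume z: "z \<in> ball (0::complex) (r/2)"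
  show "(\<phi> has_field_derivative deriv \<phi> z) (at z within ball 0 (r/2))"
    by (rule has_field_derivative_at_within[OF holomorphic_derivI[OF hol]]) (use z r in auto)
  have sub: "ball z (r/2) \<subseteq> ball 0 r"
  proof
    fix w assume "w \<in> ball z (r/2)"
    then show "w \<in> ball 0 r" using dist_triangle[of 0 w z] z by auto
  qed
  have "norm (deriv \<phi> z) \<le> 2 * B / (r / 2)"
    by (rule norm_deriv_le[OF holomorphic_on_subset[OF hol sub]]) (use r bd sub in auto)
  then show "norm (deriv \<phi> z) \<le> 4 * B / r" by simp
qed

context
  fixes r B T :: real and P :: "real set" and h
  assumes fam: "complex_family r B P T h" and r: "r > 0"
begin

lemma complex_family_continuous:
  "continuous_on (P \<times> UNIV \<times> ball 0 r \<times> ball 0 r \<times> ball 0 r) (\<lambda>(p, t, x, y, z). h p t x y z)"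
  using fam by (simp add: complex_family_def)

lemma complex_family_holomorphic:
  assumes "p \<in> P" "open U" "a holomorphic_on U" "b holomorphic_on U" "c holomorphic_on U"
    "\<And>\<epsilon>. \<epsilon> \<in> U \<Longrightarrow> a \<epsilon> \<in> ball 0 r" "\<And>\<epsilon>. \<epsilon> \<in> U \<Longrightarrow> b \<epsilon> \<in> ball 0 r" "\<And>\<epsilon>. \<epsilon> \<in> U \<Longrightarrow> c \<epsilon> \<in> ball 0 r"
  shows "(\<lambda>\<epsilon>. h p t (a \<epsilon>) (b \<epsilon>) (c \<epsilon>)) holomorphic_on U"
proof -
  have "a ` U \<subseteq> ball 0 r" "b ` U \<subseteq> ball 0 r" "c ` U \<subseteq> ball 0 r" using assms(6-8) by blast+
  then show ?thesis using fam assms(1-5) unfolding complex_family_def by blast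
qed

lemma complex_family_bound:
  assumes "p \<in> P" "norm x < r" "norm y < r" "norm z < r"
  shows "norm (h p t x y z) \<le> B"
  using fam assms unfolding complex_family_def by simp

lemma complex_family_lipschitz:
  assumes p: "p \<in> P"
    and u: "norm x < r/2" "norm y < r/2" "norm z < r/2" "norm x' < r/2" "norm y' < r/2" "norm z' < r/2"
  shows "norm (h p t x y z - h p t x' y' z') \<le> 4 * B / r * (norm (x - x') + norm (y - y') + norm (z - z'))"
proof -
  have 1: "norm (h p t x y z - h p t x' y z) \<le> 4 * B / r * norm (x - x')"
    by (rule holomorphic_lipschitz[where \<phi> = "\<lambda>\<zeta>. h p t \<zeta> y z"])
      (use u r p in \<open>auto intro!: complex_family_holomorphic holomorphic_intros complex_family_bound\<close>)
  have 2: "norm (h p t x' y z - h p t x' y' z) \<le> 4 * B / r * norm (y - y')"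
    by (rule holomorphic_lipschitz[where \<phi> = "\<lambda>\<zeta>. h p t x' \<zeta> z"])
      (use u r p in \<open>auto intro!: complex_family_holomorphic holomorphic_intros complex_family_bound\<close>)
  have 3: "norm (h p t x' y' z - h p t x' y' z') \<le> 4 * B / r * norm (z - z')"
    by (rule holomorphic_lipschitz[where \<phi> = "\<lambda>\<zeta>. h p t x' y' \<zeta>"])
      (use u r p in \<open>auto intro!: complex_family_holomorphic holomorphic_intros complex_family_bound\<close>)
  have "norm (h p t x y z - h p t x' y' z') \<le> norm (h p t x y z - h p t x' y z)
      + norm (h p t x' y z - h p t x' y' z) + norm (h p t x' y' z - h p t x' y' z')"
    by norm
  with 1 2 3 show ?thesis by (simp add: algebra_simps)
qed

text \<open>
The difference is compared with the linearisation in \<open>z\<close> at the origin. The slope at another point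
differs from the slope at the origin by at most the Cauchy estimate for a difference of two translates
of \<open>h\<close>, which is small with the arguments; this smallness is what makes the Newton steps contracting.
\<close>

lemma complex_family_lipschitz_linear:
  assumes p: "p \<in> P"
    and u: "norm x < r/4" "norm y < r/4" "norm z < r/4" "norm x' < r/4" "norm y' < r/4" "norm z' < r/4"
  shows "norm (h p t x y z - h p t x' y' z' - (z - z') * deriv (\<lambda>z. h p t 0 0 z) 0)
      \<le> 4 * B / r * (norm (x - x') + norm (y - y'))
        + 32 * B / r\<^sup>2 * (norm x' + norm y' + norm z + norm z') * norm (z - z')"
proof -
  define D where "D = deriv (\<lambda>z. h p t 0 0 z) 0"
  have B: "B \<ge> 0" using complex_family_bound[OF p, of 0 0 0] norm_ge_zero[of "h p t 0 0 0"] r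
    by (metis norm_zero order_trans)
  have 1: "norm (h p t x y z - h p t x' y' z) \<le> 4 * B / r * (norm (x - x') + norm (y - y'))"
  proof -
    have "norm x < r/2" "norm y < r/2" "norm z < r/2" "norm x' < r/2" "norm y' < r/2"
      using u r by linarith+
    from complex_family_lipschitz[OF p this(1-5) this(3), of t] show ?thesis by simp
  qed
  define M where "M = 32 * B / r\<^sup>2 * (norm x' + norm y' + norm z + norm z')"
  have holz: "(\<lambda>\<zeta>. h p t a b \<zeta>) holomorphic_on ball 0 r" if "norm a < r" "norm b < r" for a b
    using that p by (intro complex_family_holomorphic) (auto intro!: holomorphic_intros)
  have 2: "norm ((h p t x' y' z - z * D) - (h p t x' y' z' - z' * D)) \<le> M * norm (z - z')"
  proof (rule field_differentiable_bound[of "closed_segment z z'" "\<lambda>\<zeta>. h p t x' y' \<zeta> - \<zeta> * D"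
        "\<lambda>\<zeta>. deriv (\<lambda>\<zeta>. h p t x' y' \<zeta>) \<zeta> - D"])
    fix \<zeta> assume \<zeta>: "\<zeta> \<in> closed_segment z z'"
    have "closed_segment z z' \<subseteq> ball 0 (r/4)"
      by (rule closed_segment_subset) (use u in auto)
    moreover have "closed_segment z z' \<subseteq> cball 0 (norm z + norm z')"
      by (rule closed_segment_subset) auto
    ultimately have \<zeta>1: "norm \<zeta> < r/4" "norm \<zeta> \<le> norm z + norm z'"
      using \<zeta> by auto
    have der: "((\<lambda>\<zeta>. h p t x' y' \<zeta>) has_field_derivative deriv (\<lambda>\<zeta>. h p t x' y' \<zeta>) \<zeta>) (at \<zeta>)"
      by (rule holomorphic_derivI[OF holz]) (use u \<zeta>1 r in auto)
    have "((\<lambda>\<zeta>. \<zeta> * D) has_field_derivative D) (at \<zeta>)"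
      by (auto intro!: derivative_eq_intros)
    from DERIV_diff[OF der this]
    show "((\<lambda>\<zeta>. h p t x' y' \<zeta> - \<zeta> * D) has_field_derivative deriv (\<lambda>\<zeta>. h p t x' y' \<zeta>) \<zeta> - D)
        (at \<zeta> within closed_segment z z')"
      by (rule has_field_derivative_at_within)
    define \<psi> where "\<psi> = (\<lambda>\<eta>. h p t x' y' (\<zeta> + \<eta>) - h p t 0 0 \<eta>)"
    have in2: "norm (\<zeta> + \<eta>) < r / 2" if "\<eta> \<in> ball 0 (r/4)" for \<eta>
      using norm_triangle_ineq[of \<zeta> \<eta>] \<zeta>1 that by simp
    have "norm (deriv \<psi> 0) \<le> 2 * (4 * B / r * (norm x' + norm y' + norm \<zeta>)) / (r / 4)"
    proof (rule norm_deriv_le)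
      have "(\<lambda>\<eta>. h p t x' y' (\<zeta> + \<eta>)) holomorphic_on ball 0 (r/4)"
      proof (rule complex_family_holomorphic[OF p open_ball])
        show "x' \<in> ball 0 r" "y' \<in> ball 0 r" using u r by auto
        show "\<zeta> + \<eta> \<in> ball 0 r" if "\<eta> \<in> ball 0 (r/4)" for \<eta>
          using in2[OF that] r by simp
      qed (intro holomorphic_intros)+
      moreover have "(\<lambda>\<eta>. h p t 0 0 \<eta>) holomorphic_on ball 0 (r/4)"
        using p r by (intro complex_family_holomorphic) (auto intro!: holomorphic_intros)
      ultimately show "\<psi> holomorphic_on ball 0 (r/4)"
        unfolding \<psi>_def by (rule holomorphic_on_diff)
      fix \<eta> :: complex assume \<eta>: "\<eta> \<in> ball 0 (r/4)"
      have "norm (\<psi> \<eta>) \<le> 4 * B / r * (norm (x' - 0) + norm (y' - 0) + norm (\<zeta> + \<eta> - \<eta>))"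
        unfolding \<psi>_def
      proof (rule complex_family_lipschitz[OF p])
        have "norm \<eta> < r/4" using \<eta> by simp
        then show "norm x' < r/2" "norm y' < r/2" "norm \<eta> < r/2"
          using u r by linarith+
        show "norm (0::complex) < r/2" "norm (0::complex) < r/2" "norm (\<zeta> + \<eta>) < r/2"
          using r in2[OF \<eta>] by simp_all
      qed
      then show "norm (\<psi> \<eta>) \<le> 4 * B / r * (norm x' + norm y' + norm \<zeta>)" by simp
    qed (use r in auto)
    also have "deriv \<psi> 0 = deriv (\<lambda>\<zeta>. h p t x' y' \<zeta>) \<zeta> - D"
    proof (rule DERIV_imp_deriv)
      have "((\<lambda>\<eta>. h p t x' y' (\<zeta> + \<eta>)) has_field_derivative deriv (\<lambda>\<zeta>. h p t x' y' \<zeta>) \<zeta>) (at 0)"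
        using DERIV_shift[of "\<lambda>\<zeta>. h p t x' y' \<zeta>" _ 0 \<zeta>] der by (simp add: add.commute)
      moreover have "((\<lambda>\<eta>. h p t 0 0 \<eta>) has_field_derivative D) (at 0)"
        unfolding D_def by (rule holomorphic_derivI[OF holz]) (use r in auto)
      ultimately show "(\<psi> has_field_derivative deriv (\<lambda>\<zeta>. h p t x' y' \<zeta>) \<zeta> - D) (at 0)"
        unfolding \<psi>_def by (rule DERIV_diff)
    qed
    also have "2 * (4 * B / r * (norm x' + norm y' + norm \<zeta>)) / (r / 4) = 32 * B / r\<^sup>2 * (norm x' + norm y' + norm \<zeta>)"
      by (simp add: power2_eq_square)
    also have "\<dots> \<le> M"
      unfolding M_def using \<zeta>1 B r by (intro mult_left_mono) auto
    finally show "norm (deriv (\<lambda>\<zeta>. h p t x' y' \<zeta>) \<zeta> - D) \<le> M" .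
  qed auto
  have "norm (h p t x y z - h p t x' y' z' - (z - z') * D)
     \<le> norm (h p t x y z - h p t x' y' z) + norm ((h p t x' y' z - z * D) - (h p t x' y' z' - z' * D))"
    using norm_triangle_ineq[of "h p t x y z - h p t x' y' z" "(h p t x' y' z - z * D) - (h p t x' y' z' - z' * D)"]
    by (simp add: algebra_simps)
  with 1 2 show ?thesis unfolding M_def D_def by linarith
qed

end

section \<open>Averages and periodic primitives\<close>

definition mean :: "real \<Rightarrow> (real \<Rightarrow> complex) \<Rightarrow> complex" where
  "mean T u = of_real (1 / T) * integral {0..T} u"

text \<open>
For \<open>T\<close>-periodic \<open>u\<close> this is the periodic primitive of \<open>u - mean T u\<close> with zero mean. The explicit
kernel makes bounds and the dependence on parameters evident.
\<close>

definition periodic_primitive :: "real \<Rightarrow> (real \<Rightarrow> complex) \<Rightarrow> real \<Rightarrow> complex" where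
  "periodic_primitive T u t = integral {0..T} (\<lambda>s. of_real (s / T - 1 / 2) * u (t + s))"

lemma continuous_has_primitive:
  fixes u :: "real \<Rightarrow> complex"
  assumes "continuous_on UNIV u"
  obtains U where "\<And>t. (U has_vector_derivative u t) (at t)"
  using einterval_antiderivative[of "-\<infinity>" "\<infinity>" u] assms continuous_on_eq_continuous_at[of UNIV u]
  by auto

lemma norm_mean_le:
  assumes T: "T > 0" and cont: "continuous_on UNIV u" and bound: "\<And>t. norm (u t) \<le> M"
  shows "norm (mean T u) \<le> M"
proof -
  have "norm (integral {0..T} u) \<le> M * (T - 0)"
    by (rule integral_bound) (use T bound cont in \<open>auto intro: continuous_on_subset\<close>)
  then show ?thesis using T by (simp add: mean_def norm_divide divide_le_eq)
qed

lemma norm_periodic_primitive_le: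
  assumes T: "T > 0" and cont: "continuous_on UNIV u" and bound: "\<And>t. norm (u t) \<le> M"
  shows "norm (periodic_primitive T u t) \<le> T * M"
proof -
  have M: "M \<ge> 0" using bound[of 0] norm_ge_zero order_trans by blast
  have "norm (integral {0..T} (\<lambda>s. of_real (s / T - 1 / 2) * u (t + s))) \<le> M * (T - 0)"
  proof (rule integral_bound)
    show "continuous_on {0..T} (\<lambda>s. of_real (s / T - 1 / 2) * u (t + s))"
      by (intro continuous_intros continuous_on_compose2[OF cont]) (use T in auto)
    fix s assume s: "s \<in> {0..T}"
    have "s / T \<le> 1" "0 \<le> s / T" using s T by auto
    then have "\<bar>s / T - 1 / 2\<bar> \<le> 1" by linarith
    then have "\<bar>s / T - 1 / 2\<bar> * norm (u (t + s)) \<le> 1 * M"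
      using bound M by (intro mult_mono) auto
    then show "norm (of_real (s / T - 1 / 2) * u (t + s)) \<le> M"
      by (simp only: norm_mult norm_of_real mult_1)
  qed (use T in auto)
  then show ?thesis by (simp add: periodic_primitive_def mult.commute)
qed

context
  fixes T :: real and u :: "real \<Rightarrow> complex"
  assumes T: "T > 0" and cont: "continuous_on UNIV u" and per: "\<And>t. u (t + T) = u t"
begin

text \<open>
Integration by parts expresses the convolution through a primitive \<open>U\<close> of \<open>u\<close> and a primitive \<open>V\<close> of
\<open>U\<close>; periodicity of \<open>u\<close> enters as \<open>U (t + T) = U t + S\<close>, where \<open>S\<close> is the integral over a period.
\<close>

lemma periodic_primitive_properties:
  "(periodic_primitive T u has_vector_derivative u t - mean T u) (at t)"
  "integral {0..T} (periodic_primitive T u) = 0"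
proof -
  obtain U where U: "\<And>t. (U has_vector_derivative u t) (at t)"
    using continuous_has_primitive[OF cont] by blast
  have contU: "continuous_on UNIV U"
    by (intro continuous_at_imp_continuous_on ballI has_vector_derivative_continuous[OF U])
  obtain V where V: "\<And>t. (V has_vector_derivative U t) (at t)"
    using continuous_has_primitive[OF contU] by blast
  define S where "S = integral {0..T} u"
  have shift: "((\<lambda>t. X (t + c)) has_vector_derivative X' (t + c)) (at t)"
    if "\<And>t. (X has_vector_derivative X' t) (at t)" for X X' :: "real \<Rightarrow> complex" and c t
  proof -
    have "((\<lambda>t. t + c) has_vector_derivative 1 + 0) (at t)"
      by (intro has_vector_derivative_add has_vector_derivative_const has_vector_derivative_id)
    then show ?thesis
      using vector_diff_chain_at[of "\<lambda>t. t + c" 1 t X "X' (t + c)"] that by (simp add: o_def)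
  qed
  have const: "X t = X s" if X: "\<And>t. (X has_vector_derivative 0) (at t)" for X :: "real \<Rightarrow> complex" and t s
    using has_vector_derivative_zero_constant[of UNIV X] X by (metis UNIV_I convex_UNIV)
  have "((\<lambda>t. U (t + T) - U t) has_vector_derivative 0) (at t)" for t
    using has_vector_derivative_diff[OF shift[of U u T t] U[of t]] U per by simp
  from const[OF this, of _ 0] have "U (t + T) - U t = U T - U 0" for t by simp
  moreover have "U T - U 0 = S"
    unfolding S_def using fundamental_theorem_of_calculus[of 0 T U u] U T
    by (metis has_vector_derivative_at_within integral_unique less_imp_le)
  ultimately have US: "U (t + T) = U t + S" for t by (metis add.commute diff_add_cancel)
  have by_parts: "integral {0..T} (\<lambda>s. of_real (s / T - 1 / 2) * u (t + s)) =
      (of_real (T / T - 1 / 2) * U (t + T) - of_real (1 / T) * V (t + T)) -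
      (of_real (0 / T - 1 / 2) * U (t + 0) - of_real (1 / T) * V (t + 0))" for t
  proof (rule integral_unique, rule fundamental_theorem_of_calculus)
    fix s assume "s \<in> {0..T}"
    have a: "((\<lambda>s. of_real (s / T - 1 / 2) :: complex) has_vector_derivative of_real (1 / T)) (at s)"
      by (rule has_vector_derivative_of_real) (use T in \<open>auto intro!: derivative_eq_intros\<close>)
    have b: "((\<lambda>s. U (t + s)) has_vector_derivative u (t + s)) (at s)"
      using shift[of U u t s] U by (simp add: add.commute)
    have c: "((\<lambda>s. V (t + s)) has_vector_derivative U (t + s)) (at s)"
      using shift[of V U t s] V by (simp add: add.commute)
    have "((\<lambda>s. of_real (s / T - 1 / 2) * U (t + s) - of_real (1 / T) * V (t + s)) has_vector_derivative
        (of_real (s / T - 1 / 2) * u (t + s) + of_real (1 / T) * U (t + s)) - of_real (1 / T) * U (t + s)) (at s)"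
      by (intro has_vector_derivative_diff has_vector_derivative_mult a b c
          bounded_linear.has_vector_derivative[OF bounded_linear_mult_right])
    then show "((\<lambda>s. of_real (s / T - 1 / 2) * U (t + s) - of_real (1 / T) * V (t + s)) has_vector_derivative
        of_real (s / T - 1 / 2) * u (t + s)) (at s within {0..T})"
      by (simp add: has_vector_derivative_at_within)
  qed (use T in auto)
  have Q: "periodic_primitive T u t = U t + S / 2 - of_real (1 / T) * (V (t + T) - V t)" for t
    unfolding periodic_primitive_def by_parts US using T by (simp add: algebra_simps field_simps)
  have "((\<lambda>t. U t + S / 2 - of_real (1 / T) * (V (t + T) - V t)) has_vector_derivative
     u t + 0 - of_real (1 / T) * (U (t + T) - U t)) (at t)"
    by (intro has_vector_derivative_diff has_vector_derivative_add U has_vector_derivative_const shift V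
        bounded_linear.has_vector_derivative[OF bounded_linear_mult_right])
  then show "(periodic_primitive T u has_vector_derivative u t - mean T u) (at t)"
    unfolding Q[abs_def] US by (simp add: mean_def S_def)
  have "((\<lambda>t. V (t + T) - V t - of_real t * S) has_vector_derivative U (t + T) - U t - 1 * S) (at t)" for t
    by (intro has_vector_derivative_diff shift V has_vector_derivative_mult_left)
      (auto intro!: has_vector_derivative_of_real[of "\<lambda>x. x" 1, simplified] derivative_eq_intros)
  then have "((\<lambda>t. V (t + T) - V t - of_real t * S) has_vector_derivative 0) (at t)" for t
    by (simp add: US)
  from const[OF this, of _ 0] have "V (t + T) - V t - of_real t * S = V T - V 0" for t by simp
  then have VT: "V (t + T) - V t = of_real t * S + (V T - V 0)" for t
    by (metis add.commute diff_add_cancel)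
  have "((\<lambda>t. U t + S / 2 - of_real (1 / T) * (of_real t * S + (V T - V 0))) has_integral
     (V T + of_real T * (S / 2) - of_real (1 / T) * (of_real (T\<^sup>2 / 2) * S + of_real T * (V T - V 0))) -
     (V 0 + of_real 0 * (S / 2) - of_real (1 / T) * (of_real (0\<^sup>2 / 2) * S + of_real 0 * (V T - V 0)))) {0..T}"
  proof (rule fundamental_theorem_of_calculus)
    fix t assume "t \<in> {0..T}"
    have 1: "((\<lambda>t. complex_of_real t) has_vector_derivative of_real 1) (at t)"
      by (rule has_vector_derivative_of_real) (auto intro!: derivative_eq_intros)
    have 2: "((\<lambda>t. complex_of_real (t\<^sup>2 / 2)) has_vector_derivative of_real t) (at t)"
      by (rule has_vector_derivative_of_real) (auto intro!: derivative_eq_intros)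
    have "((\<lambda>t. V t + of_real t * (S / 2) - of_real (1 / T) * (of_real (t\<^sup>2 / 2) * S + of_real t * (V T - V 0)))
       has_vector_derivative U t + of_real 1 * (S / 2) - of_real (1 / T) * (of_real t * S + of_real 1 * (V T - V 0))) (at t)"
      by (intro has_vector_derivative_diff has_vector_derivative_add V 1 2
        bounded_linear.has_vector_derivative[OF bounded_linear_mult_right]
        bounded_linear.has_vector_derivative[OF bounded_linear_mult_left])
    then show "((\<lambda>t. V t + of_real t * (S / 2) - of_real (1 / T) * (of_real (t\<^sup>2 / 2) * S + of_real t * (V T - V 0)))
       has_vector_derivative U t + S / 2 - of_real (1 / T) * (of_real t * S + (V T - V 0))) (at t within {0..T})"
      by (simp add: has_vector_derivative_at_within)
  qed (use T in auto)
  then have "(periodic_primitive T u has_integral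
     (V T + of_real T * (S / 2) - of_real (1 / T) * (of_real (T\<^sup>2 / 2) * S + of_real T * (V T - V 0))) -
     (V 0 + of_real 0 * (S / 2) - of_real (1 / T) * (of_real (0\<^sup>2 / 2) * S + of_real 0 * (V T - V 0)))) {0..T}"
    unfolding Q[abs_def] VT .
  then show "integral {0..T} (periodic_primitive T u) = 0"
    unfolding integral_unique[OF \<open>(periodic_primitive T u has_integral _) _\<close>]
    using T by (simp add: field_simps power2_eq_square)
qed

end

section \<open>Families of functions depending holomorphically on a parameter\<close>

text \<open>
The class of functions of \<open>\<epsilon>\<close>, the phase and the time in which the periodic solutions are sought. It
contains the reality condition, by which the solutions at real \<open>\<epsilon>\<close> are real.
\<close>

definition param_family :: "real \<Rightarrow> real set \<Rightarrow> real \<Rightarrow> (complex \<Rightarrow> real \<Rightarrow> real \<Rightarrow> complex) \<Rightarrow> bool" where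
  "param_family e P T h \<longleftrightarrow>
     continuous_on (ball 0 e \<times> P \<times> UNIV) (\<lambda>(\<epsilon>, p, t). h \<epsilon> p t) \<and>
     (\<forall>p\<in>P. \<forall>t. (\<lambda>\<epsilon>. h \<epsilon> p t) holomorphic_on ball 0 e) \<and>
     (\<forall>\<epsilon>\<in>ball 0 e. \<forall>p\<in>P. \<forall>t. h \<epsilon> p (t + T) = h \<epsilon> p t) \<and>
     (\<forall>\<epsilon>\<in>ball 0 e. \<forall>p\<in>P. \<forall>t. \<epsilon> \<in> \<real> \<longrightarrow> h \<epsilon> p t \<in> \<real>)"

lemma param_familyD:
  assumes "param_family e P T h"
  shows "continuous_on (ball 0 e \<times> P \<times> UNIV) (\<lambda>(\<epsilon>, p, t). h \<epsilon> p t)"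
    and "p \<in> P \<Longrightarrow> (\<lambda>\<epsilon>. h \<epsilon> p t) holomorphic_on ball 0 e"
    and "norm \<epsilon> < e \<Longrightarrow> p \<in> P \<Longrightarrow> h \<epsilon> p (t + T) = h \<epsilon> p t"
    and "norm \<epsilon> < e \<Longrightarrow> p \<in> P \<Longrightarrow> \<epsilon> \<in> \<real> \<Longrightarrow> h \<epsilon> p t \<in> \<real>"
  using assms by (auto simp: param_family_def)

lemma param_family_continuous_time:
  assumes "param_family e P T h" "norm \<epsilon> < e" "p \<in> P"
  shows "continuous_on UNIV (h \<epsilon> p)"
proof -
  have "continuous_on UNIV (\<lambda>t. case (\<epsilon>, p, t) of (\<epsilon>, p, t) \<Rightarrow> h \<epsilon> p t)"
    by (rule continuous_on_compose2[OF param_familyD(1)[OF assms(1)]])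
      (use assms in \<open>auto intro!: continuous_intros\<close>)
  then show ?thesis by simp
qed

lemma param_family_const:
  assumes "continuous_on P \<mu>" "\<And>p. p \<in> P \<Longrightarrow> \<mu> p \<in> \<real>"
  shows "param_family e P T (\<lambda>\<epsilon> p t. \<mu> p)"
proof -
  have "continuous_on (ball 0 e \<times> P \<times> (UNIV :: real set)) (\<lambda>w. \<mu> (fst (snd w)))"
    by (rule continuous_on_compose2[OF assms(1)]) (auto intro!: continuous_intros)
  then show ?thesis using assms(2) by (auto simp: param_family_def case_prod_beta')
qed

lemma param_family_eps: "param_family e P T (\<lambda>\<epsilon> p t. \<epsilon>)"
  by (auto simp: param_family_def case_prod_beta' intro!: continuous_intros)

lemma param_family_add:
  assumes "param_family e P T h" "param_family e P T k"
  shows "param_family e P T (\<lambda>\<epsilon> p t. h \<epsilon> p t + k \<epsilon> p t)"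
  using assms by (auto simp: param_family_def case_prod_beta' intro!: continuous_intros holomorphic_intros)

lemma param_family_diff:
  assumes "param_family e P T h" "param_family e P T k"
  shows "param_family e P T (\<lambda>\<epsilon> p t. h \<epsilon> p t - k \<epsilon> p t)"
  using assms by (auto simp: param_family_def case_prod_beta' intro!: continuous_intros holomorphic_intros)

lemma param_family_mult:
  assumes "param_family e P T h" "param_family e P T k"
  shows "param_family e P T (\<lambda>\<epsilon> p t. h \<epsilon> p t * k \<epsilon> p t)"
  using assms by (auto simp: param_family_def case_prod_beta' intro!: continuous_intros holomorphic_intros)

lemma param_family_compose:
  assumes fam: "complex_family r B P T h" "r > 0"
    and real: "\<And>p t x y z. p \<in> P \<Longrightarrow> x \<in> \<real> \<Longrightarrow> y \<in> \<real> \<Longrightarrow> z \<in> \<real> \<Longrightarrow>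
      norm x < r \<Longrightarrow> norm y < r \<Longrightarrow> norm z < r \<Longrightarrow> h p t x y z \<in> \<real>"
    and abc: "param_family e P T a" "param_family e P T b" "param_family e P T c"
    and bd: "\<And>\<epsilon> p t. norm \<epsilon> < e \<Longrightarrow> p \<in> P \<Longrightarrow> norm (a \<epsilon> p t) < r"
      "\<And>\<epsilon> p t. norm \<epsilon> < e \<Longrightarrow> p \<in> P \<Longrightarrow> norm (b \<epsilon> p t) < r"
      "\<And>\<epsilon> p t. norm \<epsilon> < e \<Longrightarrow> p \<in> P \<Longrightarrow> norm (c \<epsilon> p t) < r"
  shows "param_family e P T (\<lambda>\<epsilon> p t. h p t (a \<epsilon> p t) (b \<epsilon> p t) (c \<epsilon> p t))"
  unfolding param_family_def
proof (intro conjI ballI allI impI)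
  have "continuous_on (ball 0 e \<times> P \<times> UNIV) (\<lambda>w. case (fst (snd w), snd (snd w),
      (\<lambda>(\<epsilon>, p, t). a \<epsilon> p t) w, (\<lambda>(\<epsilon>, p, t). b \<epsilon> p t) w, (\<lambda>(\<epsilon>, p, t). c \<epsilon> p t) w) of (p, t, x, y, z) \<Rightarrow> h p t x y z)"
    by (rule continuous_on_compose2[OF complex_family_continuous[OF fam]])
      (auto intro!: continuous_intros abc[THEN param_familyD(1)] bd)
  then show "continuous_on (ball 0 e \<times> P \<times> UNIV) (\<lambda>(\<epsilon>, p, t). h p t (a \<epsilon> p t) (b \<epsilon> p t) (c \<epsilon> p t))"
    by (simp add: case_prod_beta')
next
  fix p t assume "p \<in> P"
  then show "(\<lambda>\<epsilon>. h p t (a \<epsilon> p t) (b \<epsilon> p t) (c \<epsilon> p t)) holomorphic_on ball 0 e"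
    by (intro complex_family_holomorphic[OF fam] abc[THEN param_familyD(2)]) (auto intro: bd)
next
  fix \<epsilon> p t assume "\<epsilon> \<in> ball (0::complex) e" and p: "p \<in> P"
  then have e: "norm \<epsilon> < e" by simp
  show "h p (t + T) (a \<epsilon> p (t + T)) (b \<epsilon> p (t + T)) (c \<epsilon> p (t + T)) = h p t (a \<epsilon> p t) (b \<epsilon> p t) (c \<epsilon> p t)"
    using fam p abc[THEN param_familyD(3), OF e p] by (simp add: complex_family_def)
  assume "\<epsilon> \<in> \<real>"
  then show "h p t (a \<epsilon> p t) (b \<epsilon> p t) (c \<epsilon> p t) \<in> \<real>"
    by (intro real p bd e abc[THEN param_familyD(4), OF e p])
qed

lemma integral_in_Reals:
  fixes u :: "real \<Rightarrow> complex"
  assumes "continuous_on {a..b} u" "\<And>s. s \<in> {a..b} \<Longrightarrow> u s \<in> \<real>"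
  shows "integral {a..b} u \<in> \<real>"
proof -
  have "Im (integral {a..b} u) = integral {a..b} (\<lambda>s. Im (u s))"
    using integral_linear[OF integrable_continuous_real[OF assms(1)] bounded_linear_Im] by (simp add: o_def)
  also have "\<dots> = integral {a..b} (\<lambda>s. 0)"
    by (rule integral_cong) (use assms(2) in \<open>auto simp: complex_is_Real_iff\<close>)
  finally show ?thesis by (simp add: complex_is_Real_iff)
qed

lemma param_family_integral:
  fixes k :: "complex \<Rightarrow> real \<Rightarrow> real \<Rightarrow> real \<Rightarrow> complex"
  assumes cont: "continuous_on (ball 0 e \<times> P \<times> UNIV \<times> {0..b}) (\<lambda>(\<epsilon>, p, t, s). k \<epsilon> p t s)"
    and hol: "\<And>p t s. p \<in> P \<Longrightarrow> s \<in> {0..b} \<Longrightarrow> (\<lambda>\<epsilon>. k \<epsilon> p t s) holomorphic_on ball 0 e"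
    and per: "\<And>\<epsilon> p t s. norm \<epsilon> < e \<Longrightarrow> p \<in> P \<Longrightarrow> k \<epsilon> p (t + T) s = k \<epsilon> p t s"
    and real: "\<And>\<epsilon> p t s. norm \<epsilon> < e \<Longrightarrow> p \<in> P \<Longrightarrow> \<epsilon> \<in> \<real> \<Longrightarrow> s \<in> {0..b} \<Longrightarrow> k \<epsilon> p t s \<in> \<real>"
  shows "param_family e P T (\<lambda>\<epsilon> p t. integral {0..b} (k \<epsilon> p t))"
  unfolding param_family_def
proof (intro conjI ballI allI impI)
  have "continuous_on ((ball 0 e \<times> P \<times> UNIV) \<times> cbox 0 b)
     (\<lambda>v. (\<lambda>(\<epsilon>, p, t, s). k \<epsilon> p t s) (fst (fst v), fst (snd (fst v)), snd (snd (fst v)), snd v))"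
    by (rule continuous_on_compose2[OF cont]) (auto intro!: continuous_intros)
  then have "continuous_on ((ball 0 e \<times> P \<times> UNIV) \<times> cbox 0 b) (\<lambda>(w, s). (\<lambda>(\<epsilon>, p, t). k \<epsilon> p t s) w)"
    by (simp add: case_prod_beta')
  from integral_continuous_on_param[OF this]
  show "continuous_on (ball 0 e \<times> P \<times> UNIV) (\<lambda>(\<epsilon>, p, t). integral {0..b} (k \<epsilon> p t))"
    by (simp add: case_prod_beta')
next
  fix p t assume p: "p \<in> P"
  have "continuous_on (ball 0 e \<times> {0..b}) (\<lambda>v. (\<lambda>(\<epsilon>, p, t, s). k \<epsilon> p t s) (fst v, p, t, snd v))"
    by (rule continuous_on_compose2[OF cont]) (use p in \<open>auto intro!: continuous_intros\<close>)
  then show "(\<lambda>\<epsilon>. integral {0..b} (k \<epsilon> p t)) holomorphic_on ball 0 e"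
    by (intro holomorphic_param_integral hol p) (auto simp: case_prod_beta')
next
  fix \<epsilon> p t assume "\<epsilon> \<in> ball (0::complex) e" and p: "p \<in> P"
  then have e: "norm \<epsilon> < e" by simp
  have "k \<epsilon> p (t + T) = k \<epsilon> p t"
    by (rule ext) (rule per[OF e p])
  then show "integral {0..b} (k \<epsilon> p (t + T)) = integral {0..b} (k \<epsilon> p t)"
    by simp
  assume r: "\<epsilon> \<in> \<real>"
  have "continuous_on {0..b} (\<lambda>s. (\<lambda>(\<epsilon>, p, t, s). k \<epsilon> p t s) (\<epsilon>, p, t, s))"
    by (rule continuous_on_compose2[OF cont]) (use p e in \<open>auto intro!: continuous_intros\<close>)
  then show "integral {0..b} (k \<epsilon> p t) \<in> \<real>"
    by (intro integral_in_Reals real e p r) auto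
qed

lemma param_family_mean:
  assumes h: "param_family e P T h"
  shows "param_family e P T (\<lambda>\<epsilon> p t. mean T (h \<epsilon> p))"
proof -
  have "param_family e P T (\<lambda>\<epsilon> p t. integral {0..T} (\<lambda>s. h \<epsilon> p s))"
  proof (rule param_family_integral)
    have "continuous_on (ball 0 e \<times> P \<times> UNIV \<times> {0..T})
       (\<lambda>v. (\<lambda>(\<epsilon>, p, s). h \<epsilon> p s) (fst v, fst (snd v), snd (snd (snd v))))"
      by (rule continuous_on_compose2[OF param_familyD(1)[OF h]]) (auto intro!: continuous_intros)
    then show "continuous_on (ball 0 e \<times> P \<times> UNIV \<times> {0..T}) (\<lambda>(\<epsilon>, p, t, s). h \<epsilon> p s)"
      by (simp add: case_prod_beta')
  qed (auto intro: param_familyD[OF h])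
  from param_family_mult[OF param_family_const[of P "\<lambda>_. of_real (1 / T)"] this]
  show ?thesis by (simp add: mean_def)
qed

lemma param_family_periodic_primitive:
  assumes h: "param_family e P T h" and T: "T > 0"
  shows "param_family e P T (\<lambda>\<epsilon> p t. periodic_primitive T (h \<epsilon> p) t)"
  unfolding periodic_primitive_def
proof (rule param_family_integral)
  have "continuous_on (ball 0 e \<times> P \<times> UNIV \<times> {0..T})
     (\<lambda>v. of_real (snd (snd (snd v)) / T - 1 / 2) * (\<lambda>(\<epsilon>, p, s). h \<epsilon> p s) (fst v, fst (snd v), fst (snd (snd v)) + snd (snd (snd v))))"
    by (intro continuous_intros continuous_on_compose2[OF param_familyD(1)[OF h]]) (use T in auto)
  then show "continuous_on (ball 0 e \<times> P \<times> UNIV \<times> {0..T}) (\<lambda>(\<epsilon>, p, t, s). of_real (s / T - 1 / 2) * h \<epsilon> p (t + s))"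
    by (simp add: case_prod_beta')
next
  fix \<epsilon> :: complex and p t s :: real assume "norm \<epsilon> < e" "p \<in> P"
  then have "h \<epsilon> p (t + s + T) = h \<epsilon> p (t + s)" by (rule param_familyD(3)[OF h])
  then show "of_real (s / T - 1 / 2) * h \<epsilon> p (t + T + s) = of_real (s / T - 1 / 2) * h \<epsilon> p (t + s)"
    by (simp add: add_ac)
qed (auto intro!: holomorphic_intros Reals_mult param_familyD[OF h] simp del: of_real_diff of_real_divide)

section \<open>Periodic solutions of the complexified system\<close>

text \<open>
The contraction principle for the supremum over \<open>S\<close>. The functions are total and their values outside
\<open>S\<close> are arbitrary, hence the admissible ones form no metric space, and the fixed point equation is
obtained on \<open>S\<close> only.
\<close>

lemma function_fixed_point:
  fixes \<Phi> :: "('x \<Rightarrow> complex) \<Rightarrow> ('x \<Rightarrow> complex)" and S :: "'x set"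
  assumes adm0: "adm u0" and maps: "\<And>u. adm u \<Longrightarrow> adm (\<Phi> u)"
    and contr: "\<And>u w d x. adm u \<Longrightarrow> adm w \<Longrightarrow> (\<And>x. x \<in> S \<Longrightarrow> norm (u x - w x) \<le> d) \<Longrightarrow> x \<in> S \<Longrightarrow>
        norm (\<Phi> u x - \<Phi> w x) \<le> d / 2"
    and init: "\<And>x. x \<in> S \<Longrightarrow> norm (\<Phi> u0 x - u0 x) \<le> d0"
    and closed: "\<And>U u. (\<And>n::nat. adm (U n)) \<Longrightarrow> uniform_limit S U u sequentially \<Longrightarrow> adm u"
  obtains u where "adm u" "\<And>x. x \<in> S \<Longrightarrow> \<Phi> u x = u x"
proof -
  define U where "U = (\<lambda>n. (\<Phi> ^^ n) u0)"
  have U_Suc: "U (Suc n) = \<Phi> (U n)" for n by (simp add: U_def)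
  have adm: "adm (U n)" for n
    by (induction n) (use adm0 maps in \<open>auto simp: U_def\<close>)
  have step: "norm (U (Suc n) x - U n x) \<le> d0 * (1 / 2) ^ n" if "x \<in> S" for n x
    using that
  proof (induction n arbitrary: x)
    case 0
    then show ?case using init by (simp add: U_def)
  next
    case (Suc n)
    have "norm (\<Phi> (U (Suc n)) x - \<Phi> (U n) x) \<le> d0 * (1 / 2) ^ n / 2"
      by (rule contr[OF adm adm Suc.IH Suc.prems])
    then show ?case by (simp add: U_Suc)
  qed
  have "uniform_limit S (\<lambda>n x. \<Sum>i<n. U (Suc i) x - U i x) (\<lambda>x. \<Sum>i. U (Suc i) x - U i x) sequentially"
    by (rule Weierstrass_m_test[OF step]) (auto intro!: summable_mult summable_geometric)
  moreover have "(\<lambda>n x. \<Sum>i<n. U (Suc i) x - U i x) = (\<lambda>n x. U n x - U 0 x)"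
    by (intro ext) (rule sum_lessThan_telescope)
  ultimately have "uniform_limit S (\<lambda>n x. U n x - U 0 x) (\<lambda>x. \<Sum>i. U (Suc i) x - U i x) sequentially"
    by simp
  from uniform_limit_add[OF this uniform_limit_const[where c = "U 0"]]
  have lim: "uniform_limit S U (\<lambda>x. (\<Sum>i. U (Suc i) x - U i x) + U 0 x) sequentially"
    by simp
  define u where "u = (\<lambda>x. (\<Sum>i. U (Suc i) x - U i x) + U 0 x)"
  have lim: "uniform_limit S U u sequentially" using lim by (simp add: u_def)
  have u: "adm u" by (rule closed[OF adm lim])
  show ?thesis
  proof (rule that[OF u])
    fix x assume x: "x \<in> S"
    have "norm (\<Phi> u x - u x) \<le> \<eta>" if \<eta>: "\<eta> > 0" for \<eta>
    proof -
      have "\<forall>\<^sub>F n in sequentially. \<forall>y\<in>S. dist (U n y) (u y) < \<eta> / 2"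
        using lim \<eta> unfolding uniform_limit_iff by (meson half_gt_zero)
      then obtain N where N: "\<And>n y. n \<ge> N \<Longrightarrow> y \<in> S \<Longrightarrow> norm (U n y - u y) < \<eta> / 2"
        unfolding eventually_sequentially dist_norm by blast
      have "norm (\<Phi> (U N) x - \<Phi> u x) \<le> \<eta> / 2 / 2"
        by (rule contr[OF adm u _ x]) (use N in \<open>auto intro: less_imp_le\<close>)
      moreover have "norm (\<Phi> (U N) x - u x) < \<eta> / 2"
        using N[of "Suc N" x] x by (simp add: U_Suc)
      ultimately show ?thesis
        using norm_triangle_ineq4[of "\<Phi> (U N) x - u x" "\<Phi> (U N) x - \<Phi> u x"] \<eta> by simp
    qed
    then have "norm (\<Phi> u x - u x) \<le> 0" by (metis dense_ge)
    then show "\<Phi> u x = u x" by simp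
  qed
qed

lemma mean_diff:
  assumes "continuous_on UNIV u" "continuous_on UNIV w"
  shows "mean T (\<lambda>t. u t - w t) = mean T u - mean T w"
proof -
  have "u integrable_on {0..T}" "w integrable_on {0..T}"
    using assms by (auto intro!: integrable_continuous_real intro: continuous_on_subset)
  then show ?thesis by (simp add: mean_def Henstock_Kurzweil_Integration.integral_diff right_diff_distrib)
qed

lemma mean_mult: "mean T (\<lambda>t. c * u t) = c * mean T u"
  by (simp add: mean_def)

lemma mean_const: "T > 0 \<Longrightarrow> mean T (\<lambda>t. c) = c"
  by (simp add: mean_def scaleR_conv_of_real)

lemma periodic_primitive_diff:
  assumes "continuous_on UNIV u" "continuous_on UNIV w" "T > 0"
  shows "periodic_primitive T (\<lambda>t. u t - w t) t = periodic_primitive T u t - periodic_primitive T w t"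
proof -
  have "(\<lambda>s. of_real (s / T - 1 / 2) * x (t + s)) integrable_on {0..T}"
    if "continuous_on UNIV x" for x :: "real \<Rightarrow> complex"
    using assms(3) by (intro integrable_continuous_real continuous_intros continuous_on_compose2[OF that]) auto
  from Henstock_Kurzweil_Integration.integral_diff[OF this[OF assms(1)] this[OF assms(2)]]
  show ?thesis by (simp add: periodic_primitive_def right_diff_distrib)
qed

text \<open>
The weight \<open>L\<close> is chosen first, to control the linear terms; then the radius \<open>\<rho>\<close>, to control the
quadratic terms for this \<open>L\<close>; and finally \<open>e\<close>, to control the terms that carry a factor \<open>\<epsilon>\<close>.
\<close>

lemma contraction_constants:
  fixes K1 K2 B T w m r :: real
  assumes "K1 \<ge> 0" "K2 \<ge> 0" "B \<ge> 0" "T > 0" "w > 0" "m > 0" "r > 0"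
  obtains L \<rho> e where "L \<ge> 1" "\<rho> > 0" "e > 0" "L * \<rho> < r / 4"
    "T * (K1 / L + 3 * e * K1 * L) \<le> 1 / 2"
    "2 * K2 * \<rho> / w + 3 * e * K1 * L\<^sup>2 / w + 3 * e * T * K1 * L\<^sup>2 \<le> 1 / 2"
    "(2 * K1 + 4 * K2 * L\<^sup>2 * \<rho>) / (L * m) \<le> 1 / 2"
    "T * e * B \<le> \<rho> / 2" "L * (e * B / w + e * T * B) \<le> \<rho> / 2"
proof -
  define L where "L = 1 + 4 * T * K1 + 8 * K1 / m"
  have L: "L \<ge> 1" "4 * T * K1 \<le> L" "8 * K1 / m \<le> L"
    using assms by (auto simp: L_def)
  define \<rho> where "\<rho> = min (r / (8 * L)) (min (m / (16 * (K2 + 1) * L)) (w / (8 * (K2 + 1))))"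
  have \<rho>: "\<rho> > 0" "\<rho> \<le> r / (8 * L)" "\<rho> \<le> m / (16 * (K2 + 1) * L)" "\<rho> \<le> w / (8 * (K2 + 1))"
    using assms L by (auto simp: \<rho>_def)
  define X where "X = 1 + 3 * T * K1 * L + 3 * K1 * L\<^sup>2 / w + 3 * T * K1 * L\<^sup>2 + T * B + L * B / w + L * T * B"
  have pos: "0 \<le> 3 * T * K1 * L" "0 \<le> 3 * K1 * L\<^sup>2 / w" "0 \<le> 3 * T * K1 * L\<^sup>2" "0 \<le> T * B" "0 \<le> L * B / w" "0 \<le> L * T * B"
    using assms L by auto
  have X: "X \<ge> 1" using pos unfolding X_def by linarith
  define e where "e = min (1 / 4) (\<rho> / 2) / X"
  have e: "e > 0" using \<rho> X by (simp add: e_def)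
  have eX: "e * Y \<le> 1 / 4" "e * Y \<le> \<rho> / 2" if "Y \<le> X" for Y
  proof -
    have "e * Y \<le> e * X" using that e by (intro mult_left_mono) auto
    also have "e * X = min (1 / 4) (\<rho> / 2)" using X by (simp add: e_def)
    finally show "e * Y \<le> 1 / 4" "e * Y \<le> \<rho> / 2" by auto
  qed
  have "L * \<rho> < r / 4"
  proof -
    have "L * \<rho> \<le> L * (r / (8 * L))" using \<rho> L by (intro mult_left_mono) auto
    also have "\<dots> = r / 8" using L by simp
    finally show ?thesis using assms by simp
  qed
  moreover have "T * (K1 / L + 3 * e * K1 * L) \<le> 1 / 2"
  proof -
    have "T * K1 / L \<le> 1 / 4" using L by (simp add: field_simps)
    moreover have "e * (3 * T * K1 * L) \<le> 1 / 4" using pos by (intro eX(1)) (simp add: X_def)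
    moreover have "T * (K1 / L + 3 * e * K1 * L) = T * K1 / L + e * (3 * T * K1 * L)"
      by (simp add: algebra_simps)
    ultimately show ?thesis by linarith
  qed
  moreover have "2 * K2 * \<rho> / w + 3 * e * K1 * L\<^sup>2 / w + 3 * e * T * K1 * L\<^sup>2 \<le> 1 / 2"
  proof -
    have "2 * K2 * \<rho> \<le> 2 * (K2 + 1) * \<rho>" using \<rho> by simp
    also have "\<dots> \<le> 2 * (K2 + 1) * (w / (8 * (K2 + 1)))"
      using \<rho> assms by (intro mult_left_mono) auto
    also have "\<dots> = w / 4" using assms by (simp add: field_simps)
    finally have "2 * K2 * \<rho> / w \<le> 1 / 4" using assms by (simp add: field_simps)
    moreover have "e * (3 * K1 * L\<^sup>2 / w + 3 * T * K1 * L\<^sup>2) \<le> 1 / 4"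
      using pos by (intro eX(1)) (simp add: X_def)
    moreover have "3 * e * K1 * L\<^sup>2 / w + 3 * e * T * K1 * L\<^sup>2 = e * (3 * K1 * L\<^sup>2 / w + 3 * T * K1 * L\<^sup>2)"
      by (simp add: algebra_simps)
    ultimately show ?thesis by linarith
  qed
  moreover have "(2 * K1 + 4 * K2 * L\<^sup>2 * \<rho>) / (L * m) \<le> 1 / 2"
  proof -
    have "2 * K1 / (L * m) \<le> 1 / 4" using L assms by (simp add: field_simps)
    moreover have "4 * K2 * L * \<rho> \<le> 4 * (K2 + 1) * L * \<rho>"
      using \<rho> L by (intro mult_right_mono) auto
    moreover have "4 * (K2 + 1) * L * \<rho> \<le> 4 * (K2 + 1) * L * (m / (16 * (K2 + 1) * L))"
      using \<rho> assms L by (intro mult_left_mono) auto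
    moreover have "4 * (K2 + 1) * L * (m / (16 * (K2 + 1) * L)) = m / 4"
    proof -
      have "4 * k * L * (m / (16 * k * L)) = m / 4" if "k > 0" for k
        using that L(1) by simp
      from this[of "K2 + 1"] assms(2) show ?thesis by simp
    qed
    moreover have "(2 * K1 + 4 * K2 * L\<^sup>2 * \<rho>) / (L * m) = 2 * K1 / (L * m) + 4 * K2 * L * \<rho> / m"
      using L assms by (simp add: field_simps power2_eq_square)
    moreover have "4 * K2 * L * \<rho> / m \<le> 1 / 4" if "4 * K2 * L * \<rho> \<le> m / 4"
      using that assms by (simp add: field_simps)
    ultimately show ?thesis by linarith
  qed
  moreover have "T * e * B \<le> \<rho> / 2"
    using eX(2)[of "T * B"] pos by (simp add: X_def mult_ac)
  moreover have "L * (e * B / w + e * T * B) \<le> \<rho> / 2"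
    using eX(2)[of "L * B / w + L * T * B"] pos by (simp add: X_def algebra_simps)
  ultimately show ?thesis using that L(1) \<rho>(1) e by blast
qed

text \<open>
The data of the system \<open>a' = v(b) + \<epsilon> f(p, t, a, b, c)\<close>, \<open>b' = \<epsilon> g(p, t, a, b, c)\<close> for the deviations
from the unperturbed solution of phase \<open>p\<close>. Here \<open>w1\<close> is the twist, and \<open>g0\<close> and \<open>g1\<close> say that the
Melnikov function vanishes at \<open>c = 0\<close> and that its derivative in \<open>c\<close> does not.
\<close>

locale melnikov_setup =
  fixes P :: "real set" and T r B :: real
    and f g :: "real \<Rightarrow> real \<Rightarrow> complex \<Rightarrow> complex \<Rightarrow> complex \<Rightarrow> complex"
    and v :: "complex \<Rightarrow> complex" and w1 :: complex
  assumes P: "compact P" and T: "T > 0" and r: "r > 0"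
    and fam_f: "complex_family r B P T f" and fam_g: "complex_family r B P T g"
    and fam_v: "complex_family r B P T (\<lambda>p t x y z. v z)"
    and real_f: "\<And>p t x y z. p \<in> P \<Longrightarrow> x \<in> \<real> \<Longrightarrow> y \<in> \<real> \<Longrightarrow> z \<in> \<real> \<Longrightarrow>
      norm x < r \<Longrightarrow> norm y < r \<Longrightarrow> norm z < r \<Longrightarrow> f p t x y z \<in> \<real>"
    and real_g: "\<And>p t x y z. p \<in> P \<Longrightarrow> x \<in> \<real> \<Longrightarrow> y \<in> \<real> \<Longrightarrow> z \<in> \<real> \<Longrightarrow>
      norm x < r \<Longrightarrow> norm y < r \<Longrightarrow> norm z < r \<Longrightarrow> g p t x y z \<in> \<real>"
    and real_v: "\<And>z. z \<in> \<real> \<Longrightarrow> norm z < r \<Longrightarrow> v z \<in> \<real>"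
    and v0: "v 0 = 0" and v1: "(v has_field_derivative w1) (at 0)" "w1 \<noteq> 0" "w1 \<in> \<real>"
    and g0: "\<And>p. p \<in> P \<Longrightarrow> mean T (\<lambda>t. g p t 0 0 0) = 0"
    and g1: "\<And>p. p \<in> P \<Longrightarrow> mean T (\<lambda>t. deriv (\<lambda>z. g p t 0 0 z) 0) \<noteq> 0"
begin

definition \<mu> :: "real \<Rightarrow> complex" where
  "\<mu> p = mean T (\<lambda>t. deriv (\<lambda>z. g p t 0 0 z) 0)"

lemma B_nonneg: "p \<in> P \<Longrightarrow> B \<ge> 0"
  using complex_family_bound[OF fam_f r, of p 0 0 0 0] r norm_ge_zero[of "f p 0 0 0 0"]
  by (metis norm_zero order_trans)

lemma deriv_g_continuous: "continuous_on (P \<times> UNIV) (\<lambda>(p, t). deriv (\<lambda>z. g p t 0 0 z) 0)"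
proof (rule continuous_on_locally)
  fix w assume w: "w \<in> P \<times> (UNIV :: real set)"
  obtain p0 t0 where [simp]: "w = (p0, t0)" by (cases w)
  have "continuous_on (ball 0 r \<times> (P \<times> {t0 - 1..t0 + 1})) (\<lambda>u. (\<lambda>(p, t, x, y, z). g p t x y z)
      (fst (snd u), snd (snd u), 0, 0, fst u))"
    by (rule continuous_on_compose2[OF complex_family_continuous[OF fam_g r]])
      (use r in \<open>auto intro!: continuous_intros\<close>)
  then have cont: "continuous_on (ball 0 r \<times> (P \<times> {t0 - 1..t0 + 1})) (\<lambda>(z, s). g (fst s) (snd s) 0 0 z)"
    by (simp add: case_prod_beta')
  have "continuous_on (ball 0 r \<times> (P \<times> {t0 - 1..t0 + 1})) (\<lambda>(z, s). deriv (\<lambda>z. g (fst s) (snd s) 0 0 z) z)"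
  proof (rule continuous_on_deriv_param[OF open_ball _ cont])
    show "compact (P \<times> {t0 - 1..t0 + 1})" using P by (intro compact_Times) auto
    fix s assume "s \<in> P \<times> {t0 - 1..t0 + 1}"
    then show "(\<lambda>z. g (fst s) (snd s) 0 0 z) holomorphic_on ball 0 r"
      using r by (intro complex_family_holomorphic[OF fam_g r]) (auto intro!: holomorphic_intros)
  qed
  then have "continuous_on ((P \<times> UNIV) \<inter> (UNIV \<times> {t0 - 1<..<t0 + 1}))
      (\<lambda>u. (\<lambda>(z, s). deriv (\<lambda>z. g (fst s) (snd s) 0 0 z) z) (0, u))"
    by (rule continuous_on_compose2) (use r in \<open>auto intro!: continuous_intros\<close>)
  then have "continuous_on ((P \<times> UNIV) \<inter> (UNIV \<times> {t0 - 1<..<t0 + 1})) (\<lambda>(p, t). deriv (\<lambda>z. g p t 0 0 z) 0)"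
    by (simp add: case_prod_beta')
  then show "\<exists>V. open V \<and> w \<in> V \<and> continuous_on ((P \<times> UNIV) \<inter> V) (\<lambda>(p, t). deriv (\<lambda>z. g p t 0 0 z) 0)"
    by (intro exI[of _ "UNIV \<times> {t0 - 1<..<t0 + 1}"]) (auto intro!: open_Times)
qed

lemma continuous_on_\<mu>: "continuous_on P \<mu>"
proof -
  have "continuous_on (P \<times> cbox 0 T) (\<lambda>(p, t). deriv (\<lambda>z. g p t 0 0 z) 0)"
    by (rule continuous_on_subset[OF deriv_g_continuous]) auto
  from integral_continuous_on_param[OF this]
  show ?thesis unfolding \<mu>_def[abs_def] mean_def by (intro continuous_intros) simp
qed

lemma \<mu>_in_Reals: "p \<in> P \<Longrightarrow> \<mu> p \<in> \<real>"
proof -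
  assume p: "p \<in> P"
  have "deriv (\<lambda>z. g p t 0 0 z) 0 \<in> \<real>" for t
  proof -
    have "(\<lambda>z. g p t 0 0 z) holomorphic_on ball 0 r"
      using r p by (intro complex_family_holomorphic[OF fam_g r]) (auto intro!: holomorphic_intros)
    then have 1: "((\<lambda>z. g p t 0 0 z) has_field_derivative deriv (\<lambda>z. g p t 0 0 z) 0) (at (of_real 0))"
      using r by (auto intro!: holomorphic_derivI)
    have "eventually (\<lambda>y. y \<in> {-r<..<r}) (nhds 0)"
      by (rule eventually_nhds_in_open) (use r in auto)
    then have 2: "eventually (\<lambda>y. g p t 0 0 (of_real y) = of_real (Re (g p t 0 0 (of_real y)))) (nhds 0)"
      by eventually_elim (auto intro!: of_real_Re[symmetric] real_g p)
    show ?thesis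
      using has_real_derivative_of_complexification(2)[OF 1 2] by (metis Reals_of_real)
  qed
  moreover have "continuous_on {0..T} (\<lambda>t. (\<lambda>(p, t). deriv (\<lambda>z. g p t 0 0 z) 0) (p, t))"
    by (rule continuous_on_compose2[OF deriv_g_continuous]) (use p in \<open>auto intro!: continuous_intros\<close>)
  ultimately show ?thesis
    unfolding \<mu>_def mean_def by (intro Reals_mult integral_in_Reals) auto
qed

lemma \<mu>_bounded_below:
  obtains m where "m > 0" "\<And>p. p \<in> P \<Longrightarrow> norm (\<mu> p) \<ge> m"
proof (cases "P = {}")
  case False
  then obtain p0 where "p0 \<in> P" "\<And>p. p \<in> P \<Longrightarrow> norm (\<mu> p0) \<le> norm (\<mu> p)"
    using continuous_attains_inf[OF P, of "\<lambda>p. norm (\<mu> p)"] continuous_on_\<mu> continuous_on_norm by blast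
  then show ?thesis using that[of "norm (\<mu> p0)"] g1 by (auto simp: \<mu>_def)
qed (use that[of 1] in auto)

end

lemma param_family_cong:
  assumes eq: "\<And>\<epsilon> p t. norm \<epsilon> < e \<Longrightarrow> p \<in> P \<Longrightarrow> h \<epsilon> p t = k \<epsilon> p t" and h: "param_family e P T h"
  shows "param_family e P T k"
  unfolding param_family_def
proof (intro conjI ballI allI impI)
  show "continuous_on (ball 0 e \<times> P \<times> UNIV) (\<lambda>(\<epsilon>, p, t). k \<epsilon> p t)"
    by (rule iffD1[OF continuous_on_cong[OF refl] param_familyD(1)[OF h]]) (use eq in auto)
  show "(\<lambda>\<epsilon>. k \<epsilon> p t) holomorphic_on ball 0 e" if "p \<in> P" for p t
    by (rule holomorphic_transform[OF param_familyD(2)[OF h that, of t]]) (use eq that in auto)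
qed (use eq h in \<open>auto simp: param_family_def\<close>)

lemma param_family_uniform_limit:
  assumes U: "\<And>n::nat. param_family e P T (U n)"
    and lim: "uniform_limit (ball 0 e \<times> P \<times> UNIV) (\<lambda>n (\<epsilon>, p, t). U n \<epsilon> p t) (\<lambda>(\<epsilon>, p, t). u \<epsilon> p t) sequentially"
  shows "param_family e P T u"
  unfolding param_family_def
proof (intro conjI ballI allI impI)
  have tend: "(\<lambda>n. U n \<epsilon> p t) \<longlonglongrightarrow> u \<epsilon> p t" if "norm \<epsilon> < e" "p \<in> P" for \<epsilon> p t
    using tendsto_uniform_limitI[OF lim, of "(\<epsilon>, p, t)"] that by simp
  show "continuous_on (ball 0 e \<times> P \<times> UNIV) (\<lambda>(\<epsilon>, p, t). u \<epsilon> p t)"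
    by (rule uniform_limit_theorem[OF _ lim]) (auto intro!: always_eventually param_familyD(1)[OF U])
  {
    fix p t assume p: "p \<in> P"
    show "(\<lambda>\<epsilon>. u \<epsilon> p t) holomorphic_on ball 0 e"
    proof (rule holomorphic_uniform_sequence[OF open_ball])
      show "(\<lambda>\<epsilon>. U n \<epsilon> p t) holomorphic_on ball 0 e" for n by (rule param_familyD(2)[OF U p])
      fix x :: complex assume "x \<in> ball 0 e"
      then obtain d where d: "d > 0" "cball x d \<subseteq> ball 0 e"
        using open_contains_cball open_ball by metis
      have "uniform_limit (cball x d) (\<lambda>n \<epsilon>. U n \<epsilon> p t) (\<lambda>\<epsilon>. u \<epsilon> p t) sequentially"
        unfolding uniform_limit_iff
      proof (intro allI impI)
        fix \<eta> :: real assume "\<eta> > 0"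
        then have "\<forall>\<^sub>F n in sequentially. \<forall>w\<in>ball 0 e \<times> P \<times> UNIV.
            dist (case w of (\<epsilon>, p, t) \<Rightarrow> U n \<epsilon> p t) (case w of (\<epsilon>, p, t) \<Rightarrow> u \<epsilon> p t) < \<eta>"
          using lim unfolding uniform_limit_iff by blast
        then show "\<forall>\<^sub>F n in sequentially. \<forall>x\<in>cball x d. dist (U n x p t) (u x p t) < \<eta>"
          by eventually_elim (use d p in fastforce)
      qed
      with d show "\<exists>d>0. cball x d \<subseteq> ball 0 e \<and>
          uniform_limit (cball x d) (\<lambda>n \<epsilon>. U n \<epsilon> p t) (\<lambda>\<epsilon>. u \<epsilon> p t) sequentially" by blast
    qed
  }
  fix \<epsilon> p t assume "\<epsilon> \<in> ball (0::complex) e" and p: "p \<in> P"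
  then have \<epsilon>: "norm \<epsilon> < e" by simp
  have "(\<lambda>n. U n \<epsilon> p (t + T)) = (\<lambda>n. U n \<epsilon> p t)"
    using param_familyD(3)[OF U \<epsilon> p] by auto
  then show "u \<epsilon> p (t + T) = u \<epsilon> p t"
    using tend[OF \<epsilon> p, of "t + T"] tend[OF \<epsilon> p, of t] LIMSEQ_unique by metis
  assume "\<epsilon> \<in> \<real>"
  then have "\<forall>\<^sub>F n in sequentially. U n \<epsilon> p t \<in> \<real>"
    using param_familyD(4)[OF U \<epsilon> p] by simp
  then show "u \<epsilon> p t \<in> \<real>"
    by (rule Lim_in_closed_set[OF closed_complex_Reals _ _ tend[OF \<epsilon> p]]) simp
qed

text \<open>
The inequalities \<open>c0\<close>, \<open>c1\<close>, \<open>c2\<close> make the three components of the fixed point map contract, and \<open>i0\<close>,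
\<open>i1\<close> keep the image of zero within half of the admissible radius \<open>\<rho>\<close>.
\<close>

locale contraction_setup = melnikov_setup +
  fixes m L \<rho> e K1 K2 :: real
  assumes m: "m > 0" "\<And>p. p \<in> P \<Longrightarrow> norm (\<mu> p) \<ge> m"
    and K1: "K1 = 4 * B / r" and K2: "K2 = 32 * B / r\<^sup>2" and B: "B \<ge> 0"
    and L: "L \<ge> 1" and \<rho>: "\<rho> > 0" and e: "e > 0" and L\<rho>: "L * \<rho> < r / 4"
    and c0: "T * (K1 / L + 3 * e * K1 * L) \<le> 1 / 2"
    and c1: "2 * K2 * \<rho> / norm w1 + 3 * e * K1 * L\<^sup>2 / norm w1 + 3 * e * T * K1 * L\<^sup>2 \<le> 1 / 2"
    and c2: "(2 * K1 + 4 * K2 * L\<^sup>2 * \<rho>) / (L * m) \<le> 1 / 2"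
    and i0: "T * e * B \<le> \<rho> / 2" and i1: "L * (e * B / norm w1 + e * T * B) \<le> \<rho> / 2"
begin

text \<open>
The three unknowns are the components \<open>0\<close>, \<open>1\<close>, \<open>2\<close> of a single function \<open>u\<close>. They are weighted by \<open>1\<close>,
\<open>1 / L\<close> and \<open>L\<close>, since the linear part of the problem is triangular: \<open>a\<close> depends on \<open>b\<close>, and \<open>c\<close>
depends on both, so that for large \<open>L\<close> these dependences contract.
\<close>

definition A :: "(nat \<times> complex \<times> real \<times> real \<Rightarrow> complex) \<Rightarrow> complex \<Rightarrow> real \<Rightarrow> real \<Rightarrow> complex" where
  "A u \<epsilon> p t = u (0, \<epsilon>, p, t)"

definition Y :: "(nat \<times> complex \<times> real \<times> real \<Rightarrow> complex) \<Rightarrow> complex \<Rightarrow> real \<Rightarrow> real \<Rightarrow> complex" where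
  "Y u \<epsilon> p t = of_real (1 / L) * u (1, \<epsilon>, p, t)"

definition C :: "(nat \<times> complex \<times> real \<times> real \<Rightarrow> complex) \<Rightarrow> complex \<Rightarrow> real \<Rightarrow> real \<Rightarrow> complex" where
  "C u \<epsilon> p t = of_real L * u (2, \<epsilon>, p, t)"

definition FF where "FF u \<epsilon> p t = f p t (A u \<epsilon> p t) (Y u \<epsilon> p t) (C u \<epsilon> p t)"

definition W where "W u \<epsilon> p t = v (Y u \<epsilon> p t) + \<epsilon> * FF u \<epsilon> p t"

definition G where "G u \<epsilon> p t = g p t (A u \<epsilon> p t) (Y u \<epsilon> p t) (C u \<epsilon> p t)"

text \<open>
The second and third component contain Newton corrections for the mean of \<open>b\<close> and for \<open>c\<close>. At a fixed
point the corrections vanish, which means that both right hand sides have zero mean; then the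
primitives solve the differential equations.
\<close>

definition \<Phi> :: "(nat \<times> complex \<times> real \<times> real \<Rightarrow> complex) \<Rightarrow> nat \<times> complex \<times> real \<times> real \<Rightarrow> complex" where
  "\<Phi> u = (\<lambda>(i, \<epsilon>, p, t).
     if i = 0 then periodic_primitive T (W u \<epsilon> p) t
     else if i = 1 then of_real L * (mean T (Y u \<epsilon> p) - mean T (W u \<epsilon> p) / w1 + \<epsilon> * periodic_primitive T (G u \<epsilon> p) t)
     else of_real (1 / L) * (C u \<epsilon> p t - mean T (G u \<epsilon> p) / \<mu> p))"

definition S :: "(nat \<times> complex \<times> real \<times> real) set" where
  "S = {..<3} \<times> ball 0 e \<times> P \<times> UNIV"

definition adm :: "(nat \<times> complex \<times> real \<times> real \<Rightarrow> complex) \<Rightarrow> bool" where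
  "adm u \<longleftrightarrow> (\<forall>i<3. param_family e P T (\<lambda>\<epsilon> p t. u (i, \<epsilon>, p, t))) \<and>
     (\<forall>x\<in>S. norm (u x) \<le> \<rho>) \<and>
     (\<forall>i<3. \<forall>p\<in>P. \<forall>t. u (i, 0, p, t) = 0) \<and>
     (\<forall>\<epsilon>\<in>ball 0 e. \<forall>p\<in>P. \<forall>t. u (2, \<epsilon>, p, t) = u (2, \<epsilon>, p, 0))"

lemma w1_pos: "norm w1 > 0" using v1 by simp

lemma L_pos: "L > 0" using L by simp

lemma \<rho>_le: "\<rho> < r / 4" "\<rho> / L \<le> \<rho>" "\<rho> / L < r / 4" "\<rho> \<le> L * \<rho>"
proof -
  show 1: "\<rho> / L \<le> \<rho>" "\<rho> \<le> L * \<rho>" using L \<rho> by (simp_all add: field_simps)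
  show "\<rho> < r / 4" "\<rho> / L < r / 4" using 1 L\<rho> by linarith+
qed

lemma adm_bounds:
  assumes "adm u" "norm \<epsilon> < e" "p \<in> P"
  shows "norm (A u \<epsilon> p t) \<le> \<rho>" "norm (Y u \<epsilon> p t) \<le> \<rho> / L" "norm (C u \<epsilon> p t) \<le> L * \<rho>"
proof -
  have *: "norm (u (i, \<epsilon>, p, t)) \<le> \<rho>" if "i < 3" for i
    using assms that by (auto simp: adm_def S_def)
  show "norm (A u \<epsilon> p t) \<le> \<rho>" using *[of 0] by (simp add: A_def)
  show "norm (Y u \<epsilon> p t) \<le> \<rho> / L"
    using *[of 1] L_pos by (simp add: Y_def norm_divide divide_right_mono)
  show "norm (C u \<epsilon> p t) \<le> L * \<rho>"
    using *[of 2] L_pos by (simp add: C_def norm_mult)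
qed

lemma adm_bounds':
  assumes "adm u" "norm \<epsilon> < e" "p \<in> P"
  shows "norm (A u \<epsilon> p t) < r / 4" "norm (Y u \<epsilon> p t) < r / 4" "norm (C u \<epsilon> p t) < r / 4"
    "norm (A u \<epsilon> p t) < r / 2" "norm (Y u \<epsilon> p t) < r / 2" "norm (C u \<epsilon> p t) < r / 2"
    "norm (A u \<epsilon> p t) < r" "norm (Y u \<epsilon> p t) < r" "norm (C u \<epsilon> p t) < r"
  using adm_bounds[OF assms, of t] \<rho>_le L\<rho> r by linarith+

lemma adm_families:
  assumes u: "adm u"
  shows "param_family e P T (A u)" "param_family e P T (Y u)" "param_family e P T (C u)"
    "param_family e P T (FF u)" "param_family e P T (W u)" "param_family e P T (G u)"
proof -
  have fam: "param_family e P T (\<lambda>\<epsilon> p t. u (i, \<epsilon>, p, t))" if "i < 3" for i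
    using u that by (simp add: adm_def)
  show A: "param_family e P T (A u)" unfolding A_def[abs_def] by (rule fam) simp
  show Y: "param_family e P T (Y u)" unfolding Y_def[abs_def]
    by (rule param_family_mult[OF param_family_const fam]) auto
  show C: "param_family e P T (C u)" unfolding C_def[abs_def]
    by (rule param_family_mult[OF param_family_const fam]) auto
  show F: "param_family e P T (FF u)" unfolding FF_def[abs_def]
    by (rule param_family_compose[OF fam_f r real_f A Y C]) (use adm_bounds'[OF u] in auto)
  show "param_family e P T (G u)" unfolding G_def[abs_def]
    by (rule param_family_compose[OF fam_g r real_g A Y C]) (use adm_bounds'[OF u] in auto)
  have "param_family e P T (\<lambda>\<epsilon> p t. v (Y u \<epsilon> p t))"
    by (rule param_family_compose[OF fam_v r _ A A Y]) (use adm_bounds'[OF u] real_v in auto)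
  then show "param_family e P T (W u)" unfolding W_def[abs_def]
    by (intro param_family_add param_family_mult param_family_eps F)
qed

lemma \<Phi>_families:
  assumes u: "adm u" and i: "i < 3"
  shows "param_family e P T (\<lambda>\<epsilon> p t. \<Phi> u (i, \<epsilon>, p, t))"
proof -
  note fams = adm_families[OF u]
  have w1: "param_family e P T (\<lambda>\<epsilon> p t. inverse w1)"
    by (rule param_family_const) (use v1 in auto)
  have \<mu>: "param_family e P T (\<lambda>\<epsilon> p t. inverse (\<mu> p))"
    by (rule param_family_const) (use continuous_on_\<mu> \<mu>_in_Reals g1 in \<open>auto intro!: continuous_intros simp: \<mu>_def\<close>)
  have Lc: "param_family e P T (\<lambda>\<epsilon> p t. of_real c)" for c
    by (rule param_family_const) auto
  consider "i = 0" | "i = 1" | "i = 2" using i by linarith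
  then show ?thesis
  proof cases
    case 1
    then show ?thesis using param_family_periodic_primitive[OF fams(5) T] by (simp add: \<Phi>_def)
  next
    case 2
    have "param_family e P T (\<lambda>\<epsilon> p t. of_real L * (mean T (Y u \<epsilon> p) - mean T (W u \<epsilon> p) * inverse w1
        + \<epsilon> * periodic_primitive T (G u \<epsilon> p) t))"
      by (intro param_family_mult param_family_add param_family_diff Lc w1 param_family_eps
          param_family_mean param_family_periodic_primitive T fams)
    then show ?thesis using 2 by (simp add: \<Phi>_def divide_inverse)
  next
    case 3
    have "param_family e P T (\<lambda>\<epsilon> p t. of_real (1 / L) * (C u \<epsilon> p t - mean T (G u \<epsilon> p) * inverse (\<mu> p)))"
      by (intro param_family_mult param_family_diff Lc \<mu> param_family_mean fams)
    then show ?thesis using 3 by (simp add: \<Phi>_def divide_inverse)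
  qed
qed

text \<open>
In the first component \<open>v\<close> contributes the small factor \<open>K1 / L\<close>. In the second one the linear part of
\<open>v\<close> cancels against the mean of \<open>b\<close>, and in the third one the part of \<open>g\<close> that is linear in \<open>c\<close> cancels
against \<open>c\<close>; the remainders are quadratic, or are divided by \<open>L\<close>, or carry a factor \<open>\<epsilon>\<close>.
\<close>

lemma contraction:
  assumes u: "adm u" and w: "adm w" and d: "\<And>x. x \<in> S \<Longrightarrow> norm (u x - w x) \<le> d" and x: "x \<in> S"
  shows "norm (\<Phi> u x - \<Phi> w x) \<le> d / 2"
proof -
  obtain i \<epsilon> p t where [simp]: "x = (i, \<epsilon>, p, t)" by (cases x)
  have i: "i < 3" and \<epsilon>: "norm \<epsilon> < e" and p: "p \<in> P" using x by (auto simp: S_def)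
  have d0: "d \<ge> 0" using d[OF x] norm_ge_zero order_trans by blast
  have K: "K1 \<ge> 0" "K2 \<ge> 0" using B r by (auto simp: K1 K2)
  have D: "norm (u (j, \<epsilon>, p, s) - w (j, \<epsilon>, p, s)) \<le> d" if "j < 3" for j s
    using that \<epsilon> p by (intro d) (auto simp: S_def)
  have dA: "norm (A u \<epsilon> p s - A w \<epsilon> p s) \<le> d" for s
    using D[of 0] by (simp add: A_def)
  have dY: "norm (Y u \<epsilon> p s - Y w \<epsilon> p s) \<le> d / L" for s
  proof -
    have "Y u \<epsilon> p s - Y w \<epsilon> p s = of_real (1 / L) * (u (1, \<epsilon>, p, s) - w (1, \<epsilon>, p, s))"
      by (simp add: Y_def diff_divide_distrib)
    then have "norm (Y u \<epsilon> p s - Y w \<epsilon> p s) = 1 / L * norm (u (1, \<epsilon>, p, s) - w (1, \<epsilon>, p, s))"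
      using L_pos by (simp only: norm_mult norm_of_real) simp
    then show ?thesis using D[of 1 s] L_pos by (simp add: divide_right_mono)
  qed
  have dC: "norm (C u \<epsilon> p s - C w \<epsilon> p s) \<le> L * d" for s
  proof -
    have "C u \<epsilon> p s - C w \<epsilon> p s = of_real L * (u (2, \<epsilon>, p, s) - w (2, \<epsilon>, p, s))"
      by (simp add: C_def right_diff_distrib)
    then show ?thesis using D[of 2 s] L_pos by (simp add: norm_mult)
  qed
  have dL: "d / L \<le> L * d" "d \<le> L * d" "d / L \<le> d"
  proof -
    show "d \<le> L * d" using mult_right_mono[OF L d0] by simp
    show "d / L \<le> d" using \<open>d \<le> L * d\<close> L_pos by (simp add: field_simps)
    with \<open>d \<le> L * d\<close> show "d / L \<le> L * d" by linarith
  qed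
  note bu = adm_bounds'[OF u \<epsilon> p] and bw = adm_bounds'[OF w \<epsilon> p]
  note Bu = adm_bounds[OF u \<epsilon> p] and Bw = adm_bounds[OF w \<epsilon> p]
  have sum3: "norm (A u \<epsilon> p s - A w \<epsilon> p s) + norm (Y u \<epsilon> p s - Y w \<epsilon> p s) + norm (C u \<epsilon> p s - C w \<epsilon> p s)
      \<le> 3 * L * d" for s
    using dA[of s] dY[of s] dC[of s] dL by linarith
  have df: "norm (FF u \<epsilon> p s - FF w \<epsilon> p s) \<le> K1 * (3 * L * d)" for s
    unfolding FF_def K1
    by (rule order_trans[OF complex_family_lipschitz[OF fam_f r p bu(4-6) bw(4-6)]])
      (use K sum3 in \<open>auto simp: K1[symmetric] intro: mult_left_mono\<close>)
  have dg: "norm (G u \<epsilon> p s - G w \<epsilon> p s) \<le> K1 * (3 * L * d)" for s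
    unfolding G_def K1
    by (rule order_trans[OF complex_family_lipschitz[OF fam_g r p bu(4-6) bw(4-6)]])
      (use K sum3 in \<open>auto simp: K1[symmetric] intro: mult_left_mono\<close>)
  have df': "norm (\<epsilon> * FF u \<epsilon> p s - \<epsilon> * FF w \<epsilon> p s) \<le> e * (K1 * (3 * L * d))" for s
  proof -
    have "norm (\<epsilon> * FF u \<epsilon> p s - \<epsilon> * FF w \<epsilon> p s) = norm \<epsilon> * norm (FF u \<epsilon> p s - FF w \<epsilon> p s)"
      by (simp add: norm_mult flip: right_diff_distrib)
    also have "\<dots> \<le> e * (K1 * (3 * L * d))" using \<epsilon> df[of s] e by (intro mult_mono) auto
    finally show ?thesis .
  qed
  have dv: "norm (v (Y u \<epsilon> p s) - v (Y w \<epsilon> p s)) \<le> K1 * (d / L)" for s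
  proof -
    have "norm (v (Y u \<epsilon> p s) - v (Y w \<epsilon> p s)) \<le> 4 * B / r * (norm (0 - 0 :: complex) + norm (0 - 0 :: complex) + norm (Y u \<epsilon> p s - Y w \<epsilon> p s))"
      by (rule complex_family_lipschitz[OF fam_v r p]) (use r bu(5) bw(5) in auto)
    also have "\<dots> = K1 * norm (Y u \<epsilon> p s - Y w \<epsilon> p s)" by (simp add: K1)
    also have "\<dots> \<le> K1 * (d / L)" using dY[of s] K(1) by (rule mult_left_mono)
    finally show ?thesis .
  qed
  have cont: "continuous_on UNIV (h \<epsilon> p)" if "param_family e P T h" for h
    by (rule param_family_continuous_time[OF that \<epsilon> p])
  note cu = adm_families[OF u, THEN cont] and cw = adm_families[OF w, THEN cont]
  have contd: "continuous_on UNIV (\<lambda>s. G u \<epsilon> p s - G w \<epsilon> p s)" "continuous_on UNIV (\<lambda>s. W u \<epsilon> p s - W w \<epsilon> p s)"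
    by (intro continuous_intros cu cw)+
  consider "i = 0" | "i = 1" | "i = 2" using i by linarith
  then show ?thesis
  proof cases
    case 1
    have dW: "norm (W u \<epsilon> p s - W w \<epsilon> p s) \<le> (K1 / L + 3 * e * K1 * L) * d" for s
    proof -
      have "norm (W u \<epsilon> p s - W w \<epsilon> p s) \<le> norm (v (Y u \<epsilon> p s) - v (Y w \<epsilon> p s)) + norm (\<epsilon> * FF u \<epsilon> p s - \<epsilon> * FF w \<epsilon> p s)"
        unfolding W_def by (rule order_trans[OF _ norm_triangle_ineq]) (simp add: algebra_simps)
      also have "\<dots> \<le> K1 * (d / L) + e * (K1 * (3 * L * d))" using dv df' by (rule add_mono)
      also have "\<dots> = (K1 / L + 3 * e * K1 * L) * d" by (simp add: algebra_simps)
      finally show ?thesis .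
    qed
    have "norm (periodic_primitive T (\<lambda>s. W u \<epsilon> p s - W w \<epsilon> p s) t) \<le> T * ((K1 / L + 3 * e * K1 * L) * d)"
      by (rule norm_periodic_primitive_le[OF T contd(2) dW])
    also have "\<dots> \<le> 1 / 2 * d" using mult_right_mono[OF c0 d0] by (simp add: mult_ac)
    finally show ?thesis
      using 1 by (simp add: \<Phi>_def periodic_primitive_diff[OF cu(5) cw(5) T])
  next
    case 2
    \<comment> \<open>\<open>X\<close> is the difference of the right hand sides without its linear part \<open>w1\<close> times the difference
      of the second components; the Newton step replaces \<open>mean b\<close> by \<open>- mean X / w1\<close>.\<close>
    define X where "X = (\<lambda>s. W u \<epsilon> p s - W w \<epsilon> p s - w1 * (Y u \<epsilon> p s - Y w \<epsilon> p s))"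
    have contX: "continuous_on UNIV X" unfolding X_def by (intro continuous_intros cu cw)
    have mX: "mean T X = (mean T (W u \<epsilon> p) - mean T (W w \<epsilon> p)) - w1 * (mean T (Y u \<epsilon> p) - mean T (Y w \<epsilon> p))"
      unfolding X_def
      by (simp add: mean_diff cu cw continuous_on_mult continuous_on_diff continuous_on_const mean_mult)
    have meanX: "mean T (Y u \<epsilon> p) - mean T (W u \<epsilon> p) / w1 - (mean T (Y w \<epsilon> p) - mean T (W w \<epsilon> p) / w1) = - mean T X / w1"
      unfolding mX using v1(2) by (simp add: field_simps)
    have "norm (X s) \<le> K2 * (2 * \<rho>) * (d / L) + e * (K1 * (3 * L * d))" for s
    proof -
      have D: "deriv v 0 = w1" using v1(1) by (rule DERIV_imp_deriv)
      have "norm (v (Y u \<epsilon> p s) - v (Y w \<epsilon> p s) - (Y u \<epsilon> p s - Y w \<epsilon> p s) * deriv (\<lambda>z. v z) 0)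
         \<le> 4 * B / r * (norm (0 - 0 :: complex) + norm (0 - 0 :: complex)) + 32 * B / r\<^sup>2 * (norm (0 :: complex) + norm (0 :: complex) + norm (Y u \<epsilon> p s) + norm (Y w \<epsilon> p s))
           * norm (Y u \<epsilon> p s - Y w \<epsilon> p s)"
        by (rule complex_family_lipschitz_linear[OF fam_v r p]) (use r bu(2) bw(2) in auto)
      also have "\<dots> = K2 * (norm (Y u \<epsilon> p s) + norm (Y w \<epsilon> p s)) * norm (Y u \<epsilon> p s - Y w \<epsilon> p s)"
        by (simp add: K2)
      also have "\<dots> \<le> K2 * (2 * \<rho>) * (d / L)"
        using Bu(2)[of s] Bw(2)[of s] \<rho>_le(2) dY[of s] K \<rho> by (intro mult_mono) auto
      finally have 1: "norm (v (Y u \<epsilon> p s) - v (Y w \<epsilon> p s) - (Y u \<epsilon> p s - Y w \<epsilon> p s) * w1) \<le> K2 * (2 * \<rho>) * (d / L)"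
        unfolding D .
      have "X s = (v (Y u \<epsilon> p s) - v (Y w \<epsilon> p s) - (Y u \<epsilon> p s - Y w \<epsilon> p s) * w1) + (\<epsilon> * FF u \<epsilon> p s - \<epsilon> * FF w \<epsilon> p s)"
        by (simp add: X_def W_def algebra_simps)
      then show ?thesis using norm_triangle_mono[OF 1 df'[of s]] by simp
    qed
    then have nX: "norm (mean T X) \<le> K2 * (2 * \<rho>) * (d / L) + e * (K1 * (3 * L * d))"
      by (rule norm_mean_le[OF T contX])
    have nQ: "norm (periodic_primitive T (\<lambda>s. G u \<epsilon> p s - G w \<epsilon> p s) t) \<le> T * (K1 * (3 * L * d))"
      by (rule norm_periodic_primitive_le[OF T contd(1) dg])
    have eq: "\<Phi> u x - \<Phi> w x = of_real L * (- mean T X / w1 + \<epsilon> * periodic_primitive T (\<lambda>s. G u \<epsilon> p s - G w \<epsilon> p s) t)"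
      unfolding meanX[symmetric] periodic_primitive_diff[OF cu(6) cw(6) T] using 2
      by (simp add: \<Phi>_def algebra_simps)
    have "norm (\<Phi> u x - \<Phi> w x) \<le> L * (norm (mean T X) / norm w1 + norm \<epsilon> * norm (periodic_primitive T (\<lambda>s. G u \<epsilon> p s - G w \<epsilon> p s) t))"
      unfolding eq using L_pos
      using norm_triangle_ineq[of "- mean T X / w1" "\<epsilon> * periodic_primitive T (\<lambda>s. G u \<epsilon> p s - G w \<epsilon> p s) t"]
      by (simp only: norm_mult norm_of_real norm_divide norm_minus_cancel) simp
    also have "\<dots> \<le> L * ((K2 * (2 * \<rho>) * (d / L) + e * (K1 * (3 * L * d))) / norm w1 + e * (T * (K1 * (3 * L * d))))"
      using nX nQ \<epsilon> L_pos w1_pos e by (intro mult_left_mono add_mono divide_right_mono mult_mono) auto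
    also have "\<dots> = (2 * K2 * \<rho> / norm w1 + 3 * e * K1 * L\<^sup>2 / norm w1 + 3 * e * T * K1 * L\<^sup>2) * d"
      using L_pos w1_pos by (simp add: field_simps power2_eq_square)
    also have "\<dots> \<le> 1 / 2 * d" using c1 d0 by (rule mult_right_mono)
    finally show ?thesis by simp
  next
    case 3
    define \<delta> where "\<delta> = C u \<epsilon> p t - C w \<epsilon> p t"
    have \<delta>: "C u \<epsilon> p s - C w \<epsilon> p s = \<delta>" for s
    proof -
      have "u (2, \<epsilon>, p, s) = u (2, \<epsilon>, p, t)" "w (2, \<epsilon>, p, s) = w (2, \<epsilon>, p, t)"
        using u w \<epsilon> p unfolding adm_def by (metis dist_0_norm mem_ball)+
      then show ?thesis by (simp add: \<delta>_def C_def)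
    qed
    define D where "D = (\<lambda>s. deriv (\<lambda>z. g p s 0 0 z) 0)"
    have "continuous_on UNIV (\<lambda>s. (\<lambda>(p, t). deriv (\<lambda>z. g p t 0 0 z) 0) (p, s))"
      by (rule continuous_on_compose2[OF deriv_g_continuous]) (use p in \<open>auto intro!: continuous_intros\<close>)
    then have contD: "continuous_on UNIV D" by (simp add: D_def)
    \<comment> \<open>As the third component does not depend on time, the linear part contributes \<open>\<delta> * \<mu> p\<close> to the mean.\<close>
    define X where "X = (\<lambda>s. G u \<epsilon> p s - G w \<epsilon> p s - \<delta> * D s)"
    have contX: "continuous_on UNIV X" unfolding X_def by (intro continuous_intros cu cw contD)
    have mX: "mean T X = mean T (G u \<epsilon> p) - mean T (G w \<epsilon> p) - \<delta> * \<mu> p"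
      unfolding X_def
      by (simp add: mean_diff cu cw contD continuous_on_mult continuous_on_diff continuous_on_const mean_mult \<mu>_def D_def[symmetric])
    have "\<mu> p \<noteq> 0" using g1[OF p] by (simp add: \<mu>_def)
    then have meanX: "\<delta> - (mean T (G u \<epsilon> p) - mean T (G w \<epsilon> p)) / \<mu> p = - mean T X / \<mu> p"
      unfolding mX by (simp add: field_simps)
    have "norm (X s) \<le> (2 * K1 + 4 * K2 * L\<^sup>2 * \<rho>) * d" for s
    proof -
      have "norm (X s) \<le> K1 * (norm (A u \<epsilon> p s - A w \<epsilon> p s) + norm (Y u \<epsilon> p s - Y w \<epsilon> p s))
         + K2 * (norm (A w \<epsilon> p s) + norm (Y w \<epsilon> p s) + norm (C u \<epsilon> p s) + norm (C w \<epsilon> p s)) * norm (C u \<epsilon> p s - C w \<epsilon> p s)"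
        unfolding X_def G_def D_def \<delta>[of s, symmetric] K1 K2
        by (rule complex_family_lipschitz_linear[OF fam_g r p bu(1-3) bw(1-3)])
      also have "\<dots> \<le> K1 * (2 * d) + K2 * (4 * (L * \<rho>)) * (L * d)"
      proof (intro add_mono mult_mono mult_left_mono)
        show "norm (A u \<epsilon> p s - A w \<epsilon> p s) + norm (Y u \<epsilon> p s - Y w \<epsilon> p s) \<le> 2 * d"
          using dA[of s] dY[of s] dL by linarith
        show "norm (A w \<epsilon> p s) + norm (Y w \<epsilon> p s) + norm (C u \<epsilon> p s) + norm (C w \<epsilon> p s) \<le> 4 * (L * \<rho>)"
          using Bw[of s] Bu[of s] \<rho>_le by linarith
        show "norm (C u \<epsilon> p s - C w \<epsilon> p s) \<le> L * d" by (rule dC)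
      qed (use K L_pos \<rho> in auto)
      also have "\<dots> = (2 * K1 + 4 * K2 * L\<^sup>2 * \<rho>) * d"
        by (simp add: algebra_simps power2_eq_square)
      finally show ?thesis .
    qed
    then have nX: "norm (mean T X) \<le> (2 * K1 + 4 * K2 * L\<^sup>2 * \<rho>) * d"
      by (rule norm_mean_le[OF T contX])
    have "\<Phi> u x - \<Phi> w x = of_real (1 / L) * (- mean T X / \<mu> p)"
      unfolding meanX[symmetric] \<delta>_def using 3 by (simp add: \<Phi>_def algebra_simps diff_divide_distrib)
    then have "norm (\<Phi> u x - \<Phi> w x) = norm (mean T X) / (L * norm (\<mu> p))"
      using L_pos by (simp add: norm_mult norm_divide)
    also have "\<dots> \<le> (2 * K1 + 4 * K2 * L\<^sup>2 * \<rho>) * d / (L * m)"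
      using nX m(1) m(2)[OF p] L_pos K \<rho> d0 by (intro frac_le mult_left_mono) auto
    also have "\<dots> = (2 * K1 + 4 * K2 * L\<^sup>2 * \<rho>) / (L * m) * d" by simp
    also have "\<dots> \<le> 1 / 2 * d" using c2 d0 by (rule mult_right_mono)
    finally show ?thesis by simp
  qed
qed

lemma adm_const_time:
  assumes "adm u" "norm \<epsilon> < e" "p \<in> P"
  shows "u (2, \<epsilon>, p, t) = u (2, \<epsilon>, p, 0)"
proof -
  from assms(1) have "\<forall>\<epsilon>\<in>ball 0 e. \<forall>p\<in>P. \<forall>t. u (2, \<epsilon>, p, t) = u (2, \<epsilon>, p, 0)"
    unfolding adm_def by (elim conjE)
  moreover have "\<epsilon> \<in> ball 0 e" using assms(2) by simp
  ultimately show ?thesis using assms(3) by blast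
qed

lemma adm_zero: "adm (\<lambda>_. 0)"
  using param_family_const[of P "\<lambda>_. 0"] \<rho> by (simp add: adm_def)

lemma \<Phi>_zero_bound:
  assumes x: "x \<in> S"
  shows "norm (\<Phi> (\<lambda>_. 0) x) \<le> \<rho> / 2"
proof -
  obtain i \<epsilon> p t where [simp]: "x = (i, \<epsilon>, p, t)" by (cases x)
  have i: "i < 3" and \<epsilon>: "norm \<epsilon> < e" and p: "p \<in> P" using x by (auto simp: S_def)
  have Y0: "Y (\<lambda>_. 0) \<epsilon> p = (\<lambda>_. 0)" and C0: "C (\<lambda>_. 0) \<epsilon> p t = 0"
    and G0: "G (\<lambda>_. 0) \<epsilon> p = (\<lambda>s. g p s 0 0 0)"
    by (auto simp: Y_def C_def G_def A_def)
  note fams = adm_families[OF adm_zero]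
  have contW: "continuous_on UNIV (W (\<lambda>_. 0) \<epsilon> p)" and contG: "continuous_on UNIV (G (\<lambda>_. 0) \<epsilon> p)"
    by (rule param_family_continuous_time[OF _ \<epsilon> p], rule fams)+
  have W: "norm (W (\<lambda>_. 0) \<epsilon> p s) \<le> e * B" for s
  proof -
    have "norm \<epsilon> * norm (f p s 0 0 0) \<le> e * B"
      using \<epsilon> r e complex_family_bound[OF fam_f r p, of 0 0 0 s] by (intro mult_mono) auto
    then show ?thesis by (simp add: W_def Y0 v0 FF_def A_def C_def Y_def norm_mult)
  qed
  have G: "norm (G (\<lambda>_. 0) \<epsilon> p s) \<le> B" for s
    using complex_family_bound[OF fam_g r p, of 0 0 0 s] r by (simp add: G0)
  consider "i = 0" | "i = 1" | "i = 2" using i by linarith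
  then show ?thesis
  proof cases
    case 1
    have "norm (periodic_primitive T (W (\<lambda>_. 0) \<epsilon> p) t) \<le> T * (e * B)"
      by (rule norm_periodic_primitive_le[OF T contW W])
    then show ?thesis using 1 i0 by (simp add: \<Phi>_def mult.assoc)
  next
    case 2
    have "norm (periodic_primitive T (G (\<lambda>_. 0) \<epsilon> p) t) \<le> T * B"
      by (rule norm_periodic_primitive_le[OF T contG G])
    then have 3: "norm (\<epsilon> * periodic_primitive T (G (\<lambda>_. 0) \<epsilon> p) t) \<le> e * (T * B)"
      unfolding norm_mult using \<epsilon> e by (intro mult_mono) auto
    have 4: "norm (- mean T (W (\<lambda>_. 0) \<epsilon> p) / w1) \<le> e * B / norm w1"
      using norm_mean_le[OF T contW W] by (simp add: norm_divide divide_right_mono)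
    have "norm (\<Phi> (\<lambda>_. 0) x) = L * norm (- mean T (W (\<lambda>_. 0) \<epsilon> p) / w1 + \<epsilon> * periodic_primitive T (G (\<lambda>_. 0) \<epsilon> p) t)"
      using 2 L_pos by (simp add: \<Phi>_def Y0 mean_const[OF T] norm_mult)
    also have "\<dots> \<le> L * (e * B / norm w1 + e * (T * B))"
      using L_pos by (intro mult_left_mono norm_triangle_mono 3 4) auto
    also have "\<dots> \<le> \<rho> / 2" using i1 by (simp add: mult.assoc)
    finally show ?thesis .
  next
    case 3
    then show ?thesis using \<rho> by (simp add: \<Phi>_def C0 G0 g0[OF p])
  qed
qed

lemma adm_\<Phi>:
  assumes u: "adm u"
  shows "adm (\<Phi> u)"
  unfolding adm_def
proof (intro conjI allI impI ballI)
  fix i :: nat assume "i < 3"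
  then show "param_family e P T (\<lambda>\<epsilon> p t. \<Phi> u (i, \<epsilon>, p, t))" by (rule \<Phi>_families[OF u])
next
  fix x assume x: "x \<in> S"
  have "norm (\<Phi> u x - \<Phi> (\<lambda>_. 0) x) \<le> \<rho> / 2"
    by (rule contraction[OF u adm_zero _ x]) (use u in \<open>auto simp: adm_def\<close>)
  then show "norm (\<Phi> u x) \<le> \<rho>"
    using \<Phi>_zero_bound[OF x] norm_triangle_ineq[of "\<Phi> u x - \<Phi> (\<lambda>_. 0) x" "\<Phi> (\<lambda>_. 0) x"] by simp
next
  fix i p t assume i: "i < (3::nat)" and p: "p \<in> P"
  have u0: "u (j, 0, p, s) = 0" if "j < 3" for j s using u p that by (simp add: adm_def)
  have 0: "A u 0 p s = 0" "Y u 0 p s = 0" "C u 0 p s = 0" for s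
    by (simp_all add: A_def Y_def C_def u0)
  have "Y u 0 p = (\<lambda>_. 0)" "W u 0 p = (\<lambda>_. 0)" "G u 0 p = (\<lambda>s. g p s 0 0 0)"
    by (auto simp: 0 W_def G_def v0)
  then show "\<Phi> u (i, 0, p, t) = 0"
    by (simp add: \<Phi>_def 0 g0[OF p] mean_const[OF T] periodic_primitive_def)
next
  fix \<epsilon> p t assume "\<epsilon> \<in> ball (0::complex) e" "p \<in> P"
  then have "C u \<epsilon> p t = C u \<epsilon> p 0"
    using adm_const_time[OF u, of \<epsilon> p t] by (simp add: C_def)
  then show "\<Phi> u (2, \<epsilon>, p, t) = \<Phi> u (2, \<epsilon>, p, 0)" by (simp add: \<Phi>_def)
qed

lemma adm_uniform_limit:
  assumes U: "\<And>n::nat. adm (U n)" and lim: "uniform_limit S U u sequentially"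
  shows "adm u"
  unfolding adm_def
proof (intro conjI allI impI ballI)
  have tend: "(\<lambda>n. U n x) \<longlonglongrightarrow> u x" if "x \<in> S" for x
    by (rule tendsto_uniform_limitI[OF lim that])
  {
    fix i :: nat assume i: "i < 3"
    have "uniform_limit ((\<lambda>w. (i, w)) ` (ball 0 e \<times> P \<times> UNIV)) U u sequentially"
      by (rule uniform_limit_on_subset[OF lim]) (use i in \<open>auto simp: S_def\<close>)
    then have "uniform_limit (ball 0 e \<times> P \<times> UNIV) (\<lambda>n (\<epsilon>, p, t). U n (i, \<epsilon>, p, t)) (\<lambda>(\<epsilon>, p, t). u (i, \<epsilon>, p, t)) sequentially"
      by (auto simp: uniform_limit_iff elim!: allE eventually_mono)
    then show "param_family e P T (\<lambda>\<epsilon> p t. u (i, \<epsilon>, p, t))"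
      by (rule param_family_uniform_limit[rotated]) (use U i in \<open>auto simp: adm_def\<close>)
    fix p t assume p: "p \<in> P"
    have "(\<lambda>n. U n (i, 0, p, t)) \<longlonglongrightarrow> 0"
      using U i p by (simp add: adm_def)
    moreover have "(\<lambda>n. U n (i, 0, p, t)) \<longlonglongrightarrow> u (i, 0, p, t)"
      by (rule tend) (use i p e in \<open>auto simp: S_def\<close>)
    ultimately show "u (i, 0, p, t) = 0" using LIMSEQ_unique by blast
  }
  fix x assume x: "x \<in> S"
  show "norm (u x) \<le> \<rho>"
    by (rule Lim_norm_ubound[OF _ tend[OF x]]) (use U x in \<open>auto simp: adm_def\<close>)
next
  have tend: "(\<lambda>n. U n x) \<longlonglongrightarrow> u x" if "x \<in> S" for x
    by (rule tendsto_uniform_limitI[OF lim that])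
  fix \<epsilon> p t assume *: "\<epsilon> \<in> ball (0::complex) e" "p \<in> P"
  have "(\<lambda>n. U n (2, \<epsilon>, p, t)) \<longlonglongrightarrow> u (2, \<epsilon>, p, t)" "(\<lambda>n. U n (2, \<epsilon>, p, 0)) \<longlonglongrightarrow> u (2, \<epsilon>, p, 0)"
    by (rule tend, use * in \<open>auto simp: S_def\<close>)+
  moreover have "(\<lambda>n. U n (2, \<epsilon>, p, t)) = (\<lambda>n. U n (2, \<epsilon>, p, 0))"
    using adm_const_time[OF U] * by (metis dist_0_norm mem_ball)
  ultimately show "u (2, \<epsilon>, p, t) = u (2, \<epsilon>, p, 0)" using LIMSEQ_unique by metis
qed

lemma periodic_solution_families:
  obtains a b :: "complex \<Rightarrow> real \<Rightarrow> real \<Rightarrow> complex" and c :: "complex \<Rightarrow> real \<Rightarrow> complex"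
  where "param_family e P T a" "param_family e P T b" "param_family e P T (\<lambda>\<epsilon> p t. c \<epsilon> p)"
    "\<And>\<epsilon> p t. norm \<epsilon> < e \<Longrightarrow> p \<in> P \<Longrightarrow> norm (a \<epsilon> p t) < r / 4"
    "\<And>\<epsilon> p t. norm \<epsilon> < e \<Longrightarrow> p \<in> P \<Longrightarrow> norm (b \<epsilon> p t) < r / 4"
    "\<And>\<epsilon> p. norm \<epsilon> < e \<Longrightarrow> p \<in> P \<Longrightarrow> norm (c \<epsilon> p) < r / 4"
    "\<And>p t. p \<in> P \<Longrightarrow> a 0 p t = 0" "\<And>p t. p \<in> P \<Longrightarrow> b 0 p t = 0" "\<And>p. p \<in> P \<Longrightarrow> c 0 p = 0"
    "\<And>\<epsilon> p t. norm \<epsilon> < e \<Longrightarrow> p \<in> P \<Longrightarrow>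
      (a \<epsilon> p has_vector_derivative v (b \<epsilon> p t) + \<epsilon> * f p t (a \<epsilon> p t) (b \<epsilon> p t) (c \<epsilon> p)) (at t)"
    "\<And>\<epsilon> p t. norm \<epsilon> < e \<Longrightarrow> p \<in> P \<Longrightarrow>
      (b \<epsilon> p has_vector_derivative \<epsilon> * g p t (a \<epsilon> p t) (b \<epsilon> p t) (c \<epsilon> p)) (at t)"
    "\<And>\<epsilon> p. norm \<epsilon> < e \<Longrightarrow> p \<in> P \<Longrightarrow> integral {0..T} (a \<epsilon> p) = 0"
proof -
  have init: "norm (\<Phi> (\<lambda>_. 0) x - 0) \<le> \<rho> / 2" if "x \<in> S" for x
    using \<Phi>_zero_bound[OF that] by simp
  have "\<exists>u. adm u \<and> (\<forall>x\<in>S. \<Phi> u x = u x)"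
  proof (rule function_fixed_point[of adm "\<lambda>_. 0" \<Phi> S "\<rho> / 2"])
    show "adm (\<lambda>_. 0)" by (rule adm_zero)
    show "adm (\<Phi> u)" if "adm u" for u using that by (rule adm_\<Phi>)
    show "norm (\<Phi> u x - \<Phi> w x) \<le> d / 2"
      if "adm u" "adm w" "\<And>x. x \<in> S \<Longrightarrow> norm (u x - w x) \<le> d" "x \<in> S" for u w d x
      using that by (rule contraction)
    show "norm (\<Phi> (\<lambda>_. 0) x - 0) \<le> \<rho> / 2" if "x \<in> S" for x using that by (rule init)
    show "adm u" if "\<And>n. adm (U n)" "uniform_limit S U u sequentially" for U u
      using that by (rule adm_uniform_limit)
  qed blast
  then obtain u where u: "adm u" and fix_u: "\<And>x. x \<in> S \<Longrightarrow> \<Phi> u x = u x" by blast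
  note fams = adm_families[OF u] and bounds = adm_bounds'[OF u]
  have Ceq: "C u \<epsilon> p t = C u \<epsilon> p 0" if "norm \<epsilon> < e" "p \<in> P" for \<epsilon> p t
    using adm_const_time[OF u that] by (simp add: C_def)
  have eqs: "A u \<epsilon> p = periodic_primitive T (W u \<epsilon> p)" "mean T (W u \<epsilon> p) = 0" "mean T (G u \<epsilon> p) = 0"
      "Y u \<epsilon> p = (\<lambda>t. mean T (Y u \<epsilon> p) + \<epsilon> * periodic_primitive T (G u \<epsilon> p) t)"
    if \<epsilon>: "norm \<epsilon> < e" and p: "p \<in> P" for \<epsilon> p
  proof -
    have in_S: "(i, \<epsilon>, p, t) \<in> S" if "i < 3" for i t using that \<epsilon> p by (simp add: S_def)
    show "A u \<epsilon> p = periodic_primitive T (W u \<epsilon> p)"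
      using fix_u[OF in_S[of 0]] by (auto simp: \<Phi>_def A_def)
    have "\<mu> p \<noteq> 0" using g1[OF p] by (simp add: \<mu>_def)
    moreover have "of_real (1 / L) * (C u \<epsilon> p 0 - mean T (G u \<epsilon> p) / \<mu> p) = of_real (1 / L) * C u \<epsilon> p 0"
      using fix_u[OF in_S[of 2 0]] L_pos by (simp add: \<Phi>_def C_def)
    ultimately show "mean T (G u \<epsilon> p) = 0" using L_pos by simp
    have cG: "continuous_on UNIV (G u \<epsilon> p)"
      and cQ: "continuous_on UNIV (periodic_primitive T (G u \<epsilon> p))"
      using fams(6) param_family_periodic_primitive[OF fams(6) T] by (auto intro: param_family_continuous_time[OF _ \<epsilon> p])
    have Y1: "Y u \<epsilon> p t = mean T (Y u \<epsilon> p) - mean T (W u \<epsilon> p) / w1 + \<epsilon> * periodic_primitive T (G u \<epsilon> p) t" for t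
    proof -
      have "of_real L * (mean T (Y u \<epsilon> p) - mean T (W u \<epsilon> p) / w1 + \<epsilon> * periodic_primitive T (G u \<epsilon> p) t) = u (1, \<epsilon>, p, t)"
        using fix_u[OF in_S[of 1 t]] by (simp add: \<Phi>_def)
      moreover have "of_real (1 / L) * (of_real L * z) = z" for z :: complex
        using L_pos by simp
      ultimately show ?thesis unfolding Y_def by metis
    qed
    have "mean T (periodic_primitive T (G u \<epsilon> p)) = 0"
      using periodic_primitive_properties(2)[OF T cG param_familyD(3)[OF fams(6) \<epsilon> p]] by (simp add: mean_def)
    moreover have "mean T (\<lambda>t. (mean T (Y u \<epsilon> p) - mean T (W u \<epsilon> p) / w1) - (- \<epsilon>) * periodic_primitive T (G u \<epsilon> p) t)
        = mean T (\<lambda>t. mean T (Y u \<epsilon> p) - mean T (W u \<epsilon> p) / w1) - mean T (\<lambda>t. (- \<epsilon>) * periodic_primitive T (G u \<epsilon> p) t)"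
      by (rule mean_diff) (intro continuous_intros cQ)+
    ultimately have "mean T (\<lambda>t. (mean T (Y u \<epsilon> p) - mean T (W u \<epsilon> p) / w1) - (- \<epsilon>) * periodic_primitive T (G u \<epsilon> p) t)
        = mean T (Y u \<epsilon> p) - mean T (W u \<epsilon> p) / w1"
      unfolding mean_mult mean_const[OF T] by simp
    moreover have "(\<lambda>t. (mean T (Y u \<epsilon> p) - mean T (W u \<epsilon> p) / w1) - (- \<epsilon>) * periodic_primitive T (G u \<epsilon> p) t) = Y u \<epsilon> p"
      by (rule ext, subst Y1) simp
    \<comment> \<open>Taking means in the second component: the primitive has zero mean, so the Newton correction vanishes.\<close>
    ultimately have "mean T (Y u \<epsilon> p) = mean T (Y u \<epsilon> p) - mean T (W u \<epsilon> p) / w1" by simp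
    then show W0: "mean T (W u \<epsilon> p) = 0" using v1(2) by simp
    show "Y u \<epsilon> p = (\<lambda>t. mean T (Y u \<epsilon> p) + \<epsilon> * periodic_primitive T (G u \<epsilon> p) t)"
      by (rule ext, subst Y1) (simp add: W0)
  qed
  show ?thesis
  proof (rule that[of "A u" "Y u" "\<lambda>\<epsilon> p. C u \<epsilon> p 0"])
    show "param_family e P T (A u)" "param_family e P T (Y u)" by (rule fams)+
    show "param_family e P T (\<lambda>\<epsilon> p t. C u \<epsilon> p 0)"
      by (rule param_family_cong[OF _ fams(3)]) (rule Ceq)
  next
    fix \<epsilon> :: complex and p t :: real assume \<epsilon>: "norm \<epsilon> < e" and p: "p \<in> P"
    show "norm (A u \<epsilon> p t) < r / 4" "norm (Y u \<epsilon> p t) < r / 4" "norm (C u \<epsilon> p 0) < r / 4"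
      by (rule bounds[OF \<epsilon> p])+
    have cG: "continuous_on UNIV (G u \<epsilon> p)" and cW: "continuous_on UNIV (W u \<epsilon> p)"
      using fams(5,6) by (auto intro: param_family_continuous_time[OF _ \<epsilon> p])
    note QW = periodic_primitive_properties[OF T cW param_familyD(3)[OF fams(5) \<epsilon> p]]
    note QG = periodic_primitive_properties[OF T cG param_familyD(3)[OF fams(6) \<epsilon> p]]
    show "(A u \<epsilon> p has_vector_derivative v (Y u \<epsilon> p t) + \<epsilon> * f p t (A u \<epsilon> p t) (Y u \<epsilon> p t) (C u \<epsilon> p 0)) (at t)"
    proof -
      have "(A u \<epsilon> p has_vector_derivative W u \<epsilon> p t) (at t)"
        using QW(1)[of t] unfolding eqs(2)[OF \<epsilon> p] eqs(1)[OF \<epsilon> p, symmetric] by simp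
      then show ?thesis by (simp add: W_def FF_def Ceq[OF \<epsilon> p, of t])
    qed
    show "integral {0..T} (A u \<epsilon> p) = 0" using QW(2) eqs(1)[OF \<epsilon> p] by simp
    have "((\<lambda>t. mean T (Y u \<epsilon> p) + \<epsilon> * periodic_primitive T (G u \<epsilon> p) t) has_vector_derivative
        0 + \<epsilon> * (G u \<epsilon> p t - mean T (G u \<epsilon> p))) (at t)"
      by (intro has_vector_derivative_add has_vector_derivative_const QG(1)
          bounded_linear.has_vector_derivative[OF bounded_linear_mult_right])
    then show "(Y u \<epsilon> p has_vector_derivative \<epsilon> * g p t (A u \<epsilon> p t) (Y u \<epsilon> p t) (C u \<epsilon> p 0)) (at t)"
      using eqs(3,4)[OF \<epsilon> p] by (simp add: G_def Ceq[OF \<epsilon> p, of t])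
  next
    fix p t :: real assume p: "p \<in> P"
    have "\<forall>i<3. \<forall>p\<in>P. \<forall>t. u (i, 0, p, t) = 0" using u unfolding adm_def by (elim conjE)
    then have "u (i, 0, p, t) = 0" if "i < 3" for i t using p that by blast
    then show "A u 0 p t = 0" "Y u 0 p t = 0" "C u 0 p 0 = 0"
      by (simp_all add: A_def Y_def C_def)
  qed
qed

end

section \<open>The formal periodic solution\<close>

lemma taylor_coeff_0 [simp]: "taylor_coeff 0 \<phi> = \<phi> 0"
  by (simp add: taylor_coeff_def)

lemma taylor_coeff_cong:
  assumes "e > 0" "\<And>x. norm x < e \<Longrightarrow> \<phi> x = \<psi> x"
  shows "taylor_coeff n \<phi> = taylor_coeff n \<psi>"
proof -
  have "eventually (\<lambda>x. x \<in> ball 0 e) (nhds (0::complex))"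
    by (rule eventually_nhds_in_open) (use assms in auto)
  then have "eventually (\<lambda>x. \<phi> x = \<psi> x) (nhds 0)"
    by eventually_elim (use assms(2) in auto)
  then show ?thesis unfolding taylor_coeff_def by (simp add: higher_deriv_cong_ev)
qed

lemma taylor_coeff_const_add:
  assumes "\<phi> holomorphic_on ball 0 e" "e > 0"
  shows "taylor_coeff n (\<lambda>x. c + \<phi> x) = (if n = 0 then c else 0) + taylor_coeff n \<phi>"
proof -
  have "taylor_coeff n (\<lambda>x. c + \<phi> x) = (deriv ^^ n) (\<lambda>x. c) 0 / fact n + taylor_coeff n \<phi>"
    using higher_deriv_add[OF holomorphic_on_const assms(1) open_ball, of 0 n c] assms(2)
    by (simp add: taylor_coeff_def add_divide_distrib)
  then show ?thesis by simp
qed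

text \<open>
The truncated series without its constant term, at a complex argument.
\<close>

definition tail_poly :: "nat \<Rightarrow> (nat \<Rightarrow> real) \<Rightarrow> complex \<Rightarrow> complex" where
  "tail_poly n c \<epsilon> = (\<Sum>k\<in>{1..n}. of_real (c k) * \<epsilon> ^ k)"

lemma tail_poly_holomorphic: "tail_poly n c holomorphic_on U"
  unfolding tail_poly_def[abs_def] by (intro holomorphic_intros)

lemma fps_trunc_tail_poly:
  "complex_of_real (fps_trunc n \<phi> x) = of_real (fps_nth \<phi> 0) + tail_poly n (fps_nth \<phi>) (of_real x)"
proof -
  have "{..n} = insert 0 {1..n}" by auto
  then show ?thesis by (simp add: fps_trunc_def tail_poly_def)
qed

lemma norm_tail_poly_le:
  assumes "norm \<epsilon> \<le> 1"
  shows "norm (tail_poly n c \<epsilon>) \<le> (\<Sum>k\<in>{1..n}. \<bar>c k\<bar>) * norm \<epsilon>"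
proof -
  have "norm (tail_poly n c \<epsilon>) \<le> (\<Sum>k\<in>{1..n}. norm (of_real (c k) * \<epsilon> ^ k))"
    unfolding tail_poly_def by (rule norm_sum)
  also have "\<dots> \<le> (\<Sum>k\<in>{1..n}. \<bar>c k\<bar> * norm \<epsilon>)"
  proof (rule sum_mono)
    fix k assume "k \<in> {1..n}"
    then have "norm \<epsilon> ^ k \<le> norm \<epsilon> ^ 1" using assms by (intro power_decreasing) auto
    then show "norm (of_real (c k) * \<epsilon> ^ k) \<le> \<bar>c k\<bar> * norm \<epsilon>"
      by (simp add: norm_mult norm_power mult_left_mono)
  qed
  finally show ?thesis by (simp add: sum_distrib_right)
qed

lemma tail_poly_diff:
  assumes "\<And>j. 1 \<le> j \<Longrightarrow> j < Suc m \<Longrightarrow> c j - c' j = (if j = m then \<delta> else 0)" "m = 0 \<Longrightarrow> \<delta> = 0"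
  shows "tail_poly (Suc m) c \<epsilon> - tail_poly (Suc m) c' \<epsilon>
    = of_real \<delta> * \<epsilon> ^ m + of_real (c (Suc m) - c' (Suc m)) * \<epsilon> ^ Suc m"
proof -
  have "tail_poly m c \<epsilon> - tail_poly m c' \<epsilon> = (\<Sum>k\<in>{1..m}. of_real (c k - c' k) * \<epsilon> ^ k)"
    by (simp add: tail_poly_def sum_subtractf left_diff_distrib)
  also have "\<dots> = (\<Sum>k\<in>{1..m}. if k = m then of_real \<delta> * \<epsilon> ^ m else 0)"
    by (rule sum.cong) (use assms(1) in \<open>auto simp del: of_real_diff\<close>)
  also have "\<dots> = of_real \<delta> * \<epsilon> ^ m"
    using assms(2) by (cases "m = 0") (auto simp: sum.delta)
  finally have "tail_poly m c \<epsilon> - tail_poly m c' \<epsilon> = of_real \<delta> * \<epsilon> ^ m" .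
  then show ?thesis
    by (simp add: tail_poly_def algebra_simps)
qed

text \<open>
The complexified data are tied to the real system, written in the deviations from the unperturbed
solution and with the time counted from the phase.
\<close>

locale subharmonic_setup = melnikov_setup P T r B f g v w1
  for P T r B f g v w1 +
  fixes \<omega> :: "real \<Rightarrow> real" and F G :: "real \<Rightarrow> real \<Rightarrow> real \<Rightarrow> real \<Rightarrow> real" and q :: int
    and A0 :: real and C0 :: "real \<Rightarrow> real"
  assumes Tq: "T = 2 * pi * of_int q"
    and f_eq: "\<And>p t x y z. p \<in> P \<Longrightarrow> \<bar>x\<bar> < r \<Longrightarrow> \<bar>y\<bar> < r \<Longrightarrow> \<bar>z\<bar> < r \<Longrightarrow>
      f p t (of_real x) (of_real y) (of_real z) = of_real (F (\<omega> A0 * t + x) (A0 + y) (C0 p + z) (t + p))"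
    and g_eq: "\<And>p t x y z. p \<in> P \<Longrightarrow> \<bar>x\<bar> < r \<Longrightarrow> \<bar>y\<bar> < r \<Longrightarrow> \<bar>z\<bar> < r \<Longrightarrow>
      g p t (of_real x) (of_real y) (of_real z) = of_real (G (\<omega> A0 * t + x) (A0 + y) (C0 p + z) (t + p))"
    and v_eq: "\<And>y. \<bar>y\<bar> < r \<Longrightarrow> v (of_real y) = of_real (\<omega> (A0 + y) - \<omega> A0)"
begin

text \<open>
Curves in the domain of the complexified system that start at the origin, with an explicit Lipschitz
constant there.
\<close>

definition small :: "real \<Rightarrow> real \<Rightarrow> (complex \<Rightarrow> complex) \<Rightarrow> bool" where
  "small e M X \<longleftrightarrow> X holomorphic_on ball 0 e \<and>
     (\<forall>\<epsilon>. norm \<epsilon> < e \<longrightarrow> norm (X \<epsilon>) < r / 4 \<and> norm (X \<epsilon>) \<le> M * norm \<epsilon>)"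

definition Rf where "Rf p t X Y Z = (\<lambda>\<epsilon>. v (Y \<epsilon>) + \<epsilon> * f p t (X \<epsilon>) (Y \<epsilon>) (Z \<epsilon>))"

definition Rg where "Rg p t X Y Z = (\<lambda>\<epsilon>. \<epsilon> * g p t (X \<epsilon>) (Y \<epsilon>) (Z \<epsilon>))"

lemma smallD:
  assumes "small e M X"
  shows "X holomorphic_on ball 0 e" "norm \<epsilon> < e \<Longrightarrow> norm (X \<epsilon>) < r / 4" "norm \<epsilon> < e \<Longrightarrow> norm (X \<epsilon>) < r / 2"
    "norm \<epsilon> < e \<Longrightarrow> norm (X \<epsilon>) < r" "norm \<epsilon> < e \<Longrightarrow> norm (X \<epsilon>) \<le> M * norm \<epsilon>"
proof -
  show "X holomorphic_on ball 0 e" using assms by (simp add: small_def)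
  assume "norm \<epsilon> < e"
  then show 1: "norm (X \<epsilon>) < r / 4" "norm (X \<epsilon>) \<le> M * norm \<epsilon>" using assms by (auto simp: small_def)
  show "norm (X \<epsilon>) < r / 2" "norm (X \<epsilon>) < r" using 1 r by linarith+
qed

lemma small_0: "small e M X \<Longrightarrow> e > 0 \<Longrightarrow> X 0 = 0"
  using smallD(5)[of e M X 0] by simp

lemma R_holomorphic:
  assumes p: "p \<in> P" and s: "small e M X" "small e M Y" "small e M Z"
  shows "Rf p t X Y Z holomorphic_on ball 0 e" "Rg p t X Y Z holomorphic_on ball 0 e"
proof -
  have f: "(\<lambda>\<epsilon>. f p t (X \<epsilon>) (Y \<epsilon>) (Z \<epsilon>)) holomorphic_on ball 0 e"
    by (rule complex_family_holomorphic[OF fam_f r p open_ball s[THEN smallD(1)]])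
      (use s[THEN smallD(4)] in auto)
  have g: "(\<lambda>\<epsilon>. g p t (X \<epsilon>) (Y \<epsilon>) (Z \<epsilon>)) holomorphic_on ball 0 e"
    by (rule complex_family_holomorphic[OF fam_g r p open_ball s[THEN smallD(1)]])
      (use s[THEN smallD(4)] in auto)
  have v: "(\<lambda>\<epsilon>. v (Y \<epsilon>)) holomorphic_on ball 0 e"
    by (rule complex_family_holomorphic[OF fam_v r p open_ball s(1,1,2)[THEN smallD(1)]])
      (use s[THEN smallD(4)] in auto)
  show "Rf p t X Y Z holomorphic_on ball 0 e" "Rg p t X Y Z holomorphic_on ball 0 e"
    unfolding Rf_def Rg_def by (intro holomorphic_intros f g v)+
qed

text \<open>
Owing to the factor \<open>\<epsilon>\<close>, the coefficient of order \<open>m + 1\<close> only sees differences of order \<open>m\<close> in the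
arguments. If only the third argument has such a difference, it enters linearly and with the derivative
at the origin, as all arguments are of order \<open>\<epsilon>\<close>.
\<close>

lemma Rg_coeff_diff:
  assumes p: "p \<in> P" and e: "e > 0" and M: "M \<ge> 0"
    and s: "small e M X" "small e M Y" "small e M Z" and s': "small e M X'" "small e M Y'" "small e M Z'"
    and dX: "\<And>\<epsilon>. norm \<epsilon> < e \<Longrightarrow> norm (X \<epsilon> - X' \<epsilon>) \<le> M * norm \<epsilon> ^ Suc m"
    and dY: "\<And>\<epsilon>. norm \<epsilon> < e \<Longrightarrow> norm (Y \<epsilon> - Y' \<epsilon>) \<le> M * norm \<epsilon> ^ Suc m"
    and dZ: "\<And>\<epsilon>. norm \<epsilon> < e \<Longrightarrow> norm (Z \<epsilon> - Z' \<epsilon> - \<delta> * \<epsilon> ^ m) \<le> M * norm \<epsilon> ^ Suc m"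
  shows "taylor_coeff (Suc m) (Rg p t X Y Z) - taylor_coeff (Suc m) (Rg p t X' Y' Z')
    = \<delta> * deriv (\<lambda>z. g p t 0 0 z) 0"
proof -
  define D where "D = deriv (\<lambda>z. g p t 0 0 z) 0"
  define K1 where "K1 = 4 * B / r"
  define K2 where "K2 = 32 * B / r\<^sup>2"
  have K: "K1 \<ge> 0" "K2 \<ge> 0" using B_nonneg[OF p] r by (auto simp: K1_def K2_def)
  define K where "K = K1 * (2 * M) + K2 * (4 * M) * (norm \<delta> + M * e) + norm D * M"
  show ?thesis
    unfolding D_def[symmetric]
  proof (rule taylor_coeff_eq_cong[OF R_holomorphic(2)[OF p s] R_holomorphic(2)[OF p s'] e, where K = K])
    fix \<epsilon> :: complex assume \<epsilon>: "norm \<epsilon> < e"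
    note S = s[THEN smallD(2), OF \<epsilon>] s'[THEN smallD(2), OF \<epsilon>]
    note S5 = s(3)[THEN smallD(5), OF \<epsilon>] s'[THEN smallD(5), OF \<epsilon>]
    have "norm (Z \<epsilon> - Z' \<epsilon>) \<le> norm (Z \<epsilon> - Z' \<epsilon> - \<delta> * \<epsilon> ^ m) + norm (\<delta> * \<epsilon> ^ m)"
      using norm_triangle_ineq[of "Z \<epsilon> - Z' \<epsilon> - \<delta> * \<epsilon> ^ m" "\<delta> * \<epsilon> ^ m"] by simp
    also have "\<dots> \<le> M * norm \<epsilon> ^ Suc m + norm \<delta> * norm \<epsilon> ^ m"
      using dZ[OF \<epsilon>] by (simp add: norm_mult norm_power)
    also have "M * norm \<epsilon> ^ Suc m \<le> M * e * norm \<epsilon> ^ m"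
      using \<epsilon> M by (simp add: mult.assoc mult_left_mono mult_right_mono)
    finally have Zle: "norm (Z \<epsilon> - Z' \<epsilon>) \<le> (norm \<delta> + M * e) * norm \<epsilon> ^ m"
      by (simp add: algebra_simps)
    have "norm (g p t (X \<epsilon>) (Y \<epsilon>) (Z \<epsilon>) - g p t (X' \<epsilon>) (Y' \<epsilon>) (Z' \<epsilon>) - (Z \<epsilon> - Z' \<epsilon>) * D)
      \<le> K1 * (norm (X \<epsilon> - X' \<epsilon>) + norm (Y \<epsilon> - Y' \<epsilon>))
        + K2 * (norm (X' \<epsilon>) + norm (Y' \<epsilon>) + norm (Z \<epsilon>) + norm (Z' \<epsilon>)) * norm (Z \<epsilon> - Z' \<epsilon>)"
      unfolding D_def K1_def K2_def by (rule complex_family_lipschitz_linear[OF fam_g r p S])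
    also have "\<dots> \<le> K1 * (2 * M * norm \<epsilon> ^ Suc m) + K2 * (4 * M * norm \<epsilon>) * ((norm \<delta> + M * e) * norm \<epsilon> ^ m)"
    proof (intro add_mono mult_mono mult_left_mono)
      show "norm (X \<epsilon> - X' \<epsilon>) + norm (Y \<epsilon> - Y' \<epsilon>) \<le> 2 * M * norm \<epsilon> ^ Suc m"
        using dX[OF \<epsilon>] dY[OF \<epsilon>] by simp
      show "norm (X' \<epsilon>) + norm (Y' \<epsilon>) + norm (Z \<epsilon>) + norm (Z' \<epsilon>) \<le> 4 * M * norm \<epsilon>"
        using S5 by linarith
      show "norm (Z \<epsilon> - Z' \<epsilon>) \<le> (norm \<delta> + M * e) * norm \<epsilon> ^ m" by (rule Zle)
    qed (use K M e in auto)
    finally have 1: "norm (g p t (X \<epsilon>) (Y \<epsilon>) (Z \<epsilon>) - g p t (X' \<epsilon>) (Y' \<epsilon>) (Z' \<epsilon>) - (Z \<epsilon> - Z' \<epsilon>) * D)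
      \<le> (K1 * (2 * M) + K2 * (4 * M) * (norm \<delta> + M * e)) * norm \<epsilon> ^ Suc m" by (simp add: algebra_simps)
    have 2: "norm ((Z \<epsilon> - Z' \<epsilon> - \<delta> * \<epsilon> ^ m) * D) \<le> norm D * M * norm \<epsilon> ^ Suc m"
      using mult_left_mono[OF dZ[OF \<epsilon>] norm_ge_zero[of D]] by (simp only: norm_mult mult_ac)
    have "Rg p t X Y Z \<epsilon> - Rg p t X' Y' Z' \<epsilon> - \<delta> * D * \<epsilon> ^ Suc m =
      \<epsilon> * ((g p t (X \<epsilon>) (Y \<epsilon>) (Z \<epsilon>) - g p t (X' \<epsilon>) (Y' \<epsilon>) (Z' \<epsilon>) - (Z \<epsilon> - Z' \<epsilon>) * D)
        + (Z \<epsilon> - Z' \<epsilon> - \<delta> * \<epsilon> ^ m) * D)"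
      by (simp add: Rg_def algebra_simps)
    also have "norm \<dots> \<le> norm \<epsilon> * ((K1 * (2 * M) + K2 * (4 * M) * (norm \<delta> + M * e)) * norm \<epsilon> ^ Suc m
        + norm D * M * norm \<epsilon> ^ Suc m)"
      unfolding norm_mult[of \<epsilon>] by (intro mult_left_mono norm_triangle_mono 1 2) auto
    also have "\<dots> = K * norm \<epsilon> ^ Suc (Suc m)" by (simp add: K_def algebra_simps)
    finally show "norm (Rg p t X Y Z \<epsilon> - Rg p t X' Y' Z' \<epsilon> - \<delta> * D * \<epsilon> ^ Suc m) \<le> K * norm \<epsilon> ^ Suc (Suc m)" .
  qed
qed

text \<open>
When all differences in the arguments have order \<open>m + 1\<close>, the perturbation \<open>f\<close> contributes to
orders from \<open>m + 2\<close> on, and \<open>v\<close> acts through its linear part \<open>w1\<close>.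
\<close>

lemma Rf_coeff_diff:
  assumes p: "p \<in> P" and e: "e > 0" and M: "M \<ge> 0"
    and s: "small e M X" "small e M Y" "small e M Z" and s': "small e M X'" "small e M Y'" "small e M Z'"
    and dX: "\<And>\<epsilon>. norm \<epsilon> < e \<Longrightarrow> norm (X \<epsilon> - X' \<epsilon>) \<le> M * norm \<epsilon> ^ Suc m"
    and dY: "\<And>\<epsilon>. norm \<epsilon> < e \<Longrightarrow> norm (Y \<epsilon> - Y' \<epsilon> - \<beta> * \<epsilon> ^ Suc m) \<le> M * norm \<epsilon> ^ Suc (Suc m)"
    and dZ: "\<And>\<epsilon>. norm \<epsilon> < e \<Longrightarrow> norm (Z \<epsilon> - Z' \<epsilon>) \<le> M * norm \<epsilon> ^ Suc m"
  shows "taylor_coeff (Suc m) (Rf p t X Y Z) - taylor_coeff (Suc m) (Rf p t X' Y' Z') = w1 * \<beta>"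
proof -
  define K1 where "K1 = 4 * B / r"
  define K2 where "K2 = 32 * B / r\<^sup>2"
  have K: "K1 \<ge> 0" "K2 \<ge> 0" using B_nonneg[OF p] r by (auto simp: K1_def K2_def)
  define N where "N = norm \<beta> + M * e"
  have N: "N \<ge> 0" using M e by (simp add: N_def)
  define K where "K = K2 * (2 * M) * N + norm w1 * M + K1 * (2 * M + N)"
  have Dv: "deriv v 0 = w1" using v1(1) by (rule DERIV_imp_deriv)
  show ?thesis
  proof (rule taylor_coeff_eq_cong[OF R_holomorphic(1)[OF p s] R_holomorphic(1)[OF p s'] e, where K = K])
    fix \<epsilon> :: complex assume \<epsilon>: "norm \<epsilon> < e"
    note S = s[THEN smallD(2), OF \<epsilon>] s'[THEN smallD(2), OF \<epsilon>]
    note S2 = s[THEN smallD(3), OF \<epsilon>] s'[THEN smallD(3), OF \<epsilon>]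
    note S5 = s(2)[THEN smallD(5), OF \<epsilon>] s'(2)[THEN smallD(5), OF \<epsilon>]
    have "norm (Y \<epsilon> - Y' \<epsilon>) \<le> norm (Y \<epsilon> - Y' \<epsilon> - \<beta> * \<epsilon> ^ Suc m) + norm (\<beta> * \<epsilon> ^ Suc m)"
      using norm_triangle_ineq[of "Y \<epsilon> - Y' \<epsilon> - \<beta> * \<epsilon> ^ Suc m" "\<beta> * \<epsilon> ^ Suc m"] by simp
    also have "\<dots> \<le> M * norm \<epsilon> ^ Suc (Suc m) + norm \<beta> * norm \<epsilon> ^ Suc m"
      using dY[OF \<epsilon>] by (simp add: norm_mult norm_power)
    also have "M * norm \<epsilon> ^ Suc (Suc m) \<le> M * (e * norm \<epsilon> ^ Suc m)"
      unfolding power_Suc[of _ "Suc m"] using \<epsilon> M by (intro mult_left_mono mult_right_mono) auto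
    finally have Yle: "norm (Y \<epsilon> - Y' \<epsilon>) \<le> N * norm \<epsilon> ^ Suc m"
      by (simp add: N_def algebra_simps)
    have "norm (v (Y \<epsilon>) - v (Y' \<epsilon>) - (Y \<epsilon> - Y' \<epsilon>) * deriv (\<lambda>z. v z) 0)
      \<le> 4 * B / r * (norm (0 - 0 :: complex) + norm (0 - 0 :: complex))
        + 32 * B / r\<^sup>2 * (norm (0 :: complex) + norm (0 :: complex) + norm (Y \<epsilon>) + norm (Y' \<epsilon>)) * norm (Y \<epsilon> - Y' \<epsilon>)"
      by (rule complex_family_lipschitz_linear[OF fam_v r p]) (use r S(2,5) in auto)
    also have "\<dots> = K2 * (norm (Y \<epsilon>) + norm (Y' \<epsilon>)) * norm (Y \<epsilon> - Y' \<epsilon>)" by (simp add: K2_def)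
    also have "\<dots> \<le> K2 * (2 * M * norm \<epsilon>) * (N * norm \<epsilon> ^ Suc m)"
      using S5 Yle K M by (intro mult_mono) auto
    finally have 1: "norm (v (Y \<epsilon>) - v (Y' \<epsilon>) - (Y \<epsilon> - Y' \<epsilon>) * w1) \<le> K2 * (2 * M) * N * norm \<epsilon> ^ Suc (Suc m)"
      unfolding Dv by (simp add: mult_ac)
    have 2: "norm ((Y \<epsilon> - Y' \<epsilon> - \<beta> * \<epsilon> ^ Suc m) * w1) \<le> norm w1 * M * norm \<epsilon> ^ Suc (Suc m)"
      using mult_left_mono[OF dY[OF \<epsilon>] norm_ge_zero[of w1]] by (simp only: norm_mult mult_ac)
    have "norm (f p t (X \<epsilon>) (Y \<epsilon>) (Z \<epsilon>) - f p t (X' \<epsilon>) (Y' \<epsilon>) (Z' \<epsilon>))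
        \<le> K1 * (norm (X \<epsilon> - X' \<epsilon>) + norm (Y \<epsilon> - Y' \<epsilon>) + norm (Z \<epsilon> - Z' \<epsilon>))"
      unfolding K1_def by (rule complex_family_lipschitz[OF fam_f r p S2])
    also have "\<dots> \<le> K1 * ((2 * M + N) * norm \<epsilon> ^ Suc m)"
      using dX[OF \<epsilon>] dZ[OF \<epsilon>] Yle K by (intro mult_left_mono) (auto simp: algebra_simps)
    finally have "norm (\<epsilon> * (f p t (X \<epsilon>) (Y \<epsilon>) (Z \<epsilon>) - f p t (X' \<epsilon>) (Y' \<epsilon>) (Z' \<epsilon>)))
        \<le> norm \<epsilon> * (K1 * ((2 * M + N) * norm \<epsilon> ^ Suc m))"
      unfolding norm_mult by (intro mult_left_mono) auto
    then have 3: "norm (\<epsilon> * (f p t (X \<epsilon>) (Y \<epsilon>) (Z \<epsilon>) - f p t (X' \<epsilon>) (Y' \<epsilon>) (Z' \<epsilon>)))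
        \<le> K1 * (2 * M + N) * norm \<epsilon> ^ Suc (Suc m)" by (simp add: mult_ac)
    have "Rf p t X Y Z \<epsilon> - Rf p t X' Y' Z' \<epsilon> - w1 * \<beta> * \<epsilon> ^ Suc m =
      (v (Y \<epsilon>) - v (Y' \<epsilon>) - (Y \<epsilon> - Y' \<epsilon>) * w1) + (Y \<epsilon> - Y' \<epsilon> - \<beta> * \<epsilon> ^ Suc m) * w1
       + \<epsilon> * (f p t (X \<epsilon>) (Y \<epsilon>) (Z \<epsilon>) - f p t (X' \<epsilon>) (Y' \<epsilon>) (Z' \<epsilon>))"
      by (simp add: Rf_def algebra_simps)
    also have "norm \<dots> \<le> K2 * (2 * M) * N * norm \<epsilon> ^ Suc (Suc m) + norm w1 * M * norm \<epsilon> ^ Suc (Suc m)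
        + K1 * (2 * M + N) * norm \<epsilon> ^ Suc (Suc m)"
      by (intro norm_triangle_mono 1 2 3)
    also have "\<dots> = K * norm \<epsilon> ^ Suc (Suc m)" by (simp add: K_def algebra_simps)
    finally show "norm (Rf p t X Y Z \<epsilon> - Rf p t X' Y' Z' \<epsilon> - w1 * \<beta> * \<epsilon> ^ Suc m) \<le> K * norm \<epsilon> ^ Suc (Suc m)" .
  qed
qed

lemma small_tail_poly:
  assumes M: "(\<Sum>k\<in>{1..n}. \<bar>c k\<bar>) \<le> M" and e: "e \<le> 1" "M * e \<le> r / 4" and M0: "M > 0"
  shows "small e M (tail_poly n c)"
  unfolding small_def
proof (intro conjI allI impI tail_poly_holomorphic)
  fix \<epsilon> :: complex assume \<epsilon>: "norm \<epsilon> < e"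
  have "norm (tail_poly n c \<epsilon>) \<le> (\<Sum>k\<in>{1..n}. \<bar>c k\<bar>) * norm \<epsilon>"
    by (rule norm_tail_poly_le) (use \<epsilon> e in auto)
  also have "\<dots> \<le> M * norm \<epsilon>" using M by (intro mult_right_mono) auto
  finally show 1: "norm (tail_poly n c \<epsilon>) \<le> M * norm \<epsilon>" .
  have "M * norm \<epsilon> < M * e" using M0 \<epsilon> by simp
  then show "norm (tail_poly n c \<epsilon>) < r / 4" using 1 e by linarith
qed

text \<open>
On a small real interval the right hand sides at the truncated series are the restrictions of \<open>Rf\<close> and
\<open>Rg\<close> along polynomial curves.
\<close>

lemma eps_coeff_rhs:
  assumes p: "p \<in> P" and e: "e > 0"
    and nth0: "fps_nth \<alpha> 0 = \<omega> A0 * t" "fps_nth A 0 = A0" "fps_nth C 0 = C0 p"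
    and s: "small e M (tail_poly n (fps_nth \<alpha>))" "small e M (tail_poly n (fps_nth A))" "small e M (tail_poly n (fps_nth C))"
  shows "complex_of_real (eps_coeff n (\<lambda>\<epsilon>. \<omega> (fps_trunc n A \<epsilon>) +
               \<epsilon> * F (fps_trunc n \<alpha> \<epsilon>) (fps_trunc n A \<epsilon>) (fps_trunc n C \<epsilon>) (t + p)))
      = (if n = 0 then of_real (\<omega> A0) else 0) +
        taylor_coeff n (Rf p t (tail_poly n (fps_nth \<alpha>)) (tail_poly n (fps_nth A)) (tail_poly n (fps_nth C)))"
    and "complex_of_real (eps_coeff n (\<lambda>\<epsilon>. \<epsilon> * G (fps_trunc n \<alpha> \<epsilon>) (fps_trunc n A \<epsilon>) (fps_trunc n C \<epsilon>) (t + p)))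
      = taylor_coeff n (Rg p t (tail_poly n (fps_nth \<alpha>)) (tail_poly n (fps_nth A)) (tail_poly n (fps_nth C)))"
proof -
  let ?X = "tail_poly n (fps_nth \<alpha>)" and ?Y = "tail_poly n (fps_nth A)" and ?Z = "tail_poly n (fps_nth C)"
  have tr: "?X (of_real x) = of_real (fps_trunc n \<alpha> x - \<omega> A0 * t)" "?Y (of_real x) = of_real (fps_trunc n A x - A0)"
    "?Z (of_real x) = of_real (fps_trunc n C x - C0 p)" for x :: real
    unfolding of_real_diff fps_trunc_tail_poly nth0 by simp_all
  have bd: "\<bar>fps_trunc n \<alpha> x - \<omega> A0 * t\<bar> < r" "\<bar>fps_trunc n A x - A0\<bar> < r" "\<bar>fps_trunc n C x - C0 p\<bar> < r"
    if "\<bar>x\<bar> < e" for x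
    using s[THEN smallD(4), of "of_real x"] that unfolding tr norm_of_real by auto
  note hol = R_holomorphic[OF p s, of t]
  have "taylor_coeff n (\<lambda>\<epsilon>. of_real (\<omega> A0) + Rf p t ?X ?Y ?Z \<epsilon>) =
      of_real (eps_coeff n (\<lambda>\<epsilon>. \<omega> (fps_trunc n A \<epsilon>) +
               \<epsilon> * F (fps_trunc n \<alpha> \<epsilon>) (fps_trunc n A \<epsilon>) (fps_trunc n C \<epsilon>) (t + p)))"
  proof (rule taylor_coeff_complexification[OF _ e])
    show "(\<lambda>\<epsilon>. of_real (\<omega> A0) + Rf p t ?X ?Y ?Z \<epsilon>) holomorphic_on ball 0 e"
      by (intro holomorphic_intros hol)
    fix x :: real assume x: "\<bar>x\<bar> < e"
    show "of_real (\<omega> A0) + Rf p t ?X ?Y ?Z (of_real x) = of_real (\<omega> (fps_trunc n A x) +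
               x * F (fps_trunc n \<alpha> x) (fps_trunc n A x) (fps_trunc n C x) (t + p))"
      unfolding Rf_def tr f_eq[OF p bd[OF x]] v_eq[OF bd(2)[OF x]] by simp
  qed
  then show "complex_of_real (eps_coeff n (\<lambda>\<epsilon>. \<omega> (fps_trunc n A \<epsilon>) +
               \<epsilon> * F (fps_trunc n \<alpha> \<epsilon>) (fps_trunc n A \<epsilon>) (fps_trunc n C \<epsilon>) (t + p)))
      = (if n = 0 then of_real (\<omega> A0) else 0) + taylor_coeff n (Rf p t ?X ?Y ?Z)"
    unfolding taylor_coeff_const_add[OF hol(1) e] by (rule sym)
  have "taylor_coeff n (Rg p t ?X ?Y ?Z) =
      of_real (eps_coeff n (\<lambda>\<epsilon>. \<epsilon> * G (fps_trunc n \<alpha> \<epsilon>) (fps_trunc n A \<epsilon>) (fps_trunc n C \<epsilon>) (t + p)))"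
  proof (rule taylor_coeff_complexification[OF hol(2) e])
    fix x :: real assume x: "\<bar>x\<bar> < e"
    show "Rg p t ?X ?Y ?Z (of_real x) = of_real (x * G (fps_trunc n \<alpha> x) (fps_trunc n A x) (fps_trunc n C x) (t + p))"
      unfolding Rg_def tr g_eq[OF p bd[OF x]] by simp
  qed
  then show "complex_of_real (eps_coeff n (\<lambda>\<epsilon>. \<epsilon> * G (fps_trunc n \<alpha> \<epsilon>) (fps_trunc n A \<epsilon>) (fps_trunc n C \<epsilon>) (t + p)))
      = taylor_coeff n (Rg p t ?X ?Y ?Z)" by simp
qed

lemma formal_subharmonicD:
  assumes "formal_subharmonic \<omega> F G q A0 (C0 p) p \<alpha> A C"
  shows "fps_nth (\<alpha> t) 0 = \<omega> A0 * t" "fps_nth (A t) 0 = A0" "fps_nth C 0 = C0 p"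
    and "k \<ge> 1 \<Longrightarrow> fps_nth (\<alpha> (t + T)) k = fps_nth (\<alpha> t) k" "k \<ge> 1 \<Longrightarrow> fps_nth (A (t + T)) k = fps_nth (A t) k"
    and "k \<ge> 1 \<Longrightarrow> ((\<lambda>t. fps_nth (\<alpha> t) k) has_integral 0) {0..T}"
    and "((\<lambda>s. fps_nth (\<alpha> s) n) has_real_derivative
             eps_coeff n (\<lambda>\<epsilon>. \<omega> (fps_trunc n (A t) \<epsilon>) +
               \<epsilon> * F (fps_trunc n (\<alpha> t) \<epsilon>) (fps_trunc n (A t) \<epsilon>) (fps_trunc n C \<epsilon>) (t + p))) (at t)"
    and "((\<lambda>s. fps_nth (A s) n) has_real_derivative
             eps_coeff n (\<lambda>\<epsilon>.
               \<epsilon> * G (fps_trunc n (\<alpha> t) \<epsilon>) (fps_trunc n (A t) \<epsilon>) (fps_trunc n C \<epsilon>) (t + p))) (at t)"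
  using assms unfolding formal_subharmonic_def Let_def periodic_with_def Tq by auto

text \<open>
The triangular structure of the formal equations: once the lower orders agree, order \<open>m + 1\<close> of the
\<open>A\<close>-equation sees only the coefficient of \<open>C\<close> of order \<open>m\<close>, and order \<open>m + 1\<close> of the \<open>\<alpha>\<close>-equation
only the coefficient of \<open>A\<close> of order \<open>m + 1\<close>.
\<close>

lemma coefficient_step:
  assumes p: "p \<in> P"
    and nth0: "fps_nth \<alpha> 0 = \<omega> A0 * t" "fps_nth A 0 = A0" "fps_nth C 0 = C0 p"
    and nth0': "fps_nth \<alpha>' 0 = \<omega> A0 * t" "fps_nth A' 0 = A0" "fps_nth C' 0 = C0 p"
    and eq\<alpha>: "\<And>j. j \<le> m \<Longrightarrow> fps_nth \<alpha> j = fps_nth \<alpha>' j"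
    and eqA: "\<And>j. j \<le> m \<Longrightarrow> fps_nth A j = fps_nth A' j"
    and eqC: "\<And>j. j < m \<Longrightarrow> fps_nth C j = fps_nth C' j"
  defines "\<delta> \<equiv> fps_nth C m - fps_nth C' m"
  shows "complex_of_real (
       eps_coeff (Suc m) (\<lambda>\<epsilon>. \<epsilon> * G (fps_trunc (Suc m) \<alpha> \<epsilon>) (fps_trunc (Suc m) A \<epsilon>) (fps_trunc (Suc m) C \<epsilon>) (t + p))
     - eps_coeff (Suc m) (\<lambda>\<epsilon>. \<epsilon> * G (fps_trunc (Suc m) \<alpha>' \<epsilon>) (fps_trunc (Suc m) A' \<epsilon>) (fps_trunc (Suc m) C' \<epsilon>) (t + p)))
     = of_real \<delta> * deriv (\<lambda>z. g p t 0 0 z) 0"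
    and "\<delta> = 0 \<Longrightarrow> complex_of_real (
       eps_coeff (Suc m) (\<lambda>\<epsilon>. \<omega> (fps_trunc (Suc m) A \<epsilon>) +
          \<epsilon> * F (fps_trunc (Suc m) \<alpha> \<epsilon>) (fps_trunc (Suc m) A \<epsilon>) (fps_trunc (Suc m) C \<epsilon>) (t + p))
     - eps_coeff (Suc m) (\<lambda>\<epsilon>. \<omega> (fps_trunc (Suc m) A' \<epsilon>) +
          \<epsilon> * F (fps_trunc (Suc m) \<alpha>' \<epsilon>) (fps_trunc (Suc m) A' \<epsilon>) (fps_trunc (Suc m) C' \<epsilon>) (t + p)))
     = w1 * of_real (fps_nth A (Suc m) - fps_nth A' (Suc m))"
proof -
  define N where "N = (\<lambda>\<phi>. \<Sum>k\<in>{1..Suc m}. \<bar>fps_nth \<phi> k\<bar> :: real)"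
  have N0: "N \<phi> \<ge> 0" for \<phi> by (simp add: N_def sum_nonneg)
  have Nn: "\<bar>fps_nth \<phi> (Suc m)\<bar> \<le> N \<phi>" for \<phi>
    unfolding N_def by (rule member_le_sum) auto
  define M where "M = 1 + N \<alpha> + N A + N C + N \<alpha>' + N A' + N C'"
  have M: "M > 0" using N0[of \<alpha>] N0[of A] N0[of C] N0[of \<alpha>'] N0[of A'] N0[of C'] unfolding M_def by linarith
  have NM: "N \<alpha> + N \<alpha>' \<le> M" "N A + N A' \<le> M" "N C + N C' \<le> M"
    "N \<alpha> \<le> M" "N A \<le> M" "N C \<le> M" "N \<alpha>' \<le> M" "N A' \<le> M" "N C' \<le> M"
    using N0[of \<alpha>] N0[of A] N0[of C] N0[of \<alpha>'] N0[of A'] N0[of C'] unfolding M_def by linarith+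
  define e where "e = min 1 (r / (4 * M))"
  have e: "e > 0" "e \<le> 1" "M * e \<le> r / 4"
  proof -
    show "e > 0" "e \<le> 1" using M r by (auto simp: e_def)
    have "M * e \<le> M * (r / (4 * M))" using M by (intro mult_left_mono) (auto simp: e_def)
    then show "M * e \<le> r / 4" using M by simp
  qed
  have sm: "small e M (tail_poly (Suc m) (fps_nth \<phi>))" if "N \<phi> \<le> M" for \<phi>
    using that e M by (intro small_tail_poly) (simp_all add: N_def)
  note s = sm[OF NM(4)] sm[OF NM(5)] sm[OF NM(6)] and s' = sm[OF NM(7)] sm[OF NM(8)] sm[OF NM(9)]
  have m0: "m = 0 \<Longrightarrow> \<delta> = 0" using nth0(3) nth0'(3) by (simp add: \<delta>_def)
  have d\<alpha>: "tail_poly (Suc m) (fps_nth \<alpha>) \<epsilon> - tail_poly (Suc m) (fps_nth \<alpha>') \<epsilon>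
      = of_real (fps_nth \<alpha> (Suc m) - fps_nth \<alpha>' (Suc m)) * \<epsilon> ^ Suc m" for \<epsilon>
    using tail_poly_diff[of m "fps_nth \<alpha>" "fps_nth \<alpha>'" 0 \<epsilon>] eq\<alpha> by simp
  have dA: "tail_poly (Suc m) (fps_nth A) \<epsilon> - tail_poly (Suc m) (fps_nth A') \<epsilon>
      = of_real (fps_nth A (Suc m) - fps_nth A' (Suc m)) * \<epsilon> ^ Suc m" for \<epsilon>
    using tail_poly_diff[of m "fps_nth A" "fps_nth A'" 0 \<epsilon>] eqA by simp
  have dC: "tail_poly (Suc m) (fps_nth C) \<epsilon> - tail_poly (Suc m) (fps_nth C') \<epsilon> - of_real \<delta> * \<epsilon> ^ m
      = of_real (fps_nth C (Suc m) - fps_nth C' (Suc m)) * \<epsilon> ^ Suc m" for \<epsilon>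
    using tail_poly_diff[of m "fps_nth C" "fps_nth C'" \<delta> \<epsilon>] eqC m0 by (auto simp: \<delta>_def)
  have le: "norm (complex_of_real (fps_nth \<phi> (Suc m) - fps_nth \<psi> (Suc m)) * \<epsilon> ^ Suc m) \<le> M * norm \<epsilon> ^ Suc m"
    if "N \<phi> + N \<psi> \<le> M" for \<phi> \<psi> \<epsilon>
  proof -
    have "\<bar>fps_nth \<phi> (Suc m) - fps_nth \<psi> (Suc m)\<bar> \<le> M"
      using Nn[of \<phi>] Nn[of \<psi>] that by linarith
    then show ?thesis unfolding norm_mult norm_of_real norm_power by (rule mult_right_mono) simp
  qed
  note E = eps_coeff_rhs[OF p e(1) nth0 s] and E' = eps_coeff_rhs[OF p e(1) nth0' s']
  have M': "0 \<le> M" using M by simp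
  show "complex_of_real (
       eps_coeff (Suc m) (\<lambda>\<epsilon>. \<epsilon> * G (fps_trunc (Suc m) \<alpha> \<epsilon>) (fps_trunc (Suc m) A \<epsilon>) (fps_trunc (Suc m) C \<epsilon>) (t + p))
     - eps_coeff (Suc m) (\<lambda>\<epsilon>. \<epsilon> * G (fps_trunc (Suc m) \<alpha>' \<epsilon>) (fps_trunc (Suc m) A' \<epsilon>) (fps_trunc (Suc m) C' \<epsilon>) (t + p)))
     = of_real \<delta> * deriv (\<lambda>z. g p t 0 0 z) 0"
    unfolding of_real_diff E(2) E'(2)
  proof (rule Rg_coeff_diff[OF p e(1) M' s s'])
  qed (unfold d\<alpha> dA dC, (rule le, rule NM)+)
  show "complex_of_real (
       eps_coeff (Suc m) (\<lambda>\<epsilon>. \<omega> (fps_trunc (Suc m) A \<epsilon>) +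
          \<epsilon> * F (fps_trunc (Suc m) \<alpha> \<epsilon>) (fps_trunc (Suc m) A \<epsilon>) (fps_trunc (Suc m) C \<epsilon>) (t + p))
     - eps_coeff (Suc m) (\<lambda>\<epsilon>. \<omega> (fps_trunc (Suc m) A' \<epsilon>) +
          \<epsilon> * F (fps_trunc (Suc m) \<alpha>' \<epsilon>) (fps_trunc (Suc m) A' \<epsilon>) (fps_trunc (Suc m) C' \<epsilon>) (t + p)))
     = w1 * of_real (fps_nth A (Suc m) - fps_nth A' (Suc m))" if \<delta>: "\<delta> = 0"
  proof -
    have "taylor_coeff (Suc m) (Rf p t (tail_poly (Suc m) (fps_nth \<alpha>)) (tail_poly (Suc m) (fps_nth A)) (tail_poly (Suc m) (fps_nth C)))
        - taylor_coeff (Suc m) (Rf p t (tail_poly (Suc m) (fps_nth \<alpha>')) (tail_poly (Suc m) (fps_nth A')) (tail_poly (Suc m) (fps_nth C')))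
        = w1 * of_real (fps_nth A (Suc m) - fps_nth A' (Suc m))"
    proof (rule Rf_coeff_diff[OF p e(1) M' s s'])
      fix \<epsilon> :: complex
      show "norm (tail_poly (Suc m) (fps_nth \<alpha>) \<epsilon> - tail_poly (Suc m) (fps_nth \<alpha>') \<epsilon>) \<le> M * norm \<epsilon> ^ Suc m"
        unfolding d\<alpha> by (rule le) (rule NM)
      show "norm (tail_poly (Suc m) (fps_nth A) \<epsilon> - tail_poly (Suc m) (fps_nth A') \<epsilon>
          - of_real (fps_nth A (Suc m) - fps_nth A' (Suc m)) * \<epsilon> ^ Suc m) \<le> M * norm \<epsilon> ^ Suc (Suc m)"
        unfolding dA using M by simp
      show "norm (tail_poly (Suc m) (fps_nth C) \<epsilon> - tail_poly (Suc m) (fps_nth C') \<epsilon>) \<le> M * norm \<epsilon> ^ Suc m"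
        using dC[of \<epsilon>] le[OF NM(3), of \<epsilon>] \<delta> by simp
    qed
    then show ?thesis unfolding of_real_diff E(1) E'(1) by simp
  qed
qed

text \<open>
The induction carries \<open>\<alpha>\<close> and \<open>A\<close> to order \<open>m\<close> but \<open>C\<close> only to order \<open>m - 1\<close>, because \<open>C\<^sub>m\<close> is fixed
by the solvability condition one order later. Averaging over a period, the \<open>A\<close>-equation of order
\<open>m + 1\<close> yields \<open>C\<^sub>m\<close> because the Melnikov derivative is nonzero; the coefficients of \<open>A\<close> then differ by
a constant, which the averaged \<open>\<alpha>\<close>-equation and the twist force to be zero; and the coefficients of \<open>\<alpha>\<close>
differ by a constant of zero mean.
\<close>

lemma formal_subharmonic_unique:
  assumes p: "p \<in> P"
    and S: "formal_subharmonic \<omega> F G q A0 (C0 p) p \<alpha> A C"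
    and S': "formal_subharmonic \<omega> F G q A0 (C0 p) p \<alpha>' A' C'"
  shows "C = C'"
proof -
  note D = formal_subharmonicD[OF S] and D' = formal_subharmonicD[OF S']
  have "(\<forall>j\<le>n. \<forall>t. fps_nth (\<alpha> t) j = fps_nth (\<alpha>' t) j \<and> fps_nth (A t) j = fps_nth (A' t) j) \<and>
      (\<forall>j<n. fps_nth C j = fps_nth C' j)" for n
  proof (induction n)
    case 0
    show ?case by (simp add: D D')
  next
    case (Suc m)
    define \<delta> where "\<delta> = fps_nth C m - fps_nth C' m"
    define dA where "dA = (\<lambda>t. fps_nth (A t) (Suc m) - fps_nth (A' t) (Suc m))"
    define da where "da = (\<lambda>t. fps_nth (\<alpha> t) (Suc m) - fps_nth (\<alpha>' t) (Suc m))"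
    note step = coefficient_step[OF p D(1-3) D'(1-3), where m = m, folded \<delta>_def]
    have eqs: "\<And>t j. j \<le> m \<Longrightarrow> fps_nth (\<alpha> t) j = fps_nth (\<alpha>' t) j" "\<And>t j. j \<le> m \<Longrightarrow> fps_nth (A t) j = fps_nth (A' t) j"
      "\<And>j. j < m \<Longrightarrow> fps_nth C j = fps_nth C' j" using Suc.IH by auto
    have per: "dA (t + T) = dA t" "da (t + T) = da t" for t
      using D(4,5)[of "Suc m"] D'(4,5)[of "Suc m"] by (simp_all add: dA_def da_def)
    have derA: "((\<lambda>t. complex_of_real (dA t)) has_vector_derivative of_real \<delta> * deriv (\<lambda>z. g p t 0 0 z) 0) (at t)" for t
      unfolding dA_def \<delta>_def
      by (rule has_vector_derivative_eq_rhs[OF has_vector_derivative_of_real[OF DERIV_diff[OF D(8) D'(8)]]])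
        (rule coefficient_step(1)[OF p D(1-3) D'(1-3) eqs])
    have "((\<lambda>t. of_real \<delta> * deriv (\<lambda>z. g p t 0 0 z) 0) has_integral complex_of_real (dA T) - of_real (dA 0)) {0..T}"
      by (rule fundamental_theorem_of_calculus) (use T derA in \<open>auto intro: has_vector_derivative_at_within\<close>)
    then have "mean T (\<lambda>t. of_real \<delta> * deriv (\<lambda>z. g p t 0 0 z) 0) = 0"
      using per(1)[of 0] by (auto simp: mean_def dest: integral_unique)
    then have \<delta>: "\<delta> = 0" using g1[OF p] by (simp add: mean_mult)
    have "(dA has_real_derivative 0) (at t)" for t
    proof -
      have "((\<lambda>t. Re (complex_of_real (dA t))) has_real_derivative Re (of_real \<delta> * deriv (\<lambda>z. g p t 0 0 z) 0)) (at t)"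
        by (rule has_field_derivative_Re[OF derA])
      then show ?thesis using \<delta> by simp
    qed
    then have dA0: "dA t = dA 0" for t using DERIV_isconst_all by blast
    have dera: "((\<lambda>t. complex_of_real (da t)) has_vector_derivative w1 * of_real (dA 0)) (at t)" for t
      unfolding da_def dA0[of t, symmetric] unfolding dA_def
      by (rule has_vector_derivative_eq_rhs[OF has_vector_derivative_of_real[OF DERIV_diff[OF D(7) D'(7)]]])
        (rule coefficient_step(2)[OF p D(1-3) D'(1-3) eqs \<delta>[unfolded \<delta>_def]])
    have "((\<lambda>t. w1 * of_real (dA 0)) has_integral complex_of_real (da T) - of_real (da 0)) {0..T}"
      by (rule fundamental_theorem_of_calculus) (use T dera in \<open>auto intro: has_vector_derivative_at_within\<close>)
    then have "mean T (\<lambda>t. w1 * of_real (dA 0)) = 0"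
      using per(2)[of 0] by (auto simp: mean_def dest: integral_unique)
    then have A0: "dA 0 = 0" using v1(2) by (simp add: mean_const[OF T])
    have "(da has_real_derivative 0) (at t)" for t
    proof -
      have "((\<lambda>t. Re (complex_of_real (da t))) has_real_derivative Re (w1 * of_real (dA 0))) (at t)"
        by (rule has_field_derivative_Re[OF dera])
      then show ?thesis using A0 by simp
    qed
    then have da0: "da t = da 0" for t using DERIV_isconst_all by blast
    have "(da has_integral 0 - 0) {0..T}"
      unfolding da_def by (intro has_integral_diff D(6) D'(6)) auto
    moreover have "da = (\<lambda>t. da 0)" using da0 by blast
    ultimately have int0: "((\<lambda>t. da 0) has_integral 0) {0..T}" by simp
    have "((\<lambda>t. da 0) has_integral T * da 0) {0..T}"
      using has_integral_const_real[of "da 0" 0 T] T by simp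
    from has_integral_unique[OF this int0] have "da 0 = 0" using T by simp
    then have "fps_nth (\<alpha> t) (Suc m) = fps_nth (\<alpha>' t) (Suc m)" "fps_nth (A t) (Suc m) = fps_nth (A' t) (Suc m)" for t
      using da0[of t] dA0[of t] A0 by (auto simp: da_def dA_def)
    moreover have "fps_nth C m = fps_nth C' m" using \<delta> by (simp add: \<delta>_def)
    ultimately show ?case using Suc.IH by (auto simp: le_Suc_eq less_Suc_eq)
  qed
  then show ?thesis by (metis fps_ext lessI)
qed

text \<open>
Taking Taylor coefficients in \<open>\<epsilon>\<close> commutes with differentiation in time, and replacing the families by
their Taylor polynomials of degree \<open>n\<close> does not change the coefficient of order \<open>n\<close> of the right hand
sides, since the differences are of order \<open>n + 1\<close>.
\<close>

lemma formal_subharmonic_of_families: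
  fixes a b :: "complex \<Rightarrow> real \<Rightarrow> real \<Rightarrow> complex" and c :: "complex \<Rightarrow> real \<Rightarrow> complex"
  assumes e: "e > 0" and p: "p \<in> P"
    and fam: "param_family e P T a" "param_family e P T b" "param_family e P T (\<lambda>\<epsilon> p t. c \<epsilon> p)"
    and bda: "\<And>\<epsilon> p t. norm \<epsilon> < e \<Longrightarrow> p \<in> P \<Longrightarrow> norm (a \<epsilon> p t) < r / 4"
    and bdb: "\<And>\<epsilon> p t. norm \<epsilon> < e \<Longrightarrow> p \<in> P \<Longrightarrow> norm (b \<epsilon> p t) < r / 4"
    and bdc: "\<And>\<epsilon> p. norm \<epsilon> < e \<Longrightarrow> p \<in> P \<Longrightarrow> norm (c \<epsilon> p) < r / 4"
    and zero: "\<And>p t. p \<in> P \<Longrightarrow> a 0 p t = 0" "\<And>p t. p \<in> P \<Longrightarrow> b 0 p t = 0" "\<And>p. p \<in> P \<Longrightarrow> c 0 p = 0"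
    and dera: "\<And>\<epsilon> p t. norm \<epsilon> < e \<Longrightarrow> p \<in> P \<Longrightarrow>
      (a \<epsilon> p has_vector_derivative v (b \<epsilon> p t) + \<epsilon> * f p t (a \<epsilon> p t) (b \<epsilon> p t) (c \<epsilon> p)) (at t)"
    and derb: "\<And>\<epsilon> p t. norm \<epsilon> < e \<Longrightarrow> p \<in> P \<Longrightarrow>
      (b \<epsilon> p has_vector_derivative \<epsilon> * g p t (a \<epsilon> p t) (b \<epsilon> p t) (c \<epsilon> p)) (at t)"
    and int: "\<And>\<epsilon> p. norm \<epsilon> < e \<Longrightarrow> p \<in> P \<Longrightarrow> integral {0..T} (a \<epsilon> p) = 0"
  shows "formal_subharmonic \<omega> F G q A0 (C0 p) p
     (\<lambda>t. Abs_fps (\<lambda>n. (if n = 0 then \<omega> A0 * t else 0) + Re (taylor_coeff n (\<lambda>\<epsilon>. a \<epsilon> p t))))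
     (\<lambda>t. Abs_fps (\<lambda>n. (if n = 0 then A0 else 0) + Re (taylor_coeff n (\<lambda>\<epsilon>. b \<epsilon> p t))))
     (Abs_fps (\<lambda>n. (if n = 0 then C0 p else 0) + Re (taylor_coeff n (\<lambda>\<epsilon>. c \<epsilon> p))))"
    (is "formal_subharmonic _ _ _ _ _ _ _ ?\<alpha> ?A ?C")
proof -
  have per: "taylor_coeff n (\<lambda>\<epsilon>. h \<epsilon> p (t + T)) = taylor_coeff n (\<lambda>\<epsilon>. h \<epsilon> p t)" if "param_family e P T h" for h n t
    by (rule taylor_coeff_cong[OF e param_familyD(3)[OF that _ p]])
  have real: "of_real (Re (taylor_coeff n (\<lambda>\<epsilon>. h \<epsilon> p t))) = taylor_coeff n (\<lambda>\<epsilon>. h \<epsilon> p t)"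
    if h: "param_family e P T h" for h n t
  proof -
    have "taylor_coeff n (\<lambda>\<epsilon>. h \<epsilon> p t) = of_real (eps_coeff n (\<lambda>x. Re (h (of_real x) p t)))"
      by (rule taylor_coeff_complexification[OF param_familyD(2)[OF h p] e])
        (simp add: of_real_Re param_familyD(4)[OF h _ p])
    then show ?thesis by simp
  qed
  have famRf: "param_family e P T (\<lambda>\<epsilon> p t. v (b \<epsilon> p t) + \<epsilon> * f p t (a \<epsilon> p t) (b \<epsilon> p t) (c \<epsilon> p))"
    and famRg: "param_family e P T (\<lambda>\<epsilon> p t. \<epsilon> * g p t (a \<epsilon> p t) (b \<epsilon> p t) (c \<epsilon> p))"
  proof -
    have bd: "norm (a \<epsilon> p t) < r" "norm (b \<epsilon> p t) < r" "norm (c \<epsilon> p) < r" if "norm \<epsilon> < e" "p \<in> P" for \<epsilon> p t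
      using bda[OF that, of t] bdb[OF that, of t] bdc[OF that] r by linarith+
    have "param_family e P T (\<lambda>\<epsilon> p t. f p t (a \<epsilon> p t) (b \<epsilon> p t) (c \<epsilon> p))"
      by (rule param_family_compose[OF fam_f r real_f fam]) (use bd in auto)
    moreover have "param_family e P T (\<lambda>\<epsilon> p t. v (b \<epsilon> p t))"
      by (rule param_family_compose[OF fam_v r _ fam(1) fam(1) fam(2)]) (use bd real_v in auto)
    ultimately show "param_family e P T (\<lambda>\<epsilon> p t. v (b \<epsilon> p t) + \<epsilon> * f p t (a \<epsilon> p t) (b \<epsilon> p t) (c \<epsilon> p))"
      by (intro param_family_add param_family_mult param_family_eps)
    have "param_family e P T (\<lambda>\<epsilon> p t. g p t (a \<epsilon> p t) (b \<epsilon> p t) (c \<epsilon> p))"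
      by (rule param_family_compose[OF fam_g r real_g fam]) (use bd in auto)
    then show "param_family e P T (\<lambda>\<epsilon> p t. \<epsilon> * g p t (a \<epsilon> p t) (b \<epsilon> p t) (c \<epsilon> p))"
      by (intro param_family_mult param_family_eps)
  qed
  have der_coeff: "((\<lambda>t. taylor_coeff n (\<lambda>\<epsilon>. h \<epsilon> p t)) has_vector_derivative taylor_coeff n (\<lambda>\<epsilon>. h' \<epsilon> p t)) (at t)"
    if h: "param_family e P T h" and h': "param_family e P T h'"
      and der: "\<And>\<epsilon> t. norm \<epsilon> < e \<Longrightarrow> (h \<epsilon> p has_vector_derivative h' \<epsilon> p t) (at t)" for h h' n t
  proof (rule has_vector_derivative_taylor_coeff[where \<phi> = "\<lambda>\<epsilon> t. h \<epsilon> p t" and \<phi>' = "\<lambda>\<epsilon> t. h' \<epsilon> p t", OF e])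
    have "continuous_on (ball 0 e \<times> UNIV) (\<lambda>u. (\<lambda>(\<epsilon>, p, t). h' \<epsilon> p t) (fst u, p, snd u))"
      by (rule continuous_on_compose2[OF param_familyD(1)[OF h']]) (use p in \<open>auto intro!: continuous_intros\<close>)
    then show "continuous_on (ball 0 e \<times> UNIV) (\<lambda>(\<epsilon>, t). h' \<epsilon> p t)" by (simp add: case_prod_beta')
  qed (use param_familyD(2)[OF h p] param_familyD(2)[OF h' p] der in auto)
  have tails: "tail_poly n (fps_nth (?\<alpha> t)) \<epsilon> = (\<Sum>j\<le>n. taylor_coeff j (\<lambda>\<epsilon>. a \<epsilon> p t) * \<epsilon> ^ j)"
      "tail_poly n (fps_nth (?A t)) \<epsilon> = (\<Sum>j\<le>n. taylor_coeff j (\<lambda>\<epsilon>. b \<epsilon> p t) * \<epsilon> ^ j)"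
      "tail_poly n (fps_nth ?C) \<epsilon> = (\<Sum>j\<le>n. taylor_coeff j (\<lambda>\<epsilon>. c \<epsilon> p) * \<epsilon> ^ j)" for n t \<epsilon>
  proof -
    have *: "tail_poly n k \<epsilon> = (\<Sum>j\<le>n. taylor_coeff j (\<lambda>\<epsilon>. h \<epsilon> p t) * \<epsilon> ^ j)"
      if h: "param_family e P T h" and h0: "h 0 p t = 0"
        and k: "\<And>j. j \<ge> 1 \<Longrightarrow> k j = Re (taylor_coeff j (\<lambda>\<epsilon>. h \<epsilon> p t))" for h t k
    proof -
      have "{..n} = insert 0 {1..n}" by auto
      then have "(\<Sum>j\<le>n. taylor_coeff j (\<lambda>\<epsilon>. h \<epsilon> p t) * \<epsilon> ^ j) = (\<Sum>j\<in>{1..n}. taylor_coeff j (\<lambda>\<epsilon>. h \<epsilon> p t) * \<epsilon> ^ j)"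
        using h0 by simp
      also have "\<dots> = tail_poly n k \<epsilon>"
        unfolding tail_poly_def by (rule sum.cong) (use k real[OF h] in auto)
      finally show ?thesis by simp
    qed
    show "tail_poly n (fps_nth (?\<alpha> t)) \<epsilon> = (\<Sum>j\<le>n. taylor_coeff j (\<lambda>\<epsilon>. a \<epsilon> p t) * \<epsilon> ^ j)"
      by (rule *[OF fam(1) zero(1)[OF p]]) simp
    show "tail_poly n (fps_nth (?A t)) \<epsilon> = (\<Sum>j\<le>n. taylor_coeff j (\<lambda>\<epsilon>. b \<epsilon> p t) * \<epsilon> ^ j)"
      by (rule *[OF fam(2) zero(2)[OF p]]) simp
    show "tail_poly n (fps_nth ?C) \<epsilon> = (\<Sum>j\<le>n. taylor_coeff j (\<lambda>\<epsilon>. c \<epsilon> p) * \<epsilon> ^ j)"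
      by (rule *[where h = "\<lambda>\<epsilon> p t. c \<epsilon> p" and t = t, OF fam(3) zero(3)[OF p]]) simp
  qed
  have rhs: "complex_of_real (eps_coeff n (\<lambda>\<epsilon>. \<omega> (fps_trunc n (?A t) \<epsilon>) +
               \<epsilon> * F (fps_trunc n (?\<alpha> t) \<epsilon>) (fps_trunc n (?A t) \<epsilon>) (fps_trunc n ?C \<epsilon>) (t + p)))
      = (if n = 0 then of_real (\<omega> A0) else 0) +
        taylor_coeff n (\<lambda>\<epsilon>. v (b \<epsilon> p t) + \<epsilon> * f p t (a \<epsilon> p t) (b \<epsilon> p t) (c \<epsilon> p))"
    "complex_of_real (eps_coeff n (\<lambda>\<epsilon>. \<epsilon> * G (fps_trunc n (?\<alpha> t) \<epsilon>) (fps_trunc n (?A t) \<epsilon>) (fps_trunc n ?C \<epsilon>) (t + p)))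
      = taylor_coeff n (\<lambda>\<epsilon>. \<epsilon> * g p t (a \<epsilon> p t) (b \<epsilon> p t) (c \<epsilon> p))" for n t
  proof -
    let ?X = "tail_poly n (fps_nth (?\<alpha> t))" and ?Y = "tail_poly n (fps_nth (?A t))" and ?Z = "tail_poly n (fps_nth ?C)"
    note hol = param_familyD(2)[OF fam(1) p, of t] param_familyD(2)[OF fam(2) p, of t] param_familyD(2)[OF fam(3) p]
    obtain Ka where Ka: "Ka \<ge> 0" "\<And>x. norm x < e / 2 \<Longrightarrow> norm (a x p t - ?X x) \<le> Ka * norm x ^ Suc n"
      unfolding tails using taylor_remainder[OF hol(1) e, of n] by blast
    obtain Kb where Kb: "Kb \<ge> 0" "\<And>x. norm x < e / 2 \<Longrightarrow> norm (b x p t - ?Y x) \<le> Kb * norm x ^ Suc n"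
      unfolding tails using taylor_remainder[OF hol(2) e, of n] by blast
    obtain Kc where Kc: "Kc \<ge> 0" "\<And>x. norm x < e / 2 \<Longrightarrow> norm (c x p - ?Z x) \<le> Kc * norm x ^ Suc n"
      unfolding tails using taylor_remainder[OF hol(3) e, of n] by blast
    obtain La where La: "La \<ge> 0" "\<And>x. norm x < e / 2 \<Longrightarrow> norm (a x p t) \<le> La * norm x"
      using taylor_remainder[OF hol(1) e, of 0] zero[OF p] by auto
    obtain Lb where Lb: "Lb \<ge> 0" "\<And>x. norm x < e / 2 \<Longrightarrow> norm (b x p t) \<le> Lb * norm x"
      using taylor_remainder[OF hol(2) e, of 0] zero[OF p] by auto
    obtain Lc where Lc: "Lc \<ge> 0" "\<And>x. norm x < e / 2 \<Longrightarrow> norm (c x p) \<le> Lc * norm x"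
      using taylor_remainder[OF hol(3) e, of 0] zero[OF p] by auto
    define N where "N = (\<lambda>\<phi>. \<Sum>k\<in>{1..n}. \<bar>fps_nth \<phi> k\<bar> :: real)"
    have N0: "N \<phi> \<ge> 0" for \<phi> by (simp add: N_def sum_nonneg)
    define M where "M = 1 + Ka + Kb + Kc + La + Lb + Lc + N (?\<alpha> t) + N (?A t) + N ?C"
    have M: "M > 0" and KM: "Ka \<le> M" "Kb \<le> M" "Kc \<le> M" "La \<le> M" "Lb \<le> M" "Lc \<le> M"
      and NM: "N (?\<alpha> t) \<le> M" "N (?A t) \<le> M" "N ?C \<le> M"
      using Ka(1) Kb(1) Kc(1) La(1) Lb(1) Lc(1) N0[of "?\<alpha> t"] N0[of "?A t"] N0[of ?C]
      unfolding M_def by linarith+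
    define e' where "e' = min (min 1 (e / 2)) (r / (4 * M))"
    have e': "e' > 0" "e' \<le> 1" "e' \<le> e / 2" "M * e' \<le> r / 4"
    proof -
      show "e' > 0" "e' \<le> 1" "e' \<le> e / 2" using M r e by (auto simp: e'_def)
      have "M * e' \<le> M * (r / (4 * M))" using M by (intro mult_left_mono) (auto simp: e'_def)
      then show "M * e' \<le> r / 4" using M by simp
    qed
    have sm: "small e' M (tail_poly n (fps_nth \<phi>))" if "N \<phi> \<le> M" for \<phi>
      using that e' M by (intro small_tail_poly) (simp_all add: N_def)
    note s = sm[OF NM(1)] sm[OF NM(2)] sm[OF NM(3)]
    have sub: "ball 0 e' \<subseteq> ball (0::complex) e" using e' e by auto
    have weaken: "norm y \<le> M * norm x ^ k" if "norm y \<le> K * norm x ^ j" "k \<le> j" "K \<le> M" "K \<ge> 0" "norm x < e'"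
      for x y :: complex and K j k
    proof -
      have "K * norm x ^ j \<le> M * norm x ^ k"
        using that e' by (intro mult_mono power_decreasing) auto
      with that(1) show ?thesis by linarith
    qed
    have s': "small e' M (\<lambda>\<epsilon>. a \<epsilon> p t)" "small e' M (\<lambda>\<epsilon>. b \<epsilon> p t)" "small e' M (\<lambda>\<epsilon>. c \<epsilon> p)"
    proof -
      show "small e' M (\<lambda>\<epsilon>. a \<epsilon> p t)" unfolding small_def
        using holomorphic_on_subset[OF hol(1) sub] bda[OF _ p] La KM e' e
          weaken[of "a x p t" La x 1 1 for x] by auto
      show "small e' M (\<lambda>\<epsilon>. b \<epsilon> p t)" unfolding small_def
        using holomorphic_on_subset[OF hol(2) sub] bdb[OF _ p] Lb KM e' e
          weaken[of "b x p t" Lb x 1 1 for x] by auto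
      show "small e' M (\<lambda>\<epsilon>. c \<epsilon> p)" unfolding small_def
        using holomorphic_on_subset[OF hol(3) sub] bdc[OF _ p] Lc KM e' e
          weaken[of "c x p" Lc x 1 1 for x] by auto
    qed
    have R: "taylor_coeff n (Rf p t (\<lambda>\<epsilon>. a \<epsilon> p t) (\<lambda>\<epsilon>. b \<epsilon> p t) (\<lambda>\<epsilon>. c \<epsilon> p)) = taylor_coeff n (Rf p t ?X ?Y ?Z)"
      "taylor_coeff n (Rg p t (\<lambda>\<epsilon>. a \<epsilon> p t) (\<lambda>\<epsilon>. b \<epsilon> p t) (\<lambda>\<epsilon>. c \<epsilon> p)) = taylor_coeff n (Rg p t ?X ?Y ?Z)"
    proof -
      show "taylor_coeff n (Rf p t (\<lambda>\<epsilon>. a \<epsilon> p t) (\<lambda>\<epsilon>. b \<epsilon> p t) (\<lambda>\<epsilon>. c \<epsilon> p)) = taylor_coeff n (Rf p t ?X ?Y ?Z)"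
      proof (cases n)
        case 0
        then show ?thesis using small_0[OF s(2) e'(1)] zero[OF p] by (simp add: Rf_def)
      next
        case (Suc m)
        have "taylor_coeff (Suc m) (Rf p t (\<lambda>\<epsilon>. a \<epsilon> p t) (\<lambda>\<epsilon>. b \<epsilon> p t) (\<lambda>\<epsilon>. c \<epsilon> p))
          - taylor_coeff (Suc m) (Rf p t ?X ?Y ?Z) = w1 * 0"
        proof (rule Rf_coeff_diff[OF p e'(1) _ s' s])
          fix \<epsilon> :: complex assume \<epsilon>: "norm \<epsilon> < e'"
          then have \<epsilon>2: "norm \<epsilon> < e / 2" using e' by simp
          show "norm (a \<epsilon> p t - ?X \<epsilon>) \<le> M * norm \<epsilon> ^ Suc m"
            by (rule weaken[OF Ka(2)[OF \<epsilon>2] _ KM(1) Ka(1) \<epsilon>]) (simp add: Suc)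
          show "norm (b \<epsilon> p t - ?Y \<epsilon> - 0 * \<epsilon> ^ Suc m) \<le> M * norm \<epsilon> ^ Suc (Suc m)"
            using weaken[OF Kb(2)[OF \<epsilon>2] _ KM(2) Kb(1) \<epsilon>, of "Suc (Suc m)"] by (simp add: Suc)
          show "norm (c \<epsilon> p - ?Z \<epsilon>) \<le> M * norm \<epsilon> ^ Suc m"
            by (rule weaken[OF Kc(2)[OF \<epsilon>2] _ KM(3) Kc(1) \<epsilon>]) (simp add: Suc)
        qed (use M in simp)
        then show ?thesis by (simp add: Suc)
      qed
      show "taylor_coeff n (Rg p t (\<lambda>\<epsilon>. a \<epsilon> p t) (\<lambda>\<epsilon>. b \<epsilon> p t) (\<lambda>\<epsilon>. c \<epsilon> p)) = taylor_coeff n (Rg p t ?X ?Y ?Z)"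
      proof (cases n)
        case 0
        then show ?thesis by (simp add: Rg_def)
      next
        case (Suc m)
        have "taylor_coeff (Suc m) (Rg p t (\<lambda>\<epsilon>. a \<epsilon> p t) (\<lambda>\<epsilon>. b \<epsilon> p t) (\<lambda>\<epsilon>. c \<epsilon> p))
          - taylor_coeff (Suc m) (Rg p t ?X ?Y ?Z) = 0 * deriv (\<lambda>z. g p t 0 0 z) 0"
        proof (rule Rg_coeff_diff[OF p e'(1) _ s' s])
          fix \<epsilon> :: complex assume \<epsilon>: "norm \<epsilon> < e'"
          then have \<epsilon>2: "norm \<epsilon> < e / 2" using e' by simp
          show "norm (a \<epsilon> p t - ?X \<epsilon>) \<le> M * norm \<epsilon> ^ Suc m"
            by (rule weaken[OF Ka(2)[OF \<epsilon>2] _ KM(1) Ka(1) \<epsilon>]) (simp add: Suc)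
          show "norm (b \<epsilon> p t - ?Y \<epsilon>) \<le> M * norm \<epsilon> ^ Suc m"
            by (rule weaken[OF Kb(2)[OF \<epsilon>2] _ KM(2) Kb(1) \<epsilon>]) (simp add: Suc)
          show "norm (c \<epsilon> p - ?Z \<epsilon> - 0 * \<epsilon> ^ m) \<le> M * norm \<epsilon> ^ Suc m"
            using weaken[OF Kc(2)[OF \<epsilon>2] _ KM(3) Kc(1) \<epsilon>, of "Suc m"] by (simp add: Suc)
        qed (use M in simp)
        then show ?thesis by (simp add: Suc)
      qed
    qed
    have nth0: "fps_nth (?\<alpha> t) 0 = \<omega> A0 * t" "fps_nth (?A t) 0 = A0" "fps_nth ?C 0 = C0 p"
      using zero[OF p] by simp_all
    note E = eps_coeff_rhs[OF p e'(1) nth0 s]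
    show "complex_of_real (eps_coeff n (\<lambda>\<epsilon>. \<omega> (fps_trunc n (?A t) \<epsilon>) +
               \<epsilon> * F (fps_trunc n (?\<alpha> t) \<epsilon>) (fps_trunc n (?A t) \<epsilon>) (fps_trunc n ?C \<epsilon>) (t + p)))
      = (if n = 0 then of_real (\<omega> A0) else 0) +
        taylor_coeff n (\<lambda>\<epsilon>. v (b \<epsilon> p t) + \<epsilon> * f p t (a \<epsilon> p t) (b \<epsilon> p t) (c \<epsilon> p))"
      unfolding E(1) R(1)[symmetric] unfolding Rf_def ..
    show "complex_of_real (eps_coeff n (\<lambda>\<epsilon>. \<epsilon> * G (fps_trunc n (?\<alpha> t) \<epsilon>) (fps_trunc n (?A t) \<epsilon>) (fps_trunc n ?C \<epsilon>) (t + p)))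
      = taylor_coeff n (\<lambda>\<epsilon>. \<epsilon> * g p t (a \<epsilon> p t) (b \<epsilon> p t) (c \<epsilon> p))"
      unfolding E(2) R(2)[symmetric] unfolding Rg_def ..
  qed
  have der\<alpha>: "((\<lambda>s. fps_nth (?\<alpha> s) n) has_real_derivative eps_coeff n (\<lambda>\<epsilon>. \<omega> (fps_trunc n (?A t) \<epsilon>) +
               \<epsilon> * F (fps_trunc n (?\<alpha> t) \<epsilon>) (fps_trunc n (?A t) \<epsilon>) (fps_trunc n ?C \<epsilon>) (t + p))) (at t)" for n t
  proof -
    have "((\<lambda>s. Re (taylor_coeff n (\<lambda>\<epsilon>. a \<epsilon> p s))) has_real_derivative
        Re (taylor_coeff n (\<lambda>\<epsilon>. v (b \<epsilon> p t) + \<epsilon> * f p t (a \<epsilon> p t) (b \<epsilon> p t) (c \<epsilon> p)))) (at t)"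
      by (rule has_field_derivative_Re[OF der_coeff[OF fam(1) famRf dera[OF _ p]]])
    moreover have "((\<lambda>s. if n = 0 then \<omega> A0 * s else 0) has_real_derivative (if n = 0 then \<omega> A0 else 0)) (at t)"
      by (auto intro!: derivative_eq_intros)
    ultimately have "((\<lambda>s. (if n = 0 then \<omega> A0 * s else 0) + Re (taylor_coeff n (\<lambda>\<epsilon>. a \<epsilon> p s))) has_real_derivative
        (if n = 0 then \<omega> A0 else 0) + Re (taylor_coeff n (\<lambda>\<epsilon>. v (b \<epsilon> p t) + \<epsilon> * f p t (a \<epsilon> p t) (b \<epsilon> p t) (c \<epsilon> p)))) (at t)"
      by (rule DERIV_add[rotated])
    moreover have "(if n = 0 then \<omega> A0 else 0) + Re (taylor_coeff n (\<lambda>\<epsilon>. v (b \<epsilon> p t) + \<epsilon> * f p t (a \<epsilon> p t) (b \<epsilon> p t) (c \<epsilon> p)))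
       = Re (of_real (eps_coeff n (\<lambda>\<epsilon>. \<omega> (fps_trunc n (?A t) \<epsilon>) +
               \<epsilon> * F (fps_trunc n (?\<alpha> t) \<epsilon>) (fps_trunc n (?A t) \<epsilon>) (fps_trunc n ?C \<epsilon>) (t + p))))"
      unfolding rhs by simp
    ultimately show ?thesis by (simp only: Re_complex_of_real fps_nth_Abs_fps)
  qed
  have derA: "((\<lambda>s. fps_nth (?A s) n) has_real_derivative eps_coeff n (\<lambda>\<epsilon>.
               \<epsilon> * G (fps_trunc n (?\<alpha> t) \<epsilon>) (fps_trunc n (?A t) \<epsilon>) (fps_trunc n ?C \<epsilon>) (t + p))) (at t)" for n t
  proof -
    have "((\<lambda>s. Re (taylor_coeff n (\<lambda>\<epsilon>. b \<epsilon> p s))) has_real_derivative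
        Re (taylor_coeff n (\<lambda>\<epsilon>. \<epsilon> * g p t (a \<epsilon> p t) (b \<epsilon> p t) (c \<epsilon> p)))) (at t)"
      by (rule has_field_derivative_Re[OF der_coeff[OF fam(2) famRg derb[OF _ p]]])
    from DERIV_add[OF DERIV_const this, of "if n = 0 then A0 else 0"]
    have "((\<lambda>s. (if n = 0 then A0 else 0) + Re (taylor_coeff n (\<lambda>\<epsilon>. b \<epsilon> p s))) has_real_derivative
        Re (taylor_coeff n (\<lambda>\<epsilon>. \<epsilon> * g p t (a \<epsilon> p t) (b \<epsilon> p t) (c \<epsilon> p)))) (at t)" by simp
    then show ?thesis unfolding rhs(2)[symmetric] by (simp only: Re_complex_of_real fps_nth_Abs_fps)
  qed
  have int_coeff: "((\<lambda>t. fps_nth (?\<alpha> t) k) has_integral 0) {0..T}" if "k \<ge> 1" for k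
  proof -
    \<comment> \<open>A periodic family whose time derivative is \<open>a\<close>; its coefficients are periodic primitives of those of \<open>a\<close>.\<close>
    define H where "H = (\<lambda>\<epsilon> p t. periodic_primitive T (a \<epsilon> p) t)"
    have H: "param_family e P T H"
      unfolding H_def by (rule param_family_periodic_primitive[OF fam(1) T])
    have "(H \<epsilon> p has_vector_derivative a \<epsilon> p t) (at t)" if "norm \<epsilon> < e" for \<epsilon> t
      using periodic_primitive_properties(1)[OF T param_family_continuous_time[OF fam(1) that p]
          param_familyD(3)[OF fam(1) that p], of t] int[OF that p]
      by (simp add: H_def mean_def)
    note der = der_coeff[OF H fam(1) this]
    have "((\<lambda>t. Re (taylor_coeff k (\<lambda>\<epsilon>. a \<epsilon> p t))) has_integral
        Re (taylor_coeff k (\<lambda>\<epsilon>. H \<epsilon> p T)) - Re (taylor_coeff k (\<lambda>\<epsilon>. H \<epsilon> p 0))) {0..T}"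
    proof (rule fundamental_theorem_of_calculus)
      fix t
      show "((\<lambda>t. Re (taylor_coeff k (\<lambda>\<epsilon>. H \<epsilon> p t))) has_vector_derivative Re (taylor_coeff k (\<lambda>\<epsilon>. a \<epsilon> p t))) (at t within {0..T})"
        using has_field_derivative_Re[OF der[of k t]]
        by (simp add: has_real_derivative_iff_has_vector_derivative has_vector_derivative_at_within)
    qed (use T in simp)
    moreover have "taylor_coeff k (\<lambda>\<epsilon>. H \<epsilon> p T) = taylor_coeff k (\<lambda>\<epsilon>. H \<epsilon> p 0)"
      using per[OF H, of k 0] by simp
    ultimately show ?thesis using that by simp
  qed
  show ?thesis
    unfolding formal_subharmonic_def Let_def Tq[symmetric]
  proof (intro conjI allI impI)
    fix k :: nat assume k: "1 \<le> k"
    show "periodic_with T (\<lambda>t. fps_nth (?\<alpha> t) k)" "periodic_with T (\<lambda>t. fps_nth (?A t) k)"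
      using k per[OF fam(1)] per[OF fam(2)] by (simp_all add: periodic_with_def)
    show "((\<lambda>t. fps_nth (?\<alpha> t) k) has_integral 0) {0..T}" by (rule int_coeff[OF k])
  qed (use zero[OF p] der\<alpha> derA in simp_all)
qed

end

section \<open>From families of solutions to subharmonic solutions\<close>

lemma (in melnikov_setup) exists_families:
  assumes "P \<noteq> {}"
  obtains e :: real and a b :: "complex \<Rightarrow> real \<Rightarrow> real \<Rightarrow> complex" and c :: "complex \<Rightarrow> real \<Rightarrow> complex"
  where "e > 0" "param_family e P T a" "param_family e P T b" "param_family e P T (\<lambda>\<epsilon> p t. c \<epsilon> p)"
    "\<And>\<epsilon> p t. norm \<epsilon> < e \<Longrightarrow> p \<in> P \<Longrightarrow> norm (a \<epsilon> p t) < r / 4"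
    "\<And>\<epsilon> p t. norm \<epsilon> < e \<Longrightarrow> p \<in> P \<Longrightarrow> norm (b \<epsilon> p t) < r / 4"
    "\<And>\<epsilon> p. norm \<epsilon> < e \<Longrightarrow> p \<in> P \<Longrightarrow> norm (c \<epsilon> p) < r / 4"
    "\<And>p t. p \<in> P \<Longrightarrow> a 0 p t = 0" "\<And>p t. p \<in> P \<Longrightarrow> b 0 p t = 0" "\<And>p. p \<in> P \<Longrightarrow> c 0 p = 0"
    "\<And>\<epsilon> p t. norm \<epsilon> < e \<Longrightarrow> p \<in> P \<Longrightarrow>
      (a \<epsilon> p has_vector_derivative v (b \<epsilon> p t) + \<epsilon> * f p t (a \<epsilon> p t) (b \<epsilon> p t) (c \<epsilon> p)) (at t)"
    "\<And>\<epsilon> p t. norm \<epsilon> < e \<Longrightarrow> p \<in> P \<Longrightarrow>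
      (b \<epsilon> p has_vector_derivative \<epsilon> * g p t (a \<epsilon> p t) (b \<epsilon> p t) (c \<epsilon> p)) (at t)"
    "\<And>\<epsilon> p. norm \<epsilon> < e \<Longrightarrow> p \<in> P \<Longrightarrow> integral {0..T} (a \<epsilon> p) = 0"
proof -
  obtain p where p: "p \<in> P" using assms by blast
  have B: "B \<ge> 0" by (rule B_nonneg[OF p])
  obtain m where m: "m > 0" "\<And>p. p \<in> P \<Longrightarrow> norm (\<mu> p) \<ge> m" using \<mu>_bounded_below by blast
  have K: "4 * B / r \<ge> 0" "32 * B / r\<^sup>2 \<ge> 0" "norm w1 > 0" using B r v1 by auto
  obtain L \<rho> e where c: "L \<ge> 1" "\<rho> > 0" "e > 0" "L * \<rho> < r / 4"
    "T * (4 * B / r / L + 3 * e * (4 * B / r) * L) \<le> 1 / 2"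
    "2 * (32 * B / r\<^sup>2) * \<rho> / norm w1 + 3 * e * (4 * B / r) * L\<^sup>2 / norm w1 + 3 * e * T * (4 * B / r) * L\<^sup>2 \<le> 1 / 2"
    "(2 * (4 * B / r) + 4 * (32 * B / r\<^sup>2) * L\<^sup>2 * \<rho>) / (L * m) \<le> 1 / 2"
    "T * e * B \<le> \<rho> / 2" "L * (e * B / norm w1 + e * T * B) \<le> \<rho> / 2"
    using contraction_constants[OF K(1,2) B T K(3) m(1) r] by blast
  interpret contraction_setup P T r B f g v w1 m L \<rho> e "4 * B / r" "32 * B / r\<^sup>2"
    by unfold_locales (fact m B c refl)+
  show ?thesis
    by (rule periodic_solution_families, rule that[OF c(3)]) (assumption | blast)+
qed

context subharmonic_setup
begin

lemma C_coeff_eq: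
  assumes "formal_subharmonic \<omega> F G q A0 (C0 p) p \<alpha> A C" and p: "p \<in> P"
  shows "C_coeff \<omega> F G q A0 C0 n p = fps_nth C n"
proof -
  have "(THE C. \<exists>\<alpha> A. formal_subharmonic \<omega> F G q A0 (C0 p) p \<alpha> A C) = C"
    by (rule the_equality) (use assms formal_subharmonic_unique[OF p] in blast)+
  then show ?thesis by (simp add: C_coeff_def)
qed

text \<open>
The families count time from the phase \<open>p\<close>; the shift by \<open>p\<close> returns to the time of the system.
\<close>

lemma periodic_solution_of_families:
  fixes a b :: "complex \<Rightarrow> real \<Rightarrow> real \<Rightarrow> complex" and c :: "complex \<Rightarrow> real \<Rightarrow> complex" and s :: real
  assumes p: "p \<in> P" and s: "\<bar>s\<bar> < e" and l: "\<omega> A0 = of_int l / of_int q"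
    and W: "\<And>y. \<bar>y\<bar> < r \<Longrightarrow> A0 + y \<in> W"
    and fam: "param_family e P T a" "param_family e P T b" "param_family e P T (\<lambda>\<epsilon> p t. c \<epsilon> p)"
    and bda: "\<And>\<epsilon> p t. norm \<epsilon> < e \<Longrightarrow> p \<in> P \<Longrightarrow> norm (a \<epsilon> p t) < r / 4"
    and bdb: "\<And>\<epsilon> p t. norm \<epsilon> < e \<Longrightarrow> p \<in> P \<Longrightarrow> norm (b \<epsilon> p t) < r / 4"
    and bdc: "\<And>\<epsilon> p. norm \<epsilon> < e \<Longrightarrow> p \<in> P \<Longrightarrow> norm (c \<epsilon> p) < r / 4"
    and dera: "\<And>\<epsilon> p t. norm \<epsilon> < e \<Longrightarrow> p \<in> P \<Longrightarrow>
      (a \<epsilon> p has_vector_derivative v (b \<epsilon> p t) + \<epsilon> * f p t (a \<epsilon> p t) (b \<epsilon> p t) (c \<epsilon> p)) (at t)"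
    and derb: "\<And>\<epsilon> p t. norm \<epsilon> < e \<Longrightarrow> p \<in> P \<Longrightarrow>
      (b \<epsilon> p has_vector_derivative \<epsilon> * g p t (a \<epsilon> p t) (b \<epsilon> p t) (c \<epsilon> p)) (at t)"
  shows "periodic_solution W \<omega> F G l q s (C0 p + Re (c (of_real s) p))
     (\<lambda>t. \<omega> A0 * (t - p) + Re (a (of_real s) p (t - p))) (\<lambda>t. A0 + Re (b (of_real s) p (t - p)))"
    (is "periodic_solution _ _ _ _ _ _ _ ?C ?\<alpha> ?A")
proof -
  let ?s = "complex_of_real s"
  have s': "norm ?s < e" using s by simp
  have re: "a ?s p t = of_real (Re (a ?s p t))" "b ?s p t = of_real (Re (b ?s p t))" "c ?s p = of_real (Re (c ?s p))" for t
    using fam[THEN param_familyD(4), OF s' p] by (simp_all add: of_real_Re)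
  have bd: "\<bar>Re (a ?s p t)\<bar> < r" "\<bar>Re (b ?s p t)\<bar> < r" "\<bar>Re (c ?s p)\<bar> < r" for t
    using bda[OF s' p, of t] bdb[OF s' p, of t] bdc[OF s' p] r
      abs_Re_le_cmod[of "a ?s p t"] abs_Re_le_cmod[of "b ?s p t"] abs_Re_le_cmod[of "c ?s p"] by linarith+
  have fF: "f p t (a ?s p t) (b ?s p t) (c ?s p)
      = of_real (F (\<omega> A0 * t + Re (a ?s p t)) (A0 + Re (b ?s p t)) (C0 p + Re (c ?s p)) (t + p))" for t
    by (subst re(1), subst re(2), subst re(3)) (rule f_eq[OF p bd])
  have gG: "g p t (a ?s p t) (b ?s p t) (c ?s p)
      = of_real (G (\<omega> A0 * t + Re (a ?s p t)) (A0 + Re (b ?s p t)) (C0 p + Re (c ?s p)) (t + p))" for t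
    by (subst re(1), subst re(2), subst re(3)) (rule g_eq[OF p bd])
  have v\<omega>: "v (b ?s p t) = of_real (\<omega> (A0 + Re (b ?s p t)) - \<omega> A0)" for t
    by (subst re(2)) (rule v_eq[OF bd(2)])
  have da: "((\<lambda>t. Re (a ?s p (t - p))) has_real_derivative
      \<omega> (?A t) - \<omega> A0 + s * F (?\<alpha> t) (?A t) ?C t) (at t)" for t
    using DERIV_shift[of "\<lambda>t. Re (a ?s p t)" _ t "- p"]
      has_field_derivative_Re[OF dera[OF s' p, of "t - p"]] by (simp add: fF v\<omega>)
  have db: "((\<lambda>t. Re (b ?s p (t - p))) has_real_derivative s * G (?\<alpha> t) (?A t) ?C t) (at t)" for t
    using DERIV_shift[of "\<lambda>t. Re (b ?s p t)" _ t "- p"]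
      has_field_derivative_Re[OF derb[OF s' p, of "t - p"]] by (simp add: gG)
  have "(?\<alpha> has_real_derivative \<omega> (?A t) + s * F (?\<alpha> t) (?A t) ?C t) (at t)" for t
  proof -
    have "((\<lambda>t. \<omega> A0 * (t - p)) has_real_derivative \<omega> A0) (at t)"
      by (auto intro!: derivative_eq_intros)
    from DERIV_add[OF this da] show ?thesis by simp
  qed
  moreover have "(?A has_real_derivative s * G (?\<alpha> t) (?A t) ?C t) (at t)" for t
    using DERIV_add[OF DERIV_const db] by simp
  moreover have "?A t \<in> W" for t by (rule W[OF bd(2)])
  ultimately have "system_solution W \<omega> F G s ?C ?\<alpha> ?A"
    unfolding system_solution_def by blast
  moreover have sh: "h ?s p (t + T - p) = h ?s p (t - p)" if "param_family e P T h" for h t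
    using param_familyD(3)[OF that s' p, of "t - p"] by (simp add: algebra_simps)
  have "periodic_with (2 * pi * of_int q) ?A"
    unfolding periodic_with_def Tq[symmetric] by (simp add: sh[OF fam(2)])
  moreover have "periodic_with (2 * pi * of_int q) (\<lambda>t. ?\<alpha> t - of_int l / of_int q * t)"
    unfolding periodic_with_def Tq[symmetric] l[symmetric] by (simp add: sh[OF fam(1)] algebra_simps)
  ultimately show ?thesis unfolding periodic_solution_def by blast
qed

end

section \<open>Periodicity of the formal coefficients in the phase\<close>

lemma fps_trunc_eventually_in:
  assumes "open W" "fps_nth \<phi> 0 \<in> W"
  shows "eventually (\<lambda>\<epsilon>. fps_trunc n \<phi> \<epsilon> \<in> W) (nhds 0)"
proof -
  have "continuous_on UNIV (fps_trunc n \<phi>)"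
    unfolding fps_trunc_def[abs_def] by (intro continuous_intros)
  then have "open (fps_trunc n \<phi> -` W)" using assms(1) by (simp add: continuous_on_open_vimage)
  moreover have "fps_trunc n \<phi> 0 = fps_nth \<phi> 0"
  proof -
    have "{..n} = insert 0 {1..n}" by auto
    then show ?thesis by (simp add: fps_trunc_def)
  qed
  ultimately have "eventually (\<lambda>\<epsilon>. \<epsilon> \<in> fps_trunc n \<phi> -` W) (nhds 0)"
    using assms(2) by (intro eventually_nhds_in_open) auto
  then show ?thesis by simp
qed

text \<open>
The periodicity of \<open>F\<close> and \<open>G\<close> is available for actions in \<open>W\<close>; the truncated series stay there for
small \<open>\<epsilon>\<close>, which is enough for Taylor coefficients at \<open>0\<close>.
\<close>

lemma formal_subharmonic_shift:
  assumes W: "open W" "A0 \<in> W"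
    and F: "\<And>\<alpha> A C t. A \<in> W \<Longrightarrow> F \<alpha> A C (t + d) = F \<alpha> A C t"
    and G: "\<And>\<alpha> A C t. A \<in> W \<Longrightarrow> G \<alpha> A C (t + d) = G \<alpha> A C t"
    and S: "formal_subharmonic \<omega> F G q A0 c0 t0 \<alpha> A C"
  shows "formal_subharmonic \<omega> F G q A0 c0 (t0 + d) \<alpha> A C"
proof -
  have A: "fps_nth (A t) 0 = A0" for t using S by (simp add: formal_subharmonic_def Let_def)
  have ev: "eventually (\<lambda>\<epsilon>. fps_trunc n (A t) \<epsilon> \<in> W) (nhds 0)" for n t
    by (rule fps_trunc_eventually_in[OF W(1)]) (simp add: A W)
  have eqF: "eps_coeff n (\<lambda>\<epsilon>. \<omega> (fps_trunc n (A t) \<epsilon>) +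
      \<epsilon> * F (fps_trunc n (\<alpha> t) \<epsilon>) (fps_trunc n (A t) \<epsilon>) (fps_trunc n C \<epsilon>) (t + (t0 + d)))
    = eps_coeff n (\<lambda>\<epsilon>. \<omega> (fps_trunc n (A t) \<epsilon>) +
      \<epsilon> * F (fps_trunc n (\<alpha> t) \<epsilon>) (fps_trunc n (A t) \<epsilon>) (fps_trunc n C \<epsilon>) (t + t0))" for n t
    unfolding eps_coeff_def
    by (rule arg_cong[where f = "\<lambda>x. x / fact n"], rule higher_deriv_cong_ev)
      (use ev[of n t] F in \<open>auto elim!: eventually_mono simp: add.assoc[symmetric]\<close>)
  have eqG: "eps_coeff n (\<lambda>\<epsilon>. \<epsilon> * G (fps_trunc n (\<alpha> t) \<epsilon>) (fps_trunc n (A t) \<epsilon>) (fps_trunc n C \<epsilon>) (t + (t0 + d)))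
    = eps_coeff n (\<lambda>\<epsilon>. \<epsilon> * G (fps_trunc n (\<alpha> t) \<epsilon>) (fps_trunc n (A t) \<epsilon>) (fps_trunc n C \<epsilon>) (t + t0))" for n t
    unfolding eps_coeff_def
    by (rule arg_cong[where f = "\<lambda>x. x / fact n"], rule higher_deriv_cong_ev)
      (use ev[of n t] G in \<open>auto elim!: eventually_mono simp: add.assoc[symmetric]\<close>)
  show ?thesis using S unfolding formal_subharmonic_def Let_def eqF eqG .
qed

lemma C_coeff_periodic:
  assumes W: "open W" "A0 \<in> W"
    and F: "\<And>\<alpha> A C t. A \<in> W \<Longrightarrow> F \<alpha> A C (t + d) = F \<alpha> A C t"
    and G: "\<And>\<alpha> A C t. A \<in> W \<Longrightarrow> G \<alpha> A C (t + d) = G \<alpha> A C t"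
    and C0: "C0 (t0 + d) = C0 t0"
  shows "C_coeff \<omega> F G q A0 C0 k (t0 + d) = C_coeff \<omega> F G q A0 C0 k t0"
proof -
  have F': "F \<alpha> A C (t + - d) = F \<alpha> A C t" and G': "G \<alpha> A C (t + - d) = G \<alpha> A C t" if "A \<in> W" for \<alpha> A C t
    using F[OF that, of \<alpha> C "t + - d"] G[OF that, of \<alpha> C "t + - d"] by simp_all
  have "formal_subharmonic \<omega> F G q A0 (C0 t0) (t0 + d) \<alpha> A C \<longleftrightarrow> formal_subharmonic \<omega> F G q A0 (C0 t0) t0 \<alpha> A C" for \<alpha> A C
  proof
    assume "formal_subharmonic \<omega> F G q A0 (C0 t0) (t0 + d) \<alpha> A C"
    then have "formal_subharmonic \<omega> F G q A0 (C0 t0) (t0 + d + - d) \<alpha> A C"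
      by (rule formal_subharmonic_shift[where F = F and G = G and W = W and d = "- d", rotated 4])
        (rule W, rule W, erule F', erule G')
    then show "formal_subharmonic \<omega> F G q A0 (C0 t0) t0 \<alpha> A C" by simp
  qed (rule formal_subharmonic_shift[where F = F and G = G and W = W and d = d],
      rule W, rule W, erule F, erule G, assumption)
  then show ?thesis by (simp add: C_coeff_def C0)
qed

section \<open>Complexification of the given system\<close>

lemma real_analytic_on_cong:
  assumes "real_analytic_on f S" "open S" "\<And>x. x \<in> S \<Longrightarrow> f x = g x"
  shows "real_analytic_on g S"
  unfolding real_analytic_on_def
proof
  fix x assume x: "x \<in> S"
  then obtain r c where r: "r > 0" and hs: "\<forall>y\<in>ball x r.
     ((\<lambda>m. c m * (\<Prod>b\<in>Basis. ((y - x) \<bullet> b) ^ m b)) has_sum f y) (Basis \<rightarrow>\<^sub>E UNIV)"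
    using assms(1) unfolding real_analytic_on_def by meson
  obtain r' where r': "r' > 0" "ball x r' \<subseteq> S" using assms(2) x open_contains_ball by blast
  show "\<exists>r>0. \<exists>c. \<forall>y\<in>ball x r.
     ((\<lambda>m. c m * (\<Prod>b\<in>Basis. ((y - x) \<bullet> b) ^ m b)) has_sum g y) (Basis \<rightarrow>\<^sub>E UNIV)"
  proof (intro exI[of _ "min r r'"] exI[of _ c] conjI ballI)
    fix y assume y: "y \<in> ball x (min r r')"
    then have "f y = g y" using r' by (intro assms(3)) auto
    moreover have "y \<in> ball x r" using y by simp
    ultimately show "((\<lambda>m. c m * (\<Prod>b\<in>Basis. ((y - x) \<bullet> b) ^ m b)) has_sum g y) (Basis \<rightarrow>\<^sub>E UNIV)"
      using hs by metis
  qed (use r r' in auto)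
qed

lemma real_analytic_on_imp_continuous_on:
  fixes f :: "'a::euclidean_space \<Rightarrow> real"
  assumes an: "real_analytic_on f S" and S: "open S"
  shows "continuous_on S f"
proof (rule continuous_on_locally)
  fix x assume x: "x \<in> S"
  obtain \<rho> c where \<rho>: "\<rho> > 0" "power_summable c \<rho>" and
    ev: "\<And>y. (\<And>b. b \<in> Basis \<Longrightarrow> \<bar>y \<bullet> b\<bar> \<le> \<rho>) \<Longrightarrow> x + y \<in> S \<and> power_sum c (\<lambda>b. of_real (y \<bullet> b)) = of_real (f (x + y))"
    using real_analytic_on_power_sum[OF an S x] by metis
  have le: "\<bar>(y - x) \<bullet> b\<bar> \<le> \<rho>" if "y \<in> ball x \<rho>" "b \<in> Basis" for y b
    using Basis_le_norm[OF that(2), of "y - x"] that(1) by (simp add: dist_norm norm_minus_commute)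
  have "continuous_on (S \<inter> ball x \<rho>) (\<lambda>y. Re (power_sum c (\<lambda>b. of_real ((y - x) \<bullet> b))))"
    by (intro continuous_on_Re continuous_on_power_sum[OF \<rho>(2)] continuous_intros) (use le in auto)
  moreover have "Re (power_sum c (\<lambda>b. of_real ((y - x) \<bullet> b))) = f y" if "y \<in> S \<inter> ball x \<rho>" for y
    using ev[of "y - x"] le that by simp
  ultimately have "continuous_on (S \<inter> ball x \<rho>) f"
    by (metis (no_types, lifting) continuous_on_cong)
  with \<rho> show "\<exists>V. open V \<and> x \<in> V \<and> continuous_on (S \<inter> V) f"
    by (intro exI[of _ "ball x \<rho>"]) auto
qed

lemma complex_family_mono:
  assumes fam: "complex_family r B P T h" and r: "r' \<le> r" "B \<le> B'" "r > 0"
  shows "complex_family r' B' P T h"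
proof -
  have sub: "ball 0 r' \<subseteq> (ball 0 r :: complex set)" using r by (simp add: subset_ball)
  show ?thesis
    unfolding complex_family_def
  proof (intro conjI ballI allI impI)
    show "continuous_on (P \<times> UNIV \<times> ball 0 r' \<times> ball 0 r' \<times> ball 0 r') (\<lambda>(p, t, x, y, z). h p t x y z)"
      by (rule continuous_on_subset[OF complex_family_continuous[OF fam r(3)]]) (use sub in blast)
  next
    fix p t U a b c
    assume p: "p \<in> P" and H: "open U \<and> a holomorphic_on U \<and> b holomorphic_on U \<and> c holomorphic_on U \<and>
        a ` U \<subseteq> ball 0 r' \<and> b ` U \<subseteq> ball 0 r' \<and> c ` U \<subseteq> ball 0 r'"
    show "(\<lambda>\<epsilon>. h p t (a \<epsilon>) (b \<epsilon>) (c \<epsilon>)) holomorphic_on U"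
      by (rule complex_family_holomorphic[OF fam r(3) p]) (use H sub in blast)+
  next
    fix p t and x y z :: complex assume p: "p \<in> P" and "x \<in> ball 0 r'" "y \<in> ball 0 r'" "z \<in> ball 0 r'"
    then have "norm (h p t x y z) \<le> B"
      using r(1) by (intro complex_family_bound[OF fam r(3) p]) auto
    then show "norm (h p t x y z) \<le> B'" using r by linarith
  next
    fix p t x y z assume "p \<in> P"
    then show "h p (t + T) x y z = h p t x y z" using fam unfolding complex_family_def by blast
  qed
qed

text \<open>
The phase ranges over the compact interval from \<open>0\<close> to \<open>2 \<pi>\<close>. That \<open>\<omega>(A0) T\<close> is a multiple of \<open>2 \<pi>\<close>
makes the complexified functions \<open>T\<close>-periodic along the unperturbed orbit.
\<close>

lemma subharmonic_setup_exists:
  fixes W :: "real set" and \<omega> :: "real \<Rightarrow> real"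
    and F G :: "real \<Rightarrow> real \<Rightarrow> real \<Rightarrow> real \<Rightarrow> real"
    and l q :: int and A0 :: real and C0 :: "real \<Rightarrow> real"
  assumes W: "open W" "A0 \<in> W" and q: "q \<ge> 1" and \<omega>A0: "\<omega> A0 = of_int l / of_int q"
    and an\<omega>: "real_analytic_on \<omega> W"
    and anF: "real_analytic_on (\<lambda>(\<alpha>, A, C, t). F \<alpha> A C t) (UNIV \<times> W \<times> UNIV \<times> UNIV)"
    and anG: "real_analytic_on (\<lambda>(\<alpha>, A, C, t). G \<alpha> A C t) (UNIV \<times> W \<times> UNIV \<times> UNIV)"
    and perF: "\<And>\<alpha> A C t. A \<in> W \<Longrightarrow> F (\<alpha> + 2 * pi) A C t = F \<alpha> A C t"
      "\<And>\<alpha> A C t. A \<in> W \<Longrightarrow> F \<alpha> A C (t + 2 * pi) = F \<alpha> A C t"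
    and perG: "\<And>\<alpha> A C t. A \<in> W \<Longrightarrow> G (\<alpha> + 2 * pi) A C t = G \<alpha> A C t"
      "\<And>\<alpha> A C t. A \<in> W \<Longrightarrow> G \<alpha> A C (t + 2 * pi) = G \<alpha> A C t"
    and twist: "deriv \<omega> A0 \<noteq> 0"
    and anC0: "real_analytic_on C0 UNIV" and perC0: "periodic_with (2 * pi) C0"
    and M0: "\<And>t0. t0 \<in> {0..<2 * pi} \<Longrightarrow> Melnikov \<omega> G q A0 t0 (C0 t0) = 0"
    and M1: "\<And>t0. t0 \<in> {0..<2 * pi} \<Longrightarrow> deriv (\<lambda>C. Melnikov \<omega> G q A0 t0 C) (C0 t0) \<noteq> 0"
  obtains r B f g v w1 where
    "subharmonic_setup {0..2 * pi} (2 * pi * of_int q) r B f g v w1 \<omega> F G q A0 C0"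
    "\<And>y. \<bar>y\<bar> < r \<Longrightarrow> A0 + y \<in> W"
proof -
  define T where "T = 2 * pi * real_of_int q"
  define P where "P = {0..2 * pi}"
  have T: "T > 0" using q by (simp add: T_def)
  have \<omega>T: "\<omega> A0 * T = 2 * pi * of_int l" using q by (simp add: T_def \<omega>A0)
  have contC0: "continuous_on P C0"
    using real_analytic_on_imp_continuous_on[OF anC0 open_UNIV] continuous_on_subset by blast
  have family: "\<exists>r B. r > 0 \<and> complex_family r B P T
        (\<lambda>p t x y z. cext (\<lambda>\<alpha> A C t. if A \<in> W then H \<alpha> A C t else 0)
           (of_real (\<omega> A0 * t) + x) (of_real A0 + y) (of_real (C0 p) + z) (t + p))"
    if an: "real_analytic_on (\<lambda>(\<alpha>, A, C, t). H \<alpha> A C t) (UNIV \<times> W \<times> UNIV \<times> UNIV)"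
      and per: "\<And>\<alpha> A C t. A \<in> W \<Longrightarrow> H (\<alpha> + 2 * pi) A C t = H \<alpha> A C t"
        "\<And>\<alpha> A C t. A \<in> W \<Longrightarrow> H \<alpha> A C (t + 2 * pi) = H \<alpha> A C t" for H :: "real \<Rightarrow> real \<Rightarrow> real \<Rightarrow> real \<Rightarrow> real"
  proof -
    \<comment> \<open>Outside \<open>W\<close> the function is replaced by \<open>0\<close>, so that it is periodic for all actions.\<close>
    define H' where "H' = (\<lambda>\<alpha> A C t. if A \<in> W then H \<alpha> A C t else 0)"
    have "open (UNIV \<times> W \<times> (UNIV :: real set) \<times> (UNIV :: real set))"
      using W by (intro open_Times) auto
    then have an': "real_analytic_on (\<lambda>(\<alpha>, A, C, t). H' \<alpha> A C t) (UNIV \<times> W \<times> UNIV \<times> UNIV)"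
      by (rule real_analytic_on_cong[OF an]) (auto simp: H'_def)
    have "H' (\<alpha> + \<omega> A0 * T) A C (t + T) = H' \<alpha> A C t" for \<alpha> A C t
    proof -
      have "H' (\<alpha> + 2 * pi * of_int l) A C (t + T) = H' \<alpha> A C (t + T)"
        by (rule periodic_int_multiple[where h = "\<lambda>\<alpha>. H' \<alpha> A C (t + T)"]) (simp add: H'_def per)
      also have "\<dots> = H' \<alpha> A C t"
        unfolding T_def by (rule periodic_int_multiple) (simp add: H'_def per)
      finally show ?thesis by (simp add: \<omega>T)
    qed
    note per' = this
    have "compact P" by (simp add: P_def)
    then show ?thesis
      unfolding H'_def[symmetric] using complex_family_cext[OF an' W _ contC0 T per'] by blast
  qed
  define f where "f = (\<lambda>p t x y z. cext (\<lambda>\<alpha> A C t. if A \<in> W then F \<alpha> A C t else 0)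
           (of_real (\<omega> A0 * t) + x) (of_real A0 + y) (of_real (C0 p) + z) (t + p))"
  define g where "g = (\<lambda>p t x y z. cext (\<lambda>\<alpha> A C t. if A \<in> W then G \<alpha> A C t else 0)
           (of_real (\<omega> A0 * t) + x) (of_real A0 + y) (of_real (C0 p) + z) (t + p))"
  obtain rf Bf where rf: "rf > 0" "complex_family rf Bf P T f"
    using family[OF anF perF] unfolding f_def by blast
  obtain rg Bg where rg: "rg > 0" "complex_family rg Bg P T g"
    using family[OF anG perG] unfolding g_def by blast
  obtain rv Bv v where rv: "rv > 0" "\<And>P T. complex_family rv Bv P T (\<lambda>p t x y z. v z)"
    and v: "\<And>y. \<bar>y\<bar> < rv \<Longrightarrow> v (of_real y) = of_real (\<omega> (A0 + y) - \<omega> A0)"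
    using complex_family_one_variable[OF an\<omega> W] by blast
  obtain rW where rW: "rW > 0" "ball A0 rW \<subseteq> W" using W open_contains_ball by blast
  define r where "r = min (min rf rg) (min rv rW)"
  define B where "B = max Bf (max Bg Bv)"
  have r: "r > 0" "r \<le> rf" "r \<le> rg" "r \<le> rv" "r \<le> rW" using rf rg rv rW by (auto simp: r_def)
  have famf: "complex_family r B P T f" by (rule complex_family_mono[OF rf(2) r(2) _ rf(1)]) (simp add: B_def)
  have famg: "complex_family r B P T g" by (rule complex_family_mono[OF rg(2) r(3) _ rg(1)]) (simp add: B_def)
  have famv: "complex_family r B P T (\<lambda>p t x y z. v z)" by (rule complex_family_mono[OF rv(2) r(4) _ rv(1)]) (simp add: B_def)
  have inW: "A0 + y \<in> W" if "\<bar>y\<bar> < r" for y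
    using that r rW by (auto simp: dist_norm)
  have f_eq: "f p t (of_real x) (of_real y) (of_real z) = of_real (F (\<omega> A0 * t + x) (A0 + y) (C0 p + z) (t + p))"
    if "\<bar>y\<bar> < r" for p t x y z
    unfolding f_def of_real_add[symmetric] cext_of_real using inW[OF that] by simp
  have g_eq: "g p t (of_real x) (of_real y) (of_real z) = of_real (G (\<omega> A0 * t + x) (A0 + y) (C0 p + z) (t + p))"
    if "\<bar>y\<bar> < r" for p t x y z
    unfolding g_def of_real_add[symmetric] cext_of_real using inW[OF that] by simp
  have v_eq: "v (of_real y) = of_real (\<omega> (A0 + y) - \<omega> A0)" if "\<bar>y\<bar> < r" for y
    using v that r by simp
  define w1 where "w1 = deriv v 0"
  have "v holomorphic_on ball 0 r"
    using complex_family_holomorphic[OF famv r(1), of 0 "ball 0 r" "\<lambda>_. 0" "\<lambda>_. 0" "\<lambda>z. z"] r(1)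
    by (simp add: P_def holomorphic_on_const holomorphic_on_ident)
  then have v1: "(v has_field_derivative w1) (at 0)"
    unfolding w1_def by (rule holomorphic_derivI) (use r in auto)
  have near0: "eventually (\<lambda>y::real. y \<in> {-r<..<r}) (nhds 0)"
    by (rule eventually_nhds_in_open) (use r in auto)
  then have "eventually (\<lambda>y. v (of_real y) = of_real (\<omega> (A0 + y) - \<omega> A0)) (nhds 0)"
    by eventually_elim (rule v_eq, auto)
  from has_real_derivative_of_complexification[OF _ this, of w1] v1
  have w1: "((\<lambda>y. \<omega> (A0 + y) - \<omega> A0) has_real_derivative Re w1) (at 0)" "w1 = of_real (Re w1)" by simp_all
  have "((\<lambda>y. \<omega> (y + A0)) has_real_derivative Re w1) (at 0)"
    using DERIV_add[OF w1(1) DERIV_const[of "\<omega> A0"]] by (simp add: add.commute)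
  then have "(\<omega> has_real_derivative Re w1) (at A0)"
    using DERIV_shift[of \<omega> "Re w1" 0 A0] by simp
  then have w1_nz: "w1 \<noteq> 0" using twist DERIV_imp_deriv by fastforce
  have Mel_shift: "Melnikov \<omega> G q A0 (t0 + 2 * pi) C = Melnikov \<omega> G q A0 t0 C" for t0 C
    using perG(2)[OF W(2)] by (simp add: Melnikov_def Let_def flip: add.assoc)
  \<comment> \<open>The hypotheses cover phases below \<open>2 \<pi>\<close>; the end point is identified with \<open>0\<close>.\<close>
  have Mel: "Melnikov \<omega> G q A0 p (C0 p) = 0" "deriv (\<lambda>C. Melnikov \<omega> G q A0 p C) (C0 p) \<noteq> 0" if p: "p \<in> P" for p
  proof -
    have "C0 (2 * pi) = C0 0" using perC0[unfolded periodic_with_def, rule_format, of 0] by simp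
    moreover have "Melnikov \<omega> G q A0 (2 * pi) = Melnikov \<omega> G q A0 0"
      using Mel_shift[of 0] by auto
    ultimately show "Melnikov \<omega> G q A0 p (C0 p) = 0" "deriv (\<lambda>C. Melnikov \<omega> G q A0 p C) (C0 p) \<noteq> 0"
      using M0[of p] M1[of p] M0[of 0] M1[of 0] p by (cases "p = 2 * pi"; simp add: P_def)+
  qed
  have mean_Mel: "mean T (\<lambda>t. g p t 0 0 (of_real z)) = of_real (Melnikov \<omega> G q A0 p (C0 p + z))"
    if p: "p \<in> P" and z: "\<bar>z\<bar> < r" for p z
  proof -
    define u where "u = (\<lambda>t. G (\<omega> A0 * t) A0 (C0 p + z) (t + p))"
    have gu: "g p t 0 0 (of_real z) = of_real (u t)" for t
      using g_eq[of 0 p t 0 z] r by (simp add: u_def)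
    have "continuous_on {0..T} (\<lambda>t. (\<lambda>(p, t, x, y, z). g p t x y z) (p, t, 0, 0, of_real z))"
      by (rule continuous_on_compose2[OF complex_family_continuous[OF famg r(1)]])
        (use p z r in \<open>auto intro!: continuous_intros\<close>)
    then have "continuous_on {0..T} (\<lambda>t. Re (complex_of_real (u t)))"
      by (intro continuous_on_Re) (simp add: gu)
    then have "u integrable_on {0..T}" by (simp add: integrable_continuous_real)
    then have "((\<lambda>t. complex_of_real (u t)) has_integral of_real (integral {0..T} u)) {0..T}"
      by (intro has_integral_of_real integrable_integral)
    then have "integral {0..T} (\<lambda>t. complex_of_real (u t)) = of_real (integral {0..T} u)" by (rule integral_unique)
    then show ?thesis by (simp add: mean_def gu Melnikov_def Let_def T_def u_def)
  qed
  have g0: "mean T (\<lambda>t. g p t 0 0 0) = 0" if p: "p \<in> P" for p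
    using mean_Mel[OF p, of 0] Mel(1)[OF p] r by simp
  have g1: "mean T (\<lambda>t. deriv (\<lambda>z. g p t 0 0 z) 0) \<noteq> 0" if p: "p \<in> P" for p
  proof
    assume zero: "mean T (\<lambda>t. deriv (\<lambda>z. g p t 0 0 z) 0) = 0"
    have "continuous_on (ball 0 r \<times> {0..T}) (\<lambda>u. (\<lambda>(p, t, x, y, z). g p t x y z) (p, snd u, 0, 0, fst u))"
      by (rule continuous_on_compose2[OF complex_family_continuous[OF famg r(1)]])
        (use p r in \<open>auto intro!: continuous_intros\<close>)
    then have cont: "continuous_on (ball 0 r \<times> {0..T}) (\<lambda>(z, s). g p s 0 0 z)" by (simp add: case_prod_beta')
    have hol: "(\<lambda>z. g p s 0 0 z) holomorphic_on ball 0 r" for s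
      using p r by (intro complex_family_holomorphic[OF famg r(1)]) (auto intro!: holomorphic_intros)
    have "((\<lambda>z. of_real (1 / T) * integral {0..T} (\<lambda>s. g p s 0 0 z)) has_field_derivative
        of_real (1 / T) * integral {0..T} (\<lambda>s. deriv (\<lambda>z. g p s 0 0 z) 0)) (at (of_real 0))"
      using has_field_derivative_param_integral[OF open_ball cont hol, of 0] r
      by (intro DERIV_cmult) simp
    then have d: "((\<lambda>z. mean T (\<lambda>s. g p s 0 0 z)) has_field_derivative 0) (at (of_real 0))"
      by (simp only: mean_def zero[unfolded mean_def])
    have "eventually (\<lambda>z. mean T (\<lambda>s. g p s 0 0 (of_real z)) = of_real (Melnikov \<omega> G q A0 p (C0 p + z))) (nhds 0)"
      using near0 by eventually_elim (rule mean_Mel[OF p], auto)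
    from has_real_derivative_of_complexification(1)[OF d this]
    have "((\<lambda>z. Melnikov \<omega> G q A0 p (z + C0 p)) has_real_derivative 0) (at 0)" by (simp add: add.commute)
    then have "(Melnikov \<omega> G q A0 p has_real_derivative 0) (at (C0 p))"
      using DERIV_shift[of "Melnikov \<omega> G q A0 p" 0 0 "C0 p"] by simp
    then show False using Mel(2)[OF p] DERIV_imp_deriv by blast
  qed
  have "subharmonic_setup P T r B f g v w1 \<omega> F G q A0 C0"
  proof unfold_locales
    show "compact P" by (simp add: P_def)
    show "f p t x y z \<in> \<real>" if "x \<in> \<real>" "y \<in> \<real>" "z \<in> \<real>" "norm y < r" for p t x y z
      using that by (elim Reals_cases) (simp add: f_eq)
    show "g p t x y z \<in> \<real>" if "x \<in> \<real>" "y \<in> \<real>" "z \<in> \<real>" "norm y < r" for p t x y z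
      using that by (elim Reals_cases) (simp add: g_eq)
    show "v z \<in> \<real>" if "z \<in> \<real>" "norm z < r" for z
      using that by (elim Reals_cases) (simp add: v_eq del: of_real_diff)
    show "v 0 = 0" using v_eq[of 0] r by simp
    show "w1 \<in> \<real>" using w1(2) by (metis Reals_of_real)
  qed (fact T r famf famg famv v1 w1_nz g0 g1 T_def | rule f_eq g_eq v_eq, assumption)+
  then show ?thesis
    using that inW unfolding P_def T_def by blast
qed

section \<open>The region filled by subharmonic solutions\<close>

text \<open>
This applies to the maximum and the minimum of two functions that touch at a point.
\<close>

lemma has_real_derivative_selection:
  fixes g1 g2 \<gamma> :: "real \<Rightarrow> real"
  assumes "(g1 has_real_derivative D) (at x)" "(g2 has_real_derivative D) (at x)"
    and sel: "\<And>y. \<gamma> y = g1 y \<or> \<gamma> y = g2 y" and eq: "g1 x = g2 x"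
  shows "(\<gamma> has_real_derivative D) (at x)"
proof -
  have x: "\<gamma> x = g1 x" "\<gamma> x = g2 x" using sel[of x] eq by auto
  have 1: "((\<lambda>y. (g1 y - g1 x) / (y - x)) \<longlongrightarrow> D) (at x)" "((\<lambda>y. (g2 y - g2 x) / (y - x)) \<longlongrightarrow> D) (at x)"
    using assms(1,2) by (simp_all add: has_field_derivative_iff)
  have "((\<lambda>y. (\<gamma> y - \<gamma> x) / (y - x)) \<longlongrightarrow> D) (at x)"
  proof (rule tendstoI)
    fix \<eta> :: real assume "\<eta> > 0"
    from tendstoD[OF 1(1) this] tendstoD[OF 1(2) this]
    show "\<forall>\<^sub>F y in at x. dist ((\<gamma> y - \<gamma> x) / (y - x)) D < \<eta>"
    proof eventually_elim
      case (elim y)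
      then show ?case using sel[of y] x by (elim disjE) simp_all
    qed
  qed
  then show ?thesis by (simp add: has_field_derivative_iff)
qed

theorem theorem3:
  fixes W :: "real set" and \<omega> :: "real \<Rightarrow> real"
    and F G :: "real \<Rightarrow> real \<Rightarrow> real \<Rightarrow> real \<Rightarrow> real"
    and p q :: int and A0 :: real and C0 :: "real \<Rightarrow> real"
    and k :: nat and tm tM :: real
  assumes "open W"
    and "real_analytic_on \<omega> W"
    and "real_analytic_on (\<lambda>(\<alpha>, A, C, t). F \<alpha> A C t) (UNIV \<times> W \<times> UNIV \<times> UNIV)"
    and "real_analytic_on (\<lambda>(\<alpha>, A, C, t). G \<alpha> A C t) (UNIV \<times> W \<times> UNIV \<times> UNIV)"
    and "\<And>\<alpha> A C t. A \<in> W \<Longrightarrow> F (\<alpha> + 2 * pi) A C t = F \<alpha> A C t"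
    and "\<And>\<alpha> A C t. A \<in> W \<Longrightarrow> F \<alpha> A C (t + 2 * pi) = F \<alpha> A C t"
    and "\<And>\<alpha> A C t. A \<in> W \<Longrightarrow> G (\<alpha> + 2 * pi) A C t = G \<alpha> A C t"
    and "\<And>\<alpha> A C t. A \<in> W \<Longrightarrow> G \<alpha> A C (t + 2 * pi) = G \<alpha> A C t"
    and "p \<noteq> 0" and "q \<ge> 1" and "coprime p q"
    and "A0 \<in> W" and "\<omega> A0 = of_int p / of_int q"
    and i: "deriv \<omega> A0 \<noteq> 0"
    and ii: "real_analytic_on C0 UNIV" "periodic_with (2 * pi) C0"
      "\<And>t0. t0 \<in> {0..<2 * pi} \<Longrightarrow> Melnikov \<omega> G q A0 t0 (C0 t0) = 0"
      "\<And>t0. t0 \<in> {0..<2 * pi} \<Longrightarrow> deriv (\<lambda>C. Melnikov \<omega> G q A0 t0 C) (C0 t0) \<noteq> 0"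
    and iii: "k \<ge> 1"
      "\<And>j. j < k \<Longrightarrow> \<exists>c. \<forall>t0. C_coeff \<omega> F G q A0 C0 j t0 = c"
      "tm \<in> {0..<2 * pi}" "tM \<in> {0..<2 * pi}"
      "\<And>t0. t0 \<in> {0..<2 * pi} \<Longrightarrow> C_coeff \<omega> F G q A0 C0 k tm \<le> C_coeff \<omega> F G q A0 C0 k t0"
      "\<And>t0. t0 \<in> {0..<2 * pi} \<Longrightarrow> C_coeff \<omega> F G q A0 C0 k t0 \<le> C_coeff \<omega> F G q A0 C0 k tM"
      "deriv (deriv (C_coeff \<omega> F G q A0 C0 k)) tm * deriv (deriv (C_coeff \<omega> F G q A0 C0 k)) tM \<noteq> 0"
  shows "\<exists>\<epsilon>0>0. \<exists>g1 g2 :: real \<Rightarrow> real.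
    real_analytic_on g1 {-\<epsilon>0<..<\<epsilon>0} \<and> real_analytic_on g2 {-\<epsilon>0<..<\<epsilon>0} \<and>
    g1 0 = g2 0 \<and> (\<forall>\<epsilon>\<in>{-\<epsilon>0<..<\<epsilon>0}. \<epsilon> \<noteq> 0 \<longrightarrow> g1 \<epsilon> \<noteq> g2 \<epsilon>) \<and>
    (let \<gamma>1 = (\<lambda>\<epsilon>. if \<epsilon> > 0 then max (g1 \<epsilon>) (g2 \<epsilon>)
                   else if \<epsilon> < 0 then min (g1 \<epsilon>) (g2 \<epsilon>) else g1 0);
         \<gamma>2 = (\<lambda>\<epsilon>. if \<epsilon> > 0 then min (g1 \<epsilon>) (g2 \<epsilon>)
                   else if \<epsilon> < 0 then max (g1 \<epsilon>) (g2 \<epsilon>) else g1 0)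
     in (\<exists>D. (\<gamma>1 has_real_derivative D) (at 0) \<and> (\<gamma>2 has_real_derivative D) (at 0)) \<and>
        (\<forall>\<epsilon> C. 0 < \<epsilon> \<and> \<epsilon> < \<epsilon>0 \<and> \<gamma>2 \<epsilon> \<le> \<epsilon> * C \<and> \<epsilon> * C \<le> \<gamma>1 \<epsilon> \<longrightarrow>
           (\<exists>\<alpha> A. subharmonic_solution W \<omega> F G p q A0 \<epsilon> C \<alpha> A)) \<and>
        (\<forall>\<epsilon> C. - \<epsilon>0 < \<epsilon> \<and> \<epsilon> < 0 \<and> \<gamma>1 \<epsilon> \<le> \<epsilon> * C \<and> \<epsilon> * C \<le> \<gamma>2 \<epsilon> \<longrightarrow>
           (\<exists>\<alpha> A. subharmonic_solution W \<omega> F G p q A0 \<epsilon> C \<alpha> A)))"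
proof -
  note W = \<open>open W\<close> \<open>A0 \<in> W\<close>
  have perC0: "C0 (t + 2 * pi) = C0 t" for t using ii(2) by (simp add: periodic_with_def)
  obtain r B f g v w1 where
    ss: "subharmonic_setup {0..2 * pi} (2 * pi * of_int q) r B f g v w1 \<omega> F G q A0 C0"
    and inW: "\<And>y. \<bar>y\<bar> < r \<Longrightarrow> A0 + y \<in> W"
  proof ((rule subharmonic_setup_exists[where l = p and q = q and \<omega> = \<omega> and F = F and G = G and W = W
          and ?A0.0 = A0 and ?C0.0 = C0, OF assms(1,12,10,13,2,3,4,5,6,7,8,14,15,16,17,18)]; assumption?), goal_cases)
    case (1 r B f g v w1)
    show ?case by (rule that[of r B f g v w1]) (fact 1)+
  qed
  define P where "P = {0..2 * pi}"
  define T where "T = 2 * pi * real_of_int q"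
  interpret subharmonic_setup P T r B f g v w1 \<omega> F G q A0 C0
    using ss by (simp add: P_def T_def)
  have P_ne: "P \<noteq> {}" by (simp add: P_def)
  obtain e a b c where e: "e > 0"
    and fam: "param_family e P T a" "param_family e P T b" "param_family e P T (\<lambda>\<epsilon> p t. c \<epsilon> p)"
    and bda: "\<And>\<epsilon> p t. norm \<epsilon> < e \<Longrightarrow> p \<in> P \<Longrightarrow> norm (a \<epsilon> p t) < r / 4"
    and bdb: "\<And>\<epsilon> p t. norm \<epsilon> < e \<Longrightarrow> p \<in> P \<Longrightarrow> norm (b \<epsilon> p t) < r / 4"
    and bdc: "\<And>\<epsilon> p. norm \<epsilon> < e \<Longrightarrow> p \<in> P \<Longrightarrow> norm (c \<epsilon> p) < r / 4"
    and zero: "\<And>p t. p \<in> P \<Longrightarrow> a 0 p t = 0" "\<And>p t. p \<in> P \<Longrightarrow> b 0 p t = 0" "\<And>p. p \<in> P \<Longrightarrow> c 0 p = 0"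
    and dera: "\<And>\<epsilon> p t. norm \<epsilon> < e \<Longrightarrow> p \<in> P \<Longrightarrow>
      (a \<epsilon> p has_vector_derivative v (b \<epsilon> p t) + \<epsilon> * f p t (a \<epsilon> p t) (b \<epsilon> p t) (c \<epsilon> p)) (at t)"
    and derb: "\<And>\<epsilon> p t. norm \<epsilon> < e \<Longrightarrow> p \<in> P \<Longrightarrow>
      (b \<epsilon> p has_vector_derivative \<epsilon> * g p t (a \<epsilon> p t) (b \<epsilon> p t) (c \<epsilon> p)) (at t)"
    and int: "\<And>\<epsilon> p. norm \<epsilon> < e \<Longrightarrow> p \<in> P \<Longrightarrow> integral {0..T} (a \<epsilon> p) = 0"
  proof (rule exists_families[OF P_ne], goal_cases)
    case (1 e a b c)
    show ?case by (rule that[of e a b c]) (fact 1)+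
  qed
  let ?K = "C_coeff \<omega> F G q A0 C0"
  have K_eq: "?K n s = (if n = 0 then C0 s else 0) + Re (taylor_coeff n (\<lambda>\<epsilon>. c \<epsilon> s))" if "s \<in> P" for n s
    using C_coeff_eq[OF formal_subharmonic_of_families[OF e that fam bda bdb bdc zero dera derb int] that, of n]
    by simp
  have K_per: "?K n (s + 2 * pi) = ?K n s" for n s
    by (rule C_coeff_periodic[where F = F and G = G and W = W and d = "2 * pi" and ?C0.0 = C0, OF W assms(6,8) perC0])
  have t: "tm \<in> P" "tM \<in> P" using iii(3,4) by (auto simp: P_def)
  have K_const: "?K n tm = ?K n tM" if "n < k" for n using iii(2)[OF that] by metis
  have C0_eq: "C0 tM = C0 tm"
    using K_const[of 0] iii(1) K_eq[OF t(1), of 0] K_eq[OF t(2), of 0] zero(3)[OF t(1)] zero(3)[OF t(2)] by simp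
  have K_less: "?K k tm \<noteq> ?K k tM"
  proof
    assume eq: "?K k tm = ?K k tM"
    \<comment> \<open>Minimum and maximum coincide, so \<open>C\<^sub>k\<close> is constant on a period.\<close>
    have "?K k s = ?K k tm" for s
    proof -
      define n where "n = \<lfloor>s / (2 * pi)\<rfloor>"
      define s0 where "s0 = s - 2 * pi * of_int n"
      have "of_int n \<le> s / (2 * pi)" "s / (2 * pi) < of_int n + 1" by (auto simp: n_def)
      then have "s0 \<in> {0..<2 * pi}" by (auto simp: s0_def field_simps)
      then have "?K k s0 = ?K k tm" using iii(5,6)[of s0] eq by force
      moreover have "?K k (s0 + 2 * pi * of_int n) = ?K k s0" by (rule periodic_int_multiple) (rule K_per)
      ultimately show ?thesis by (simp add: s0_def)
    qed
    then have "?K k = (\<lambda>s. ?K k tm)" by blast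
    then have "deriv (?K k) = (\<lambda>s. 0)" by (metis deriv_const ext)
    then show False using iii(7) by simp
  qed
  \<comment> \<open>\<open>CC\<close> is the parameter \<open>C(\<epsilon>, s)\<close> at complex \<open>\<epsilon>\<close>, and \<open>Cr\<close> is its restriction to real \<open>\<epsilon>\<close>.\<close>
  define CC where "CC = (\<lambda>\<epsilon> s. complex_of_real (C0 s) + c \<epsilon> s)"
  define Cr where "Cr = (\<lambda>x s. C0 s + Re (c (complex_of_real x) s))"
  have hol_c: "(\<lambda>\<epsilon>. c \<epsilon> s) holomorphic_on ball 0 e" if "s \<in> P" for s
    using param_familyD(2)[OF fam(3) that] .
  have CC_real: "CC (of_real x) s = of_real (Cr x s)" if "\<bar>x\<bar> < e" "s \<in> P" for x s
    using param_familyD(4)[OF fam(3), of "of_real x" s] that by (simp add: CC_def Cr_def of_real_Re)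
  obtain e1 where e1: "e1 > 0" "e1 \<le> e" "\<And>\<epsilon>. norm \<epsilon> < e1 \<Longrightarrow> \<epsilon> \<noteq> 0 \<Longrightarrow> CC \<epsilon> tM \<noteq> CC \<epsilon> tm"
  proof -
    \<comment> \<open>The coefficient of order \<open>k\<close> of \<open>d\<close> is nonzero, so the zero of \<open>d\<close> at the origin is isolated.\<close>
    define d where "d = (\<lambda>\<epsilon>. c \<epsilon> tM - c \<epsilon> tm)"
    have hol_d: "d holomorphic_on ball 0 e" unfolding d_def by (intro holomorphic_intros hol_c t)
    have "taylor_coeff k d = taylor_coeff k (\<lambda>\<epsilon>. c \<epsilon> tM) - taylor_coeff k (\<lambda>\<epsilon>. c \<epsilon> tm)"
      unfolding d_def by (rule taylor_coeff_diff[OF hol_c hol_c e]) (rule t)+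
    then have "Re (taylor_coeff k d) \<noteq> 0"
      using K_less iii(1) K_eq[OF t(1), of k] K_eq[OF t(2), of k] by simp
    then have nz: "taylor_coeff k d \<noteq> 0" by auto
    have "\<exists>\<beta>. norm \<beta> < e \<and> d \<beta> \<noteq> 0"
    proof (rule ccontr)
      assume "\<not> ?thesis"
      then have "d \<beta> = 0" if "norm \<beta> < e" for \<beta> using that by blast
      have "taylor_coeff k d = 0"
        by (rule taylor_coeff_eq_0[OF hol_d e, where K = 0]) (simp add: \<open>\<And>\<beta>. norm \<beta> < e \<Longrightarrow> d \<beta> = 0\<close>)
      then show False using nz by simp
    qed
    then obtain \<beta> where \<beta>: "\<beta> \<in> ball 0 e" "d \<beta> \<noteq> 0" by auto
    have d0: "d 0 = 0" using zero(3) t by (simp add: d_def)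
    obtain e2 where e2: "e2 > 0" "ball (0 :: complex) e2 \<subseteq> ball 0 e" "\<And>z. z \<in> ball 0 e2 - {0} \<Longrightarrow> d z \<noteq> 0"
    proof (rule isolated_zeros[OF hol_d open_ball connected_ball centre_in_ball[THEN iffD2, OF e] d0 \<beta>], goal_cases)
      case (1 e2)
      show ?case by (rule that[of e2]) (fact 1)+
    qed
    show ?thesis
    proof (rule that[of "min e e2"])
      fix \<epsilon> :: complex assume "norm \<epsilon> < min e e2" "\<epsilon> \<noteq> 0"
      then have "d \<epsilon> \<noteq> 0" by (intro e2) auto
      then show "CC \<epsilon> tM \<noteq> CC \<epsilon> tm" by (simp add: CC_def d_def C0_eq)
    qed (use e e2 in auto)
  qed
  \<comment> \<open>The boundary curves are the members of the solution families at the two fixed phases.\<close>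
  define g1 where "g1 = (\<lambda>x. x * Cr x tM)"
  define g2 where "g2 = (\<lambda>x. x * Cr x tm)"
  have hol_g: "(\<lambda>\<epsilon>. \<epsilon> * CC \<epsilon> s) holomorphic_on ball 0 e" if "s \<in> P" for s
    unfolding CC_def by (intro holomorphic_intros hol_c that)
  have an_g: "real_analytic_on (\<lambda>x. x * Cr x s) {-e1<..<e1}" if "s \<in> P" for s
  proof (rule real_analytic_on_holomorphic)
    show "(\<lambda>\<epsilon>. \<epsilon> * CC \<epsilon> s) holomorphic_on ball 0 e1"
      by (rule holomorphic_on_subset[OF hol_g[OF that]]) (use e1 in auto)
    show "of_real x * CC (of_real x) s = of_real (x * Cr x s)" if "\<bar>x\<bar> < e1" for x
      using CC_real[OF _ \<open>s \<in> P\<close>, of x] that e1 by simp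
  qed
  have der_g: "((\<lambda>x. x * Cr x s) has_real_derivative C0 s) (at 0)" if s: "s \<in> P" for s
  proof -
    have "((\<lambda>\<epsilon>. CC \<epsilon> s) has_field_derivative deriv (\<lambda>\<epsilon>. CC \<epsilon> s) 0) (at 0)"
      by (rule holomorphic_derivI[of _ "ball 0 e"]) (use e hol_c[OF s] in \<open>auto simp: CC_def intro!: holomorphic_intros\<close>)
    from DERIV_mult[OF DERIV_ident this]
    have d: "((\<lambda>\<epsilon>. \<epsilon> * CC \<epsilon> s) has_field_derivative of_real (C0 s)) (at (of_real 0))"
      using zero(3)[OF s] by (simp add: CC_def)
    have "eventually (\<lambda>x::real. x \<in> {-e<..<e}) (nhds 0)"
      by (rule eventually_nhds_in_open) (use e in auto)
    then have ev: "eventually (\<lambda>x. of_real x * CC (of_real x) s = of_real (x * Cr x s)) (nhds 0)"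
      by eventually_elim (use CC_real[OF _ s] in auto)
    show ?thesis using has_real_derivative_of_complexification(1)[OF d ev] by simp
  qed
  have cont_Cr: "continuous_on P (Cr x)" if x: "\<bar>x\<bar> < e" for x
  proof -
    have "continuous_on P (\<lambda>s. (\<lambda>(\<epsilon>, p, t). c \<epsilon> p) (of_real x, s, 0 :: real))"
      by (rule continuous_on_compose2[OF param_familyD(1)[OF fam(3)]])
        (use x in \<open>auto intro!: continuous_intros\<close>)
    moreover have "continuous_on P C0"
      using real_analytic_on_imp_continuous_on[OF ii(1) open_UNIV] continuous_on_subset by blast
    ultimately show ?thesis unfolding Cr_def by (intro continuous_intros) simp_all
  qed
  have \<omega>A0: "\<omega> A0 = of_int p / of_int q" by fact
  have solution: "\<exists>\<alpha> A. subharmonic_solution W \<omega> F G p q A0 \<epsilon> (Cr \<epsilon> s) \<alpha> A" if s: "s \<in> P" and \<epsilon>: "\<bar>\<epsilon>\<bar> < e" for s \<epsilon>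
  proof -
    define \<alpha>' where "\<alpha>' = (\<lambda>x t. \<omega> A0 * (t - s) + Re (a (complex_of_real x) s (t - s)))"
    define A' where "A' = (\<lambda>x t. A0 + Re (b (complex_of_real x) s (t - s)))"
    have per: "periodic_solution W \<omega> F G p q x (Cr x s) (\<alpha>' x) (A' x)" if "x \<in> {-e<..<e}" for x
      unfolding Cr_def \<alpha>'_def A'_def
      by (rule periodic_solution_of_families[OF s _ \<omega>A0 inW fam bda bdb bdc dera derb]) (use that in auto)
    have an: "real_analytic_on (\<lambda>x. k0 + Re (h (complex_of_real x) s t)) {-e<..<e}"
      if h: "param_family e P T h" for h :: "complex \<Rightarrow> real \<Rightarrow> real \<Rightarrow> complex" and k0 t :: real
    proof (rule real_analytic_on_holomorphic)
      show "(\<lambda>\<epsilon>. of_real k0 + h \<epsilon> s t) holomorphic_on ball 0 e"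
        by (intro holomorphic_intros param_familyD(2)[OF h s])
      show "of_real k0 + h (of_real x) s t = of_real (k0 + Re (h (of_real x) s t))" if "\<bar>x\<bar> < e" for x
        using param_familyD(4)[OF h _ s, of "of_real x" t] that by (simp add: of_real_Re)
    qed
    have "subharmonic_solution W \<omega> F G p q A0 \<epsilon> (Cr \<epsilon> s) (\<alpha>' \<epsilon>) (A' \<epsilon>)"
      unfolding subharmonic_solution_def
    proof (intro conjI)
      show "periodic_solution W \<omega> F G p q \<epsilon> (Cr \<epsilon> s) (\<alpha>' \<epsilon>) (A' \<epsilon>)" by (rule per) (use \<epsilon> in auto)
      have start: "\<alpha>' 0 t = of_int p / of_int q * t + - \<omega> A0 * s" "A' 0 t = A0" for t
        using zero[OF s] by (simp_all add: \<alpha>'_def A'_def \<omega>A0 right_diff_distrib)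
      show "\<exists>J \<alpha>'' A'' C'. is_interval J \<and> open J \<and> 0 \<in> J \<and> \<epsilon> \<in> J \<and> real_analytic_on C' J \<and>
        (\<forall>t. real_analytic_on (\<lambda>\<epsilon>. \<alpha>'' \<epsilon> t) J \<and> real_analytic_on (\<lambda>\<epsilon>. A'' \<epsilon> t) J) \<and>
        (\<forall>\<epsilon>\<in>J. periodic_solution W \<omega> F G p q \<epsilon> (C' \<epsilon>) (\<alpha>'' \<epsilon>) (A'' \<epsilon>)) \<and>
        \<epsilon> * C' \<epsilon> = \<epsilon> * Cr \<epsilon> s \<and>
        (\<exists>\<theta>. \<forall>t. \<alpha>'' 0 t = of_int p / of_int q * t + \<theta>) \<and> (\<forall>t. A'' 0 t = A0) \<and>
        \<alpha>'' \<epsilon> = \<alpha>' \<epsilon> \<and> A'' \<epsilon> = A' \<epsilon>"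
      proof (rule exI[of _ "{-e<..<e}"], rule exI[of _ \<alpha>'], rule exI[of _ A'], rule exI[of _ "\<lambda>x. Cr x s"],
          intro conjI allI)
        show "real_analytic_on (\<lambda>x. Cr x s) {-e<..<e}" unfolding Cr_def by (rule an[OF fam(3)])
        show "real_analytic_on (\<lambda>\<epsilon>. \<alpha>' \<epsilon> t) {-e<..<e}" for t
          unfolding \<alpha>'_def by (rule an[OF fam(1)])
        show "real_analytic_on (\<lambda>\<epsilon>. A' \<epsilon> t) {-e<..<e}" for t
          unfolding A'_def by (rule an[OF fam(2)])
        show "\<forall>\<epsilon>\<in>{-e<..<e}. periodic_solution W \<omega> F G p q \<epsilon> (Cr \<epsilon> s) (\<alpha>' \<epsilon>) (A' \<epsilon>)"
          using per by blast
        show "\<exists>\<theta>. \<forall>t. \<alpha>' 0 t = of_int p / of_int q * t + \<theta>" using start(1) by blast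
        show "A' 0 t = A0" for t by (fact start)
      qed (use e \<epsilon> in \<open>auto simp: is_interval_oo\<close>)
    qed
    then show ?thesis by blast
  qed
  have between: "\<exists>\<alpha> A. subharmonic_solution W \<omega> F G p q A0 \<epsilon> C \<alpha> A"
    if \<epsilon>: "\<epsilon> \<noteq> 0" "\<bar>\<epsilon>\<bar> < e1" and C: "min (g1 \<epsilon>) (g2 \<epsilon>) \<le> \<epsilon> * C" "\<epsilon> * C \<le> max (g1 \<epsilon>) (g2 \<epsilon>)" for \<epsilon> C
  proof -
    have e': "\<bar>\<epsilon>\<bar> < e" using \<epsilon> e1 by simp
    \<comment> \<open>Intermediate values in the phase, for fixed \<open>\<epsilon>\<close>.\<close>
    have con: "connected ((\<lambda>s. \<epsilon> * Cr \<epsilon> s) ` P)"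
      using cont_Cr[OF e'] by (intro connected_continuous_image continuous_intros) (auto simp: P_def)
    have mem: "g1 \<epsilon> \<in> (\<lambda>s. \<epsilon> * Cr \<epsilon> s) ` P" "g2 \<epsilon> \<in> (\<lambda>s. \<epsilon> * Cr \<epsilon> s) ` P"
      using t by (auto simp: g1_def g2_def)
    have "\<epsilon> * C \<in> (\<lambda>s. \<epsilon> * Cr \<epsilon> s) ` P"
      using C connected_contains_Icc[OF con mem] connected_contains_Icc[OF con mem(2) mem(1)]
      by (auto simp: min_def max_def subset_iff split: if_splits)
    then obtain s where "s \<in> P" "C = Cr \<epsilon> s" using \<epsilon> by auto
    then show ?thesis using solution[OF _ e'] by blast
  qed
  define \<gamma>1 where "\<gamma>1 = (\<lambda>\<epsilon>. if \<epsilon> > 0 then max (g1 \<epsilon>) (g2 \<epsilon>)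
                   else if \<epsilon> < 0 then min (g1 \<epsilon>) (g2 \<epsilon>) else g1 0)"
  define \<gamma>2 where "\<gamma>2 = (\<lambda>\<epsilon>. if \<epsilon> > 0 then min (g1 \<epsilon>) (g2 \<epsilon>)
                   else if \<epsilon> < 0 then max (g1 \<epsilon>) (g2 \<epsilon>) else g1 0)"
  have g0: "g1 0 = g2 0" by (simp add: g1_def g2_def)
  have neq: "g1 \<epsilon> \<noteq> g2 \<epsilon>" if "\<epsilon> \<in> {-e1<..<e1}" "\<epsilon> \<noteq> 0" for \<epsilon>
  proof -
    have "CC (of_real \<epsilon>) tM \<noteq> CC (of_real \<epsilon>) tm" using that by (intro e1(3)) auto
    moreover have "\<bar>\<epsilon>\<bar> < e" using that e1 by auto
    ultimately have "Cr \<epsilon> tM \<noteq> Cr \<epsilon> tm" using CC_real t by metis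
    with that show ?thesis by (simp add: g1_def g2_def)
  qed
  have d1: "(g1 has_real_derivative C0 tm) (at 0)" and d2: "(g2 has_real_derivative C0 tm) (at 0)"
    using der_g[OF t(2)] der_g[OF t(1)] by (simp_all add: g1_def g2_def C0_eq)
  have d\<gamma>: "(\<gamma>1 has_real_derivative C0 tm) (at 0)" "(\<gamma>2 has_real_derivative C0 tm) (at 0)"
    by (rule has_real_derivative_selection[OF d1 d2 _ g0], auto simp: \<gamma>1_def \<gamma>2_def g0 max_def min_def)+
  show ?thesis
  proof (rule exI[of _ e1], rule conjI, rule e1(1), rule exI[of _ g1], rule exI[of _ g2],
      unfold Let_def \<gamma>1_def[symmetric] \<gamma>2_def[symmetric], intro conjI)
    show "real_analytic_on g1 {- e1<..<e1}" "real_analytic_on g2 {- e1<..<e1}"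
      unfolding g1_def g2_def by (intro an_g t)+
    show "\<exists>D. (\<gamma>1 has_real_derivative D) (at 0) \<and> (\<gamma>2 has_real_derivative D) (at 0)"
      using d\<gamma> by blast
    show "\<forall>\<epsilon>\<in>{- e1<..<e1}. \<epsilon> \<noteq> 0 \<longrightarrow> g1 \<epsilon> \<noteq> g2 \<epsilon>" using neq by blast
    show "\<forall>\<epsilon> C. 0 < \<epsilon> \<and> \<epsilon> < e1 \<and> \<gamma>2 \<epsilon> \<le> \<epsilon> * C \<and> \<epsilon> * C \<le> \<gamma>1 \<epsilon> \<longrightarrow>
        (\<exists>\<alpha> A. subharmonic_solution W \<omega> F G p q A0 \<epsilon> C \<alpha> A)"
    proof (intro allI impI, elim conjE)
      fix \<epsilon> C assume "0 < \<epsilon>" "\<epsilon> < e1" "\<gamma>2 \<epsilon> \<le> \<epsilon> * C" "\<epsilon> * C \<le> \<gamma>1 \<epsilon>"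
      then show "\<exists>\<alpha> A. subharmonic_solution W \<omega> F G p q A0 \<epsilon> C \<alpha> A"
        by (intro between) (simp_all add: \<gamma>1_def \<gamma>2_def)
    qed
    show "\<forall>\<epsilon> C. - e1 < \<epsilon> \<and> \<epsilon> < 0 \<and> \<gamma>1 \<epsilon> \<le> \<epsilon> * C \<and> \<epsilon> * C \<le> \<gamma>2 \<epsilon> \<longrightarrow>
        (\<exists>\<alpha> A. subharmonic_solution W \<omega> F G p q A0 \<epsilon> C \<alpha> A)"
    proof (intro allI impI, elim conjE)
      fix \<epsilon> C assume "- e1 < \<epsilon>" "\<epsilon> < 0" "\<gamma>1 \<epsilon> \<le> \<epsilon> * C" "\<epsilon> * C \<le> \<gamma>2 \<epsilon>"
      then show "\<exists>\<alpha> A. subharmonic_solution W \<omega> F G p q A0 \<epsilon> C \<alpha> A"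
        by (intro between) (simp_all add: \<gamma>1_def \<gamma>2_def)
    qed
    show "g1 0 = g2 0" by (fact g0)
  qed
qed

end
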